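(* Let $K$ be a field of characteristic zero, let $R = K[X_1,\ldots,X_n]$ and let $I, J$ be ideals in $R$. Let $A_n(K) = K\langle X_1,\ldots,X_n, \partial_1, \ldots, \partial_n\rangle$ be the $n$-th Weyl algebra over $K$. Then the Mayer-Vietoris sequence \[ \cdots \rightarrow H^{i}_{I+J}(R) \xrightarrow{\rho^i} H^i_I(R) \oplus H^i_J(R) \xrightarrow{\pi^i} H^i_{I\cap J}(R) \xrightarrow{\delta^i} H^{i+1}_{I+J}(R) \rightarrow \cdots \] is a sequence of $A_n(K)$-modules, i.e. all the maps $\rho^i$, $\pi^i$ and $\delta^i$ are $A_n(K)$-linear.
   Context: $R$ is a left $A_n(K)$-module in the usual way ($X_i$ acts by multiplication and $\partial_i$ by $\partial/\partial X_i$). $H^i_I(R)$ denotes the $i$-th local cohomology module of $R$ with support in $I$, i.e. the $i$-th right derived functor of $\Gamma_I$ applied to $R$, where for an $R$-module $N$, $\Gamma_I(N) = \{ m \in N \mid I^s m = 0 \text{ for some } s \geq 1\}$. Each $H^i_I(R)$ carries its standard left $A_n(K)$-module structure (for example, the one induced from the Čech complex on generators of $I$, whose terms are localizations of $R$ on which $\partial_i$ acts by the quotient rule). The Mayer-Vietoris sequence is the long exact cohomology sequence of the short exact sequence of complexes $0 \to \Gamma_{I+J}(E^\bullet) \to \Gamma_I(E^\bullet)\oplus \Gamma_J(E^\bullet) \to \Gamma_{I\cap J}(E^\bullet) \to 0$, where $E^\bullet$ is an injective resolution of $R$ as an $R$-module, the first map is $x \mapsto (x,x)$ and the second is $(x,y)\mapsto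 x-y$. *)

theory Defs
  imports
    "HOL-Library.Poly_Mapping"
    "HOL-Library.FuncSet"
    "HOL-Algebra.Algebra"
    "HOL-Algebra.Algebraic_Closure_Type"
begin

section \<open>Modules, linear maps, cohomology\<close>

text \<open>
  The library locale \<^locale>\<open>module\<close> is restricted to commutative scalars; modules over the Weyl
  algebra need the same axioms over an arbitrary ring. The fields \<open>mult\<close> and \<open>one\<close> that the
  module record inherits from the ring record play no role for modules.
\<close>

locale left_module = A?: ring A + M?: abelian_group M
  for A :: "('a, 'c) ring_scheme" (structure) and M :: "('a, 'b, 'd) module_scheme" (structure) +
  assumes smult_closed:
      "\<lbrakk>a \<in> carrier A; x \<in> carrier M\<rbrakk> \<Longrightarrow> a \<odot>\<^bsub>M\<^esub> x \<in> carrier M"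
    and smult_l_distr:
      "\<lbrakk>a \<in> carrier A; b \<in> carrier A; x \<in> carrier M\<rbrakk> \<Longrightarrow>
        (a \<oplus>\<^bsub>A\<^esub> b) \<odot>\<^bsub>M\<^esub> x = a \<odot>\<^bsub>M\<^esub> x \<oplus>\<^bsub>M\<^esub> b \<odot>\<^bsub>M\<^esub> x"
    and smult_r_distr:
      "\<lbrakk>a \<in> carrier A; x \<in> carrier M; y \<in> carrier M\<rbrakk> \<Longrightarrow>
        a \<odot>\<^bsub>M\<^esub> (x \<oplus>\<^bsub>M\<^esub> y) = a \<odot>\<^bsub>M\<^esub> x \<oplus>\<^bsub>M\<^esub> a \<odot>\<^bsub>M\<^esub> y"
    and smult_assoc:
      "\<lbrakk>a \<in> carrier A; b \<in> carrier A; x \<in> carrier M\<rbrakk> \<Longrightarrow>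
        (a \<otimes>\<^bsub>A\<^esub> b) \<odot>\<^bsub>M\<^esub> x = a \<odot>\<^bsub>M\<^esub> (b \<odot>\<^bsub>M\<^esub> x)"
    and smult_one: "x \<in> carrier M \<Longrightarrow> \<one>\<^bsub>A\<^esub> \<odot>\<^bsub>M\<^esub> x = x"

definition linear_maps ::
  "('a, 'c) ring_scheme \<Rightarrow> ('a, 'b) module \<Rightarrow> ('a, 'e) module \<Rightarrow> ('b \<Rightarrow> 'e) set" where
  "linear_maps A M N = {h \<in> carrier M \<rightarrow> carrier N.
     (\<forall>x\<in>carrier M. \<forall>y\<in>carrier M. h (x \<oplus>\<^bsub>M\<^esub> y) = h x \<oplus>\<^bsub>N\<^esub> h y) \<and>
     (\<forall>a\<in>carrier A. \<forall>x\<in>carrier M. h (a \<odot>\<^bsub>M\<^esub> x) = a \<odot>\<^bsub>N\<^esub> h x)}"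

definition self_module :: "'a ring \<Rightarrow> ('a, 'a) module" where
  "self_module R = \<lparr>carrier = carrier R, monoid.mult = monoid.mult R, one = one R,
     ring.zero = ring.zero R, add = add R, module.smult = monoid.mult R\<rparr>"

definition module_dsum :: "('a, 'b) module \<Rightarrow> ('a, 'c) module \<Rightarrow> ('a, 'b \<times> 'c) module" where
  "module_dsum M N = \<lparr>carrier = carrier M \<times> carrier N, monoid.mult = undefined, one = undefined,
     ring.zero = (\<zero>\<^bsub>M\<^esub>, \<zero>\<^bsub>N\<^esub>),
     add = (\<lambda>(x, y) (x', y'). (x \<oplus>\<^bsub>M\<^esub> x', y \<oplus>\<^bsub>N\<^esub> y')),
     module.smult = (\<lambda>a (x, y). (a \<odot>\<^bsub>M\<^esub> x, a \<odot>\<^bsub>N\<^esub> y))\<rparr>"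

text \<open>
  A cochain complex in degrees \<open>0, 1, 2, \<dots>\<close> is a sequence of modules \<open>C\<close> with maps
  \<open>d i\<close> from \<open>C i\<close> to \<open>C (Suc i)\<close>. Cohomology classes are additive cosets of the coboundaries.
\<close>

definition cocycles :: "(nat \<Rightarrow> ('a, 'b) module) \<Rightarrow> (nat \<Rightarrow> 'b \<Rightarrow> 'b) \<Rightarrow> nat \<Rightarrow> 'b set" where
  "cocycles C d i = {x \<in> carrier (C i). d i x = \<zero>\<^bsub>C (Suc i)\<^esub>}"

definition coboundaries :: "(nat \<Rightarrow> ('a, 'b) module) \<Rightarrow> (nat \<Rightarrow> 'b \<Rightarrow> 'b) \<Rightarrow> nat \<Rightarrow> 'b set" where
  "coboundaries C d i = (case i of 0 \<Rightarrow> {\<zero>\<^bsub>C 0\<^esub>} | Suc j \<Rightarrow> d j ` carrier (C j))"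

definition coh_class ::
  "(nat \<Rightarrow> ('a, 'b) module) \<Rightarrow> (nat \<Rightarrow> 'b \<Rightarrow> 'b) \<Rightarrow> nat \<Rightarrow> 'b \<Rightarrow> 'b set" where
  "coh_class C d i x = coboundaries C d i +>\<^bsub>C i\<^esub> x"

definition cohomology ::
  "(nat \<Rightarrow> ('a, 'b) module) \<Rightarrow> (nat \<Rightarrow> 'b \<Rightarrow> 'b) \<Rightarrow> nat \<Rightarrow> ('a, 'b set) module" where
  "cohomology C d i = \<lparr>carrier = coh_class C d i ` cocycles C d i,
     monoid.mult = undefined, one = undefined,
     ring.zero = coboundaries C d i,
     add = set_add (C i),
     module.smult = (\<lambda>a U. \<Union>x\<in>U. coh_class C d i (a \<odot>\<^bsub>C i\<^esub> x))\<rparr>"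

text \<open>
  The connecting homomorphism from the \<open>i\<close>-th cohomology of \<open>C\<close> to the \<open>i+1\<close>-st cohomology of \<open>A\<close>,
  for a short exact sequence of complexes \<open>0 \<rightarrow> A \<rightarrow> B \<rightarrow> C \<rightarrow> 0\<close> with maps \<open>f\<close> and \<open>g\<close>: lift a
  cocycle along \<open>g\<close>, apply the differential of \<open>B\<close>, pull back along \<open>f\<close>. Here and below, a map
  on classes is written as the union of its values on representatives.
\<close>

definition connecting_hom ::
  "(nat \<Rightarrow> ('a, 'u) module) \<Rightarrow> (nat \<Rightarrow> 'u \<Rightarrow> 'u) \<Rightarrow>
   (nat \<Rightarrow> ('a, 'v) module) \<Rightarrow> (nat \<Rightarrow> 'v \<Rightarrow> 'v) \<Rightarrow>
   (nat \<Rightarrow> 'u \<Rightarrow> 'v) \<Rightarrow> (nat \<Rightarrow> 'v \<Rightarrow> 'w) \<Rightarrow> nat \<Rightarrow> 'w set \<Rightarrow> 'u set" where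
  "connecting_hom A dA B dB f g i Z =
     \<Union>{coh_class A dA (Suc i) a | a b. a \<in> carrier (A (Suc i)) \<and> b \<in> carrier (B i) \<and>
        g i b \<in> Z \<and> dB i b = f (Suc i) a}"


section \<open>Injective resolutions and local cohomology\<close>

text \<open>
  HOL cannot quantify over the types of the test modules \<open>M\<close> and \<open>N\<close>, so they live on the element
  type of \<open>Q\<close>. In an injective resolution of \<open>R\<close> this is no restriction: \<open>R\<close> embeds into the zeroth
  term, so every ideal of \<open>R\<close> occurs as a test module, and by Baer's criterion \<open>Q\<close> is
  injective with respect to test modules on all other types as well.
\<close>

definition injective_module :: "'a ring \<Rightarrow> ('a, 'e) module \<Rightarrow> bool" where
  "injective_module R Q \<longleftrightarrow> module R Q \<and>
     (\<forall>(M :: ('a, 'e) module) (N :: ('a, 'e) module) f g.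
        module R M \<longrightarrow> module R N \<longrightarrow> f \<in> linear_maps R M N \<longrightarrow> inj_on f (carrier M) \<longrightarrow>
        g \<in> linear_maps R M Q \<longrightarrow>
        (\<exists>h \<in> linear_maps R N Q. \<forall>x\<in>carrier M. h (f x) = g x))"

locale injective_resolution =
  fixes R :: "'a ring" and M :: "('a, 'm) module"
    and E :: "nat \<Rightarrow> ('a, 'e) module" and d :: "nat \<Rightarrow> 'e \<Rightarrow> 'e" and \<epsilon> :: "'m \<Rightarrow> 'e"
  assumes injective: "\<And>i. injective_module R (E i)"
    and augmentation: "\<epsilon> \<in> linear_maps R M (E 0)"
    and differential: "\<And>i. d i \<in> linear_maps R (E i) (E (Suc i))"
    and augmentation_inj: "inj_on \<epsilon> (carrier M)"
    and exact_0: "\<epsilon> ` carrier M = {x \<in> carrier (E 0). d 0 x = \<zero>\<^bsub>E 1\<^esub>}"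
    and exact_Suc: "\<And>i. d i ` carrier (E i) =
          {x \<in> carrier (E (Suc i)). d (Suc i) x = \<zero>\<^bsub>E (Suc (Suc i))\<^esub>}"

definition Gamma :: "'a ring \<Rightarrow> 'a set \<Rightarrow> ('a, 'e) module \<Rightarrow> ('a, 'e) module" where
  "Gamma R I N = N\<lparr>carrier := {m \<in> carrier N.
     \<exists>s::nat. s \<ge> 1 \<and> (\<forall>a \<in> I [^]\<^bsub>ideals_set R\<^esub> s. a \<odot>\<^bsub>N\<^esub> m = \<zero>\<^bsub>N\<^esub>)}\<rparr>"

definition Gamma_complex ::
  "'a ring \<Rightarrow> (nat \<Rightarrow> ('a, 'e) module) \<Rightarrow> 'a set \<Rightarrow> nat \<Rightarrow> ('a, 'e) module" where
  "Gamma_complex R E I = (\<lambda>q. Gamma R I (E q))"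

definition local_cohomology ::
  "'a ring \<Rightarrow> (nat \<Rightarrow> ('a, 'e) module) \<Rightarrow> (nat \<Rightarrow> 'e \<Rightarrow> 'e) \<Rightarrow> 'a set \<Rightarrow> nat \<Rightarrow> ('a, 'e set) module" where
  "local_cohomology R E d I i = cohomology (Gamma_complex R E I) d i"


section \<open>The maps of the Mayer--Vietoris sequence\<close>

definition MV_rho ::
  "'a ring \<Rightarrow> (nat \<Rightarrow> ('a, 'e) module) \<Rightarrow> (nat \<Rightarrow> 'e \<Rightarrow> 'e) \<Rightarrow> 'a set \<Rightarrow> 'a set \<Rightarrow> nat \<Rightarrow>
   'e set \<Rightarrow> 'e set \<times> 'e set" where
  "MV_rho R E d I J i U =
     (\<Union>x\<in>U. coh_class (Gamma_complex R E I) d i x, \<Union>x\<in>U. coh_class (Gamma_complex R E J) d i x)"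

definition MV_pi ::
  "'a ring \<Rightarrow> (nat \<Rightarrow> ('a, 'e) module) \<Rightarrow> (nat \<Rightarrow> 'e \<Rightarrow> 'e) \<Rightarrow> 'a set \<Rightarrow> 'a set \<Rightarrow> nat \<Rightarrow>
   'e set \<times> 'e set \<Rightarrow> 'e set" where
  "MV_pi R E d I J i = (\<lambda>(U, V).
     \<Union>x\<in>U. \<Union>y\<in>V. coh_class (Gamma_complex R E (I \<inter> J)) d i (x \<ominus>\<^bsub>E i\<^esub> y))"

definition MV_delta ::
  "'a ring \<Rightarrow> (nat \<Rightarrow> ('a, 'e) module) \<Rightarrow> (nat \<Rightarrow> 'e \<Rightarrow> 'e) \<Rightarrow> 'a set \<Rightarrow> 'a set \<Rightarrow> nat \<Rightarrow>
   'e set \<Rightarrow> 'e set" where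
  "MV_delta R E d I J i = connecting_hom
     (Gamma_complex R E (I <+>\<^bsub>R\<^esub> J)) d
     (\<lambda>q. module_dsum (Gamma_complex R E I q) (Gamma_complex R E J q)) (\<lambda>q. map_prod (d q) (d q))
     (\<lambda>q x. (x, x)) (\<lambda>q (x, y). x \<ominus>\<^bsub>E q\<^esub> y) i"


section \<open>Localization at an element and the Cech complex\<close>

text \<open>The pair \<open>(m, k)\<close> stands for the fraction \<open>m / f^k\<close>.\<close>

definition loc_rel :: "'a ring \<Rightarrow> 'a \<Rightarrow> ('a, 'e) module \<Rightarrow> (('e \<times> nat) \<times> ('e \<times> nat)) set" where
  "loc_rel R f M = {((m, k), (n, l)). m \<in> carrier M \<and> n \<in> carrier M \<and>
     (\<exists>t::nat. (f [^]\<^bsub>R\<^esub> (t + l)) \<odot>\<^bsub>M\<^esub> m = (f [^]\<^bsub>R\<^esub> (t + k)) \<odot>\<^bsub>M\<^esub> n)}"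

definition fraction :: "'a ring \<Rightarrow> 'a \<Rightarrow> ('a, 'e) module \<Rightarrow> 'e \<Rightarrow> nat \<Rightarrow> ('e \<times> nat) set" where
  "fraction R f M m k = loc_rel R f M `` {(m, k)}"

definition localization :: "'a ring \<Rightarrow> 'a \<Rightarrow> ('a, 'e) module \<Rightarrow> ('a, ('e \<times> nat) set) module" where
  "localization R f M = \<lparr>carrier = (carrier M \<times> UNIV) // loc_rel R f M,
     monoid.mult = undefined, one = undefined,
     ring.zero = fraction R f M \<zero>\<^bsub>M\<^esub> 0,
     add = (\<lambda>C D. \<Union>(m, k)\<in>C. \<Union>(n, l)\<in>D.
       fraction R f M ((f [^]\<^bsub>R\<^esub> l) \<odot>\<^bsub>M\<^esub> m \<oplus>\<^bsub>M\<^esub> (f [^]\<^bsub>R\<^esub> k) \<odot>\<^bsub>M\<^esub> n) (k + l)),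
     module.smult = (\<lambda>a C. \<Union>(m, k)\<in>C. fraction R f M (a \<odot>\<^bsub>M\<^esub> m) k)\<rparr>"

definition loc_functor ::
  "'a ring \<Rightarrow> 'a \<Rightarrow> ('a, 'e) module \<Rightarrow> ('m \<Rightarrow> 'e) \<Rightarrow> ('m \<times> nat) set \<Rightarrow> ('e \<times> nat) set" where
  "loc_functor R f N \<phi> C = (\<Union>(m, k)\<in>C. fraction R f N (\<phi> m) k)"

text \<open>The canonical map from the localization at \<open>f\<close> to the localization at \<open>f g\<close>.\<close>

definition loc_restrict ::
  "'a ring \<Rightarrow> 'a \<Rightarrow> 'a \<Rightarrow> ('a, 'e) module \<Rightarrow> ('e \<times> nat) set \<Rightarrow> ('e \<times> nat) set" where
  "loc_restrict R f g M C =
     (\<Union>(m, k)\<in>C. fraction R (f \<otimes>\<^bsub>R\<^esub> g) M ((g [^]\<^bsub>R\<^esub> k) \<odot>\<^bsub>M\<^esub> m) k)"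

text \<open>
  For a list \<open>fs\<close> of elements of \<open>R\<close>, the degree \<open>p\<close> term of the Cech complex is the product, over the
  \<open>p\<close>-element sets \<open>S\<close> of positions in \<open>fs\<close>, of the localizations at the products \<open>cech_elt R fs S\<close>;
  it starts in degree \<open>0\<close> with the module itself (localized at the empty product).
\<close>

definition cech_index :: "'a list \<Rightarrow> nat \<Rightarrow> nat set set" where
  "cech_index fs p = {S. S \<subseteq> {..<length fs} \<and> card S = p}"

definition cech_elt :: "'a ring \<Rightarrow> 'a list \<Rightarrow> nat set \<Rightarrow> 'a" where
  "cech_elt R fs S = (\<Otimes>\<^bsub>R\<^esub>j\<in>S. fs ! j)"

definition cech_cochains ::
  "'a ring \<Rightarrow> 'a list \<Rightarrow> ('a, 'e) module \<Rightarrow> nat \<Rightarrow> (nat set \<Rightarrow> ('e \<times> nat) set) set" where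
  "cech_cochains R fs M p =
     (\<Pi>\<^sub>E S\<in>cech_index fs p. carrier (localization R (cech_elt R fs S) M))"

definition cech_diff ::
  "'a ring \<Rightarrow> 'a list \<Rightarrow> ('a, 'e) module \<Rightarrow> nat \<Rightarrow>
   (nat set \<Rightarrow> ('e \<times> nat) set) \<Rightarrow> nat set \<Rightarrow> ('e \<times> nat) set" where
  "cech_diff R fs M p c = (\<lambda>S\<in>cech_index fs (Suc p).
     \<Oplus>\<^bsub>localization R (cech_elt R fs S) M\<^esub>j\<in>S.
       ((\<ominus>\<^bsub>R\<^esub> \<one>\<^bsub>R\<^esub>) [^]\<^bsub>R\<^esub> card {l \<in> S. l < j})
         \<odot>\<^bsub>localization R (cech_elt R fs S) M\<^esub>
       loc_restrict R (cech_elt R fs (S - {j})) (fs ! j) M (c (S - {j})))"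

definition cech_cocycles ::
  "'a ring \<Rightarrow> 'a list \<Rightarrow> ('a, 'e) module \<Rightarrow> nat \<Rightarrow> (nat set \<Rightarrow> ('e \<times> nat) set) set" where
  "cech_cocycles R fs M p = {c \<in> cech_cochains R fs M p.
     cech_diff R fs M p c =
       (\<lambda>S\<in>cech_index fs (Suc p). \<zero>\<^bsub>localization R (cech_elt R fs S) M\<^esub>)}"

text \<open>
  The canonical isomorphism between the \<open>i\<close>-th cohomology of \<open>\<Gamma>\<^sub>I(E)\<close> and the \<open>i\<close>-th Cech
  cohomology of \<open>M\<close>, where \<open>E\<close> is an injective resolution of \<open>M\<close> and \<open>fs\<close> generates \<open>I\<close>, comes from the
  double complex with entries \<open>cech_cochains R fs (E q) p\<close>: it receives \<open>\<Gamma>\<^sub>I(E)\<close> along the edge \<open>p = 0\<close>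
  and the Cech complex of \<open>M\<close> along the edge \<open>q = 0\<close>, and both edge maps are quasi-isomorphisms into
  the total complex. In terms of representatives, \<open>x\<close> corresponds to \<open>c\<close> if they are joined by a
  staircase of elements \<open>v p\<close> in position \<open>(p, i - p)\<close>, consecutive ones having a common origin in
  position \<open>(p, i - 1 - p)\<close>. The signs of the total complex are absorbed into the \<open>v p\<close>; this changes
  the isomorphism at most by a sign depending only on \<open>i\<close>, and so does not affect the module
  structures transported along it.
\<close>

definition cech_corresponds ::
  "'a ring \<Rightarrow> (nat \<Rightarrow> ('a, 'e) module) \<Rightarrow> (nat \<Rightarrow> 'e \<Rightarrow> 'e) \<Rightarrow> ('m \<Rightarrow> 'e) \<Rightarrow> 'a list \<Rightarrow> nat \<Rightarrow>
   'e \<Rightarrow> (nat set \<Rightarrow> ('m \<times> nat) set) \<Rightarrow> bool" where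
  "cech_corresponds R E d \<epsilon> fs i x c \<longleftrightarrow> (\<exists>v.
     v 0 = (\<lambda>S\<in>cech_index fs 0. fraction R (cech_elt R fs S) (E i) x 0) \<and>
     v i = (\<lambda>S\<in>cech_index fs i. loc_functor R (cech_elt R fs S) (E 0) \<epsilon> (c S)) \<and>
     (\<forall>p<i. \<exists>u \<in> cech_cochains R fs (E (i - 1 - p)) p.
        v p = (\<lambda>S\<in>cech_index fs p.
          loc_functor R (cech_elt R fs S) (E (i - p)) (d (i - 1 - p)) (u S)) \<and>
        v (Suc p) = cech_diff R fs (E (i - 1 - p)) p u))"


section \<open>The Weyl algebra\<close>

text \<open>
  \<open>('n, 'k) mpoly\<close> is the polynomial ring over \<open>'k\<close> with one variable for each element of the finite
  type \<open>'n\<close>.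
\<close>

type_synonym ('n, 'k) mpoly = "('n \<Rightarrow>\<^sub>0 nat) \<Rightarrow>\<^sub>0 'k"

abbreviation mpoly_ring :: "('n::finite, 'k::field_char_0) mpoly ring" where
  "mpoly_ring \<equiv> ring_of_type_algebra"

definition Const :: "'k \<Rightarrow> ('n::finite, 'k::field_char_0) mpoly" where
  "Const c = Poly_Mapping.single 0 c"

definition Var :: "'n \<Rightarrow> ('n::finite, 'k::field_char_0) mpoly" where
  "Var i = Poly_Mapping.single (Poly_Mapping.single i 1) 1"

definition partial_deriv ::
  "'n \<Rightarrow> ('n::finite, 'k::field_char_0) mpoly \<Rightarrow> ('n, 'k) mpoly" where
  "partial_deriv i p = (\<Sum>m\<in>Poly_Mapping.keys p.
     Poly_Mapping.single (m - Poly_Mapping.single i 1)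
       (of_nat (Poly_Mapping.lookup m i) * Poly_Mapping.lookup p m))"

text \<open>
  Over a field of characteristic zero the Weyl algebra is the subalgebra of the endomorphism ring
  of the polynomial ring generated by the constants, the variables and the partial derivatives.
\<close>

inductive_set weyl_ops :: "(('n::finite, 'k::field_char_0) mpoly \<Rightarrow> ('n, 'k) mpoly) set" where
  const: "(\<lambda>p. Const c * p) \<in> weyl_ops"
| var: "(\<lambda>p. Var i * p) \<in> weyl_ops"
| deriv: "partial_deriv i \<in> weyl_ops"
| add: "P \<in> weyl_ops \<Longrightarrow> Q \<in> weyl_ops \<Longrightarrow> (\<lambda>p. P p + Q p) \<in> weyl_ops"
| comp: "P \<in> weyl_ops \<Longrightarrow> Q \<in> weyl_ops \<Longrightarrow> P \<circ> Q \<in> weyl_ops"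

definition weyl_algebra :: "(('n::finite, 'k::field_char_0) mpoly \<Rightarrow> ('n, 'k) mpoly) ring" where
  "weyl_algebra = \<lparr>carrier = weyl_ops, monoid.mult = (\<circ>), one = id,
     ring.zero = (\<lambda>p. 0), add = (\<lambda>P Q p. P p + Q p)\<rparr>"


section \<open>The Weyl algebra structure on local cohomology\<close>

abbreviation poly_loc ::
  "('n::finite, 'k::field_char_0) mpoly \<Rightarrow> (('n, 'k) mpoly, (('n, 'k) mpoly \<times> nat) set) module" where
  "poly_loc f \<equiv> localization mpoly_ring f (self_module mpoly_ring)"

text \<open>The quotient rule for \<open>r / f^k\<close>.\<close>

definition loc_deriv ::
  "('n::finite, 'k::field_char_0) mpoly \<Rightarrow> 'n \<Rightarrow>
   (('n, 'k) mpoly \<times> nat) set \<Rightarrow> (('n, 'k) mpoly \<times> nat) set" where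
  "loc_deriv f i C = (\<Union>(r, k)\<in>C. fraction mpoly_ring f (self_module mpoly_ring)
     (partial_deriv i r * f ^ k - r * partial_deriv i (f ^ k)) (2 * k))"

text \<open>
  \<open>weyl_loc_rep f P T\<close>: some expression of \<open>P\<close> in terms of the generators of the Weyl algebra, evaluated
  at the corresponding operators on the localization at \<open>f\<close>, yields \<open>T\<close>. On the
  localization, \<open>T\<close> depends only on \<open>P\<close>, not on the expression.
\<close>

inductive weyl_loc_rep ::
  "('n::finite, 'k::field_char_0) mpoly \<Rightarrow> (('n, 'k) mpoly \<Rightarrow> ('n, 'k) mpoly) \<Rightarrow>
   ((('n, 'k) mpoly \<times> nat) set \<Rightarrow> (('n, 'k) mpoly \<times> nat) set) \<Rightarrow> bool" for f where
  const: "weyl_loc_rep f (\<lambda>p. Const c * p) (\<lambda>C. Const c \<odot>\<^bsub>poly_loc f\<^esub> C)"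
| var: "weyl_loc_rep f (\<lambda>p. Var i * p) (\<lambda>C. Var i \<odot>\<^bsub>poly_loc f\<^esub> C)"
| deriv: "weyl_loc_rep f (partial_deriv i) (loc_deriv f i)"
| add: "weyl_loc_rep f P S \<Longrightarrow> weyl_loc_rep f Q T \<Longrightarrow>
    weyl_loc_rep f (\<lambda>p. P p + Q p) (\<lambda>C. S C \<oplus>\<^bsub>poly_loc f\<^esub> T C)"
| comp: "weyl_loc_rep f P S \<Longrightarrow> weyl_loc_rep f Q T \<Longrightarrow> weyl_loc_rep f (P \<circ> Q) (S \<circ> T)"

definition weyl_loc_act ::
  "('n::finite, 'k::field_char_0) mpoly \<Rightarrow> (('n, 'k) mpoly \<Rightarrow> ('n, 'k) mpoly) \<Rightarrow>
   (('n, 'k) mpoly \<times> nat) set \<Rightarrow> (('n, 'k) mpoly \<times> nat) set" where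
  "weyl_loc_act f P C = (THE D. \<exists>T. weyl_loc_rep f P T \<and> D = T C)"

definition weyl_cech_act ::
  "('n::finite, 'k::field_char_0) mpoly list \<Rightarrow> nat \<Rightarrow> (('n, 'k) mpoly \<Rightarrow> ('n, 'k) mpoly) \<Rightarrow>
   (nat set \<Rightarrow> (('n, 'k) mpoly \<times> nat) set) \<Rightarrow> nat set \<Rightarrow> (('n, 'k) mpoly \<times> nat) set" where
  "weyl_cech_act fs i P c =
     (\<lambda>S\<in>cech_index fs i. weyl_loc_act (cech_elt mpoly_ring fs S) P (c S))"

text \<open>
  The local cohomology of the polynomial ring with support in the ideal \<open>I\<close> as a module over the Weyl
  algebra: the action on the Cech complex of a list \<open>fs\<close> of generators of \<open>I\<close> is transported
  along the canonical isomorphism.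
\<close>

definition weyl_local_cohomology ::
  "(nat \<Rightarrow> (('n::finite, 'k::field_char_0) mpoly, 'e) module) \<Rightarrow> (nat \<Rightarrow> 'e \<Rightarrow> 'e) \<Rightarrow>
   (('n, 'k) mpoly \<Rightarrow> 'e) \<Rightarrow> ('n, 'k) mpoly list \<Rightarrow> ('n, 'k) mpoly set \<Rightarrow> nat \<Rightarrow>
   (('n, 'k) mpoly \<Rightarrow> ('n, 'k) mpoly, 'e set) module" where
  "weyl_local_cohomology E d \<epsilon> fs I i = (let H = local_cohomology mpoly_ring E d I i in
     \<lparr>carrier = carrier H, monoid.mult = monoid.mult H, one = one H, ring.zero = ring.zero H, add = add H,
      module.smult = (\<lambda>P U. THE V. V \<in> carrier H \<and>
        (\<exists>x\<in>U. \<exists>y\<in>V. \<exists>c \<in> cech_cocycles mpoly_ring fs (self_module mpoly_ring) i.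
           cech_corresponds mpoly_ring E d \<epsilon> fs i x c \<and>
           cech_corresponds mpoly_ring E d \<epsilon> fs i y (weyl_cech_act fs i P c)))\<rparr>)"

end

theory Submission
  imports Defs
begin

text \<open>
  The derivative \<open>\<partial>\<^sub>i\<close> of the polynomial ring lifts to the injective resolution \<open>E\<close>: an additive
  map \<open>D\<close> with \<open>D (a x) = \<partial>\<^sub>i(a) x + a D x\<close> on an injective module \<open>M\<close> is the same as a splitting of
  an extension of \<open>M\<close> by \<open>M\<close>, and such maps can be corrected by linear ones so that they commute with
  the differentials and the augmentation. Hence every operator \<open>P\<close> of the Weyl algebra lifts to additive
  chain maps of \<open>E\<close>. They preserve torsion, so they act on \<open>\<Gamma>\<^sub>I(E)\<close> for every ideal \<open>I\<close>, compatibly with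
  the inclusions, differences and differentials from which the Mayer--Vietoris maps are built; and they
  act on the staircases of the Cech double complex, so that on cohomology they induce the action
  transported from the Cech complex.

  The transport is well-defined because the Cech complex of an injective module \<open>M\<close> is exact in
  positive degrees. This, and the surjectivity of \<open>\<Gamma>\<^sub>I(M) \<oplus> \<Gamma>\<^sub>J(M) \<rightarrow> \<Gamma>\<^bsub>I \<inter> J\<^esub>(M)\<close>, follow from Baer's
  criterion and a decomposition of annihilators over the Noetherian polynomial ring.
\<close>

section \<open>Ideals of Noetherian rings\<close>

text \<open>The scalar action is defined separately for each ideal, through the Cech complex of a
  chosen list of generators, whereas the sequence compares \<open>I + J\<close>, \<open>I\<close>,
  \<open>J\<close> and \<open>I \<inter> J\<close> with unrelated lists. A direct proof would have
  to relate Cech complexes of different lists. A lift \<open>L\<close> of an operator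
  \<open>P\<close> avoids this: it is chosen on \<open>E\<close> with no reference to an ideal or a
  list, and \<open>weyl_smult_cls\<close> says that \<open>P\<close> sends the class of
  \<open>x\<close> to the class of \<open>L x\<close> for every ideal and every list generating it.
  Any lift will do, so homotopies between lifts never enter, and each module axiom can use the lift
  that suits it. The obstacle is that \<open>L\<close> is not linear over the ring, so annihilation
  by a fixed power of an ideal need not be preserved. The Leibniz rule still gives a torsion
  statement: \<open>f^n x = 0\<close> implies \<open>f^(2n) D x = 0\<close>. This is why torsion is
  recorded elementwise, as the ideal \<open>tors x\<close> of those \<open>f\<close> some power of
  which kills \<open>x\<close>, and why the chain condition is used to identify \<Gamma>_I with the
  condition \<open>I \<subseteq> tors x\<close>.\<close>

definition ring_ideal :: "'a::comm_ring_1 set \<Rightarrow> bool" where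
  "ring_ideal I \<longleftrightarrow> 0 \<in> I \<and> (\<forall>a\<in>I. \<forall>b\<in>I. a + b \<in> I) \<and> (\<forall>r. \<forall>a\<in>I. r * a \<in> I)"

lemma ring_idealI:
  "0 \<in> I \<Longrightarrow> (\<And>a b. a \<in> I \<Longrightarrow> b \<in> I \<Longrightarrow> a + b \<in> I) \<Longrightarrow> (\<And>r a. a \<in> I \<Longrightarrow> r * a \<in> I) \<Longrightarrow> ring_ideal I"
  by (auto simp: ring_ideal_def)

lemma ring_idealD:
  assumes "ring_ideal I"
  shows "0 \<in> I" "a \<in> I \<Longrightarrow> b \<in> I \<Longrightarrow> a + b \<in> I" "a \<in> I \<Longrightarrow> r * a \<in> I" "a \<in> I \<Longrightarrow> a * r \<in> I"
    "a \<in> I \<Longrightarrow> - a \<in> I" "a \<in> I \<Longrightarrow> b \<in> I \<Longrightarrow> a - b \<in> I"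
proof -
  show *: "0 \<in> I" "a \<in> I \<Longrightarrow> b \<in> I \<Longrightarrow> a + b \<in> I" "\<And>r a. a \<in> I \<Longrightarrow> r * a \<in> I" for a b
    using assms by (auto simp: ring_ideal_def)
  show "a \<in> I \<Longrightarrow> a * r \<in> I" using *(3)[of a r] by (simp add: mult.commute)
  have neg: "a \<in> I \<Longrightarrow> - a \<in> I" for a using *(3)[of a "-1"] by simp
  then show "a \<in> I \<Longrightarrow> - a \<in> I" .
  show "a \<in> I \<Longrightarrow> b \<in> I \<Longrightarrow> a - b \<in> I" using *(2)[of a "-b"] neg[of b] by simp
qed

abbreviation (input) rta :: "'a::comm_ring_1 ring" where
  "rta \<equiv> ring_of_type_algebra"

lemma rta_simps [simp]:
  "carrier (rta :: 'a::comm_ring_1 ring) = UNIV"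
  "monoid.mult (rta :: 'a ring) = (*)"
  "one (rta :: 'a ring) = 1"
  "ring.zero (rta :: 'a ring) = 0"
  "add (rta :: 'a ring) = (+)"
  by (auto simp: ring_of_type_algebra_def)

lemma cring_rta: "cring (rta :: 'a::comm_ring_1 ring)"
  by (rule cring_from_type_algebra)

lemma rta_a_inv [simp]: "\<ominus>\<^bsub>(rta :: 'a::comm_ring_1 ring)\<^esub> a = - a"
proof -
  interpret cring "rta :: 'a ring" by (rule cring_rta)
  show ?thesis by (rule minus_equality) simp_all
qed

lemma rta_pow [simp]: "a [^]\<^bsub>(rta :: 'a::comm_ring_1 ring)\<^esub> (n::nat) = a ^ n"
  by (induction n) (simp_all add: nat_pow_def mult.commute)

lemma rta_finprod: "finprod (rta :: 'a::comm_ring_1 ring) f A = prod f A"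
proof -
  interpret cring "rta :: 'a ring" by (rule cring_rta)
  show ?thesis by (induction A rule: infinite_finite_induct) simp_all
qed

lemma ideal_rta_iff: "ideal I (rta :: 'a::comm_ring_1 ring) \<longleftrightarrow> ring_ideal I"
proof
  assume "ideal I (rta :: 'a ring)"
  then interpret ideal I "rta :: 'a ring" .
  show "ring_ideal I"
    by (rule ring_idealI) (use additive_subgroup.zero_closed[OF is_additive_subgroup]
      additive_subgroup.a_closed[OF is_additive_subgroup] I_l_closed in auto)
next
  assume I: "ring_ideal I"
  interpret cring "rta :: 'a ring" by (rule cring_rta)
  have "subgroup I (add_monoid (rta :: 'a ring))"
    by (rule add.subgroupI) (use ring_idealD[OF I] in auto)
  then show "ideal I (rta :: 'a ring)"
    by (rule idealI[OF ring_axioms]) (use ring_idealD[OF I] in auto)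
qed

section \<open>Radicals of ideals\<close>

definition ideal_radical :: "'a::comm_ring_1 set \<Rightarrow> 'a set" where
  "ideal_radical I = {f. \<exists>n. f ^ n \<in> I}"

lemma ideal_radical_upper: "I \<subseteq> ideal_radical I"
  unfolding ideal_radical_def by (auto intro: exI[of _ 1])

lemma ideal_radical_mono: "I \<subseteq> J \<Longrightarrow> ideal_radical I \<subseteq> ideal_radical J"
  unfolding ideal_radical_def by auto

lemma power_in_ideal_mono:
  "ring_ideal I \<Longrightarrow> f ^ n \<in> I \<Longrightarrow> n \<le> m \<Longrightarrow> f ^ m \<in> I"
  using ring_idealD(3)[of I "f ^ n" "f ^ (m - n)"] by (simp add: power_add[symmetric])

lemma ideal_radical_Int:
  assumes "ring_ideal I" "ring_ideal J"
  shows "ideal_radical (I \<inter> J) = ideal_radical I \<inter> ideal_radical J"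
proof -
  have "f \<in> ideal_radical (I \<inter> J)" if "f ^ m \<in> I" "f ^ n \<in> J" for f m n
    using power_in_ideal_mono[OF assms(1) that(1), of "max m n"]
      power_in_ideal_mono[OF assms(2) that(2), of "max m n"] by (auto simp: ideal_radical_def)
  then show ?thesis by (auto simp: ideal_radical_def)
qed

lemma ring_ideal_radical:
  assumes I: "ring_ideal I" shows "ring_ideal (ideal_radical I)"
proof (rule ring_idealI)
  show "0 \<in> ideal_radical I" using ideal_radical_upper ring_idealD(1)[OF I] by blast
  show "r * f \<in> ideal_radical I" if "f \<in> ideal_radical I" for r f
    using that ring_idealD(3)[OF I] by (auto simp: ideal_radical_def power_mult_distrib)
  fix f g assume "f \<in> ideal_radical I" "g \<in> ideal_radical I"
  then obtain m n where mn: "f ^ m \<in> I" "g ^ n \<in> I" by (auto simp: ideal_radical_def)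
  have summand: "of_nat ((m + n) choose k) * f ^ k * g ^ (m + n - k) \<in> I" if "k \<le> m + n" for k
  proof (cases "m \<le> k")
    case True
    show ?thesis using power_in_ideal_mono[OF I mn(1) True] ring_idealD(3,4)[OF I] by simp
  next
    case False
    then have "g ^ (m + n - k) \<in> I" using power_in_ideal_mono[OF I mn(2)] by simp
    then show ?thesis using ring_idealD(3)[OF I] by simp
  qed
  have "(\<Sum>k\<in>K. of_nat ((m + n) choose k) * f ^ k * g ^ (m + n - k)) \<in> I"
    if "finite K" "K \<subseteq> {..m + n}" for K
    using that by (induction K) (use summand ring_idealD(1,2)[OF I] in auto)
  then show "f + g \<in> ideal_radical I" by (auto simp: ideal_radical_def binomial_ring intro!: exI[of _ "m + n"])
qed

lemma ideal_radical_idem: "ideal_radical (ideal_radical I) = ideal_radical I"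
proof -
  have "f \<in> ideal_radical I" if "f ^ m \<in> ideal_radical I" for f m
    using that by (auto simp: ideal_radical_def power_mult[symmetric])
  then show ?thesis using ideal_radical_upper by (force simp: ideal_radical_def)
qed

section \<open>The ascending chain condition\<close>

definition acc_ideals :: "'a::comm_ring_1 itself \<Rightarrow> bool" where
  "acc_ideals _ \<longleftrightarrow> wfP (\<lambda>J I :: 'a set. ring_ideal I \<and> ring_ideal J \<and> I \<subset> J)"

text \<open>The relation in \<open>acc_ideals\<close> is reverse inclusion, so well-founded
  induction moves upwards: the claim may be assumed for all strictly larger ideals.\<close>

lemma noetherian_induct [consumes 2, case_names less]:
  fixes A :: "'a::comm_ring_1 set"
  assumes "acc_ideals TYPE('a)" "ring_ideal A"
    and "\<And>A. ring_ideal A \<Longrightarrow> (\<And>B. ring_ideal B \<Longrightarrow> A \<subset> B \<Longrightarrow> P B) \<Longrightarrow> P A"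
  shows "P A"
  using assms(2)
  by (induction A rule: wfp_induct[OF assms(1)[unfolded acc_ideals_def]]) (use assms(3) in blast)

definition adjoin :: "'a::comm_ring_1 set \<Rightarrow> 'a \<Rightarrow> 'a set" where
  "adjoin A g = {a + r * g | a r. a \<in> A}"

lemma ring_ideal_adjoin:
  assumes A: "ring_ideal A" shows "ring_ideal (adjoin A g)"
proof (rule ring_idealI)
  show "0 \<in> adjoin A g"
    using ring_idealD(1)[OF A] by (auto simp: adjoin_def intro!: exI[of _ 0])
  fix x y s assume "x \<in> adjoin A g"
  then obtain a r where x: "x = a + r * g" "a \<in> A" by (auto simp: adjoin_def)
  have "s * x = s * a + s * r * g" by (simp add: x algebra_simps)
  then show "s * x \<in> adjoin A g" using x ring_idealD(3)[OF A] by (auto simp: adjoin_def)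
  assume "y \<in> adjoin A g"
  then obtain b t where y: "y = b + t * g" "b \<in> A" by (auto simp: adjoin_def)
  have "x + y = (a + b) + (r + t) * g" by (simp add: x y algebra_simps)
  then show "x + y \<in> adjoin A g"
    using ring_idealD(2)[OF A x(2) y(2)] unfolding adjoin_def by blast
qed

lemma adjoin_upper: "A \<subseteq> adjoin A g"
  by (force simp: adjoin_def intro: exI[of _ 0])

lemma adjoin_self: "ring_ideal A \<Longrightarrow> g \<in> adjoin A g"
  using ring_idealD(1) by (force simp: adjoin_def intro: exI[of _ 1])

text \<open>The ideal quotient \<open>(A : f)\<close>. Together with \<open>adjoin\<close>, which is
  \<open>A + (g)\<close>, it supplies the two strictly larger ideals to which each Noetherian
  induction below passes.\<close>

definition colon :: "'a::comm_ring_1 set \<Rightarrow> 'a \<Rightarrow> 'a set" where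
  "colon A f = {a. a * f \<in> A}"

lemma ring_ideal_colon: "ring_ideal A \<Longrightarrow> ring_ideal (colon A f)"
  by (rule ring_idealI) (auto simp: colon_def ring_idealD distrib_right mult.assoc)

lemma colon_upper: "ring_ideal A \<Longrightarrow> A \<subseteq> colon A f"
  by (auto simp: colon_def ring_idealD)

text \<open>The quotients of \<open>A\<close> by the powers of \<open>f\<close> form an ascending
  chain; by the chain condition one of them is maximal and hence contains all the others.\<close>

lemma colon_power_stable:
  fixes A :: "'a::comm_ring_1 set"
  assumes acc: "acc_ideals TYPE('a)" and A: "ring_ideal A"
  shows "\<exists>m. \<forall>n. \<forall>a. a * f ^ n \<in> A \<longrightarrow> a * f ^ m \<in> A"
proof -
  have mono: "colon A (f ^ m) \<subseteq> colon A (f ^ n)" if "m \<le> n" for m n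
    using that ring_idealD(4)[OF A, of "a * f ^ m" "f ^ (n - m)" for a]
    by (auto simp: colon_def mult.assoc power_add[symmetric])
  define Q where "Q = range (\<lambda>n. colon A (f ^ n))"
  have "colon A (f ^ 0) \<in> Q" unfolding Q_def by blast
  then obtain B where "B \<in> Q" and max: "\<And>C. ring_ideal B \<Longrightarrow> ring_ideal C \<Longrightarrow> B \<subset> C \<Longrightarrow> C \<notin> Q"
    using acc unfolding acc_ideals_def wfp_iff_ex_minimal by (metis (no_types, lifting) empty_iff)
  then obtain m where B: "B = colon A (f ^ m)" by (auto simp: Q_def)
  have "colon A (f ^ n) \<subseteq> B" for n
  proof -
    have "\<not> B \<subset> colon A (f ^ max m n)"
      using max ring_ideal_colon[OF A] by (auto simp: B Q_def)
    then show ?thesis using mono[of m "max m n"] mono[of n "max m n"] by (auto simp: B)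
  qed
  then show ?thesis by (auto simp: colon_def B)
qed

section \<open>Powers of ideals\<close>

lemma ideals_pow_Suc:
  "I [^]\<^bsub>ideals_set R\<^esub> Suc n = ideal_prod R (I [^]\<^bsub>ideals_set R\<^esub> n) I"
  by (simp add: nat_pow_def ideals_set_def)

lemma ideal_prod_subset:
  fixes A :: "'a::comm_ring_1 set"
  assumes "ring_ideal A" "\<And>a b. a \<in> I \<Longrightarrow> b \<in> J \<Longrightarrow> a * b \<in> A"
  shows "ideal_prod rta I J \<subseteq> A"
proof
  fix x assume "x \<in> ideal_prod rta I J"
  then show "x \<in> A" by induction (use assms ring_idealD(2) in auto)
qed

context
  fixes I :: "'a::comm_ring_1 set"
  assumes I: "ring_ideal I"
begin

interpretation rta: cring "rta :: 'a ring" by (rule cring_rta)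
interpretation ids: comm_monoid "ideals_set (rta :: 'a ring)"
  by (rule rta.ideals_set_is_comm_monoid)

lemma ideals_pow_one: "I [^]\<^bsub>ideals_set rta\<^esub> (1::nat) = I"
  using I by (subst ids.nat_pow_eone) (auto simp: ideals_set_def ideal_rta_iff)

lemma ideals_pow_add:
  "I [^]\<^bsub>ideals_set rta\<^esub> (m + n::nat) = ideal_prod rta
    (I [^]\<^bsub>ideals_set rta\<^esub> m) (I [^]\<^bsub>ideals_set rta\<^esub> n)"
  using ids.nat_pow_mult[of I m n] I by (auto simp: ideals_set_def ideal_rta_iff)

text \<open>Nilpotence of each element modulo \<open>A\<close> becomes nilpotence of the whole
  ideal. If some \<open>f\<close> in \<open>I\<close> is outside \<open>A\<close>, its last power
  \<open>g\<close> outside \<open>A\<close> has its square in \<open>A\<close>, so both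
  \<open>A + (g)\<close> and \<open>(A : g)\<close> are strictly larger than \<open>A\<close>. A
  power of \<open>I\<close> inside the first times a power inside the second lies in
  \<open>A\<close>, because \<open>(a + r g) y = a y + r (y g)\<close>.\<close>

lemma ideals_pow_subset_of_radical:
  fixes A :: "'a set"
  assumes acc: "acc_ideals TYPE('a)" and A: "ring_ideal A" and sub: "I \<subseteq> ideal_radical A"
  shows "\<exists>n\<ge>1. I [^]\<^bsub>ideals_set rta\<^esub> (n::nat) \<subseteq> A"
  using acc A sub
proof (induction A rule: noetherian_induct)
  case (less A)
  show ?case
  proof (cases "I \<subseteq> A")
    case True
    then show ?thesis using ideals_pow_one by (intro exI[of _ 1]) auto
  next
    case False
    then obtain f where f: "f \<in> I" "f \<notin> A" by blast
    with less.prems obtain n where n: "f ^ n \<in> A" by (auto simp: ideal_radical_def)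
    define m where "m = (LEAST n. f ^ n \<in> A)"
    have m: "f ^ m \<in> A" "\<And>k. k < m \<Longrightarrow> f ^ k \<notin> A"
      unfolding m_def using n by (auto intro: LeastI dest: not_less_Least)
    \<comment> \<open>Exponent 0 would put 1, hence \<open>f\<close>, into \<open>A\<close>;
      exponent 1 contradicts the choice of \<open>f\<close>. So \<open>m - 1\<close> is positive and
      \<open>g\<close> remains in \<open>I\<close>.\<close>
    have "m \<ge> 2"
      using m(1) f ring_idealD(4)[OF less.hyps, of 1 f] by (cases m; cases "m - 1") auto
    define g where "g = f ^ (m - 1)"
    have gI: "g \<in> I" unfolding g_def using power_in_ideal_mono[OF I, of f 1] f \<open>m \<ge> 2\<close> by simp
    have gA: "g \<notin> A" using m(2) \<open>m \<ge> 2\<close> by (simp add: g_def)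
    have gg: "g * g \<in> A"
      unfolding g_def power_add[symmetric]
      using power_in_ideal_mono[OF less.hyps m(1)] \<open>m \<ge> 2\<close> by simp
    define B where "B = adjoin A g"
    have B: "ring_ideal B" unfolding B_def by (rule ring_ideal_adjoin[OF less.hyps])
    have AB: "A \<subset> B"
      using adjoin_upper adjoin_self[OF less.hyps] gA unfolding B_def by blast
    have AC: "A \<subset> colon A g"
      using colon_upper[OF less.hyps, of g] gg gA by (auto simp: colon_def)
    obtain k l where k: "I [^]\<^bsub>ideals_set rta\<^esub> (k::nat) \<subseteq> B" "k \<ge> 1"
      and l: "I [^]\<^bsub>ideals_set rta\<^esub> (l::nat) \<subseteq> colon A g"
      using less.IH[OF B AB] less.IH[OF ring_ideal_colon[OF less.hyps] AC] less.prems
        ideal_radical_mono[of A B] ideal_radical_mono[of A "colon A g"] AB AC by (metis psubsetE subset_trans)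
    have "I [^]\<^bsub>ideals_set rta\<^esub> (k + l) \<subseteq> A"
      unfolding ideals_pow_add
    proof (rule ideal_prod_subset[OF less.hyps])
      fix x y assume "x \<in> I [^]\<^bsub>ideals_set rta\<^esub> k"
        "y \<in> I [^]\<^bsub>ideals_set rta\<^esub> l"
      then obtain a r where "x = a + r * g" "a \<in> A" "y * g \<in> A"
        using k l unfolding B_def adjoin_def colon_def by blast
      moreover have "x * y = a * y + r * (y * g)" using calculation by (simp add: algebra_simps)
      ultimately show "x * y \<in> A" using ring_idealD[OF less.hyps] by metis
    qed
    then show ?thesis using k(2) by (intro exI[of _ "k + l"]) auto
  qed
qed

end

text \<open>A form of primary decomposition; it replaces the Artin--Rees lemma in the construction of
  elements of injective modules with prescribed torsion.\<close>

lemma separate_radicals: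
  fixes A :: "'a::comm_ring_1 set"
  assumes acc: "acc_ideals TYPE('a)" and A: "ring_ideal A"
    and sub: "P \<inter> Q \<subseteq> ideal_radical A" and P: "ring_ideal P" and Q: "ring_ideal Q"
  shows "\<exists>P' Q'. ring_ideal P' \<and> ring_ideal Q' \<and> P \<subseteq> ideal_radical P' \<and> Q \<subseteq> ideal_radical Q' \<and> P' \<inter> Q' = A"
  using acc A sub
proof (induction A rule: noetherian_induct)
  case (less A)
  note A = ring_idealD[OF less.hyps]
  have U: "ring_ideal UNIV" "ideal_radical UNIV = UNIV" by (auto simp: ring_ideal_def ideal_radical_def)
  show ?case
  proof (cases "P \<subseteq> ideal_radical A \<or> Q \<subseteq> ideal_radical A")
    case True
    \<comment> \<open>One of the two ideals is \<open>A\<close> itself, the other the whole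
      ring.\<close>
    then show ?thesis using U less.hyps by (metis Int_UNIV_left Int_UNIV_right subset_UNIV)
  next
    case False
    then obtain p q where p: "p \<in> P" "p \<notin> ideal_radical A" and q: "q \<in> Q" "q \<notin> ideal_radical A" by blast
    have "p * q \<in> ideal_radical A" using p q ring_idealD(3)[OF Q] ring_idealD(4)[OF P] less.prems by blast
    then obtain n where n: "(p * q) ^ n \<in> A" by (auto simp: ideal_radical_def)
    \<comment> \<open>Stability of the quotients from \<open>m\<close> on makes \<open>A\<close> the
      intersection of \<open>A + (p^m)\<close> and \<open>(A : p^m)\<close>, as in the classical
      proof that irreducible ideals are primary.\<close>
    obtain m where m: "\<And>n a. a * p ^ n \<in> A \<Longrightarrow> a * p ^ m \<in> A"
      using colon_power_stable[OF acc less.hyps, of p] by blast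
    define B where "B = adjoin A (p ^ m)"
    have B: "ring_ideal B" unfolding B_def by (rule ring_ideal_adjoin[OF less.hyps])
    have AB: "A \<subset> B"
      using adjoin_upper adjoin_self[OF less.hyps, of "p ^ m"] p(2) unfolding ideal_radical_def B_def by blast
    \<comment> \<open>From \<open>q^n p^n\<close> in \<open>A\<close>, stability gives
      \<open>q^n p^m\<close> in \<open>A\<close>; since \<open>q\<close> is not in the radical of
      \<open>A\<close>, the quotient is strictly larger than \<open>A\<close>.\<close>
    have "q ^ n \<in> colon A (p ^ m)" using n m[of "q ^ n" n] by (simp add: colon_def power_mult_distrib mult.commute)
    then have AC: "A \<subset> colon A (p ^ m)"
      using colon_upper[OF less.hyps, of "p ^ m"] q(2) by (auto simp: ideal_radical_def)
    have BC: "B \<inter> colon A (p ^ m) = A"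
    proof
      show "A \<subseteq> B \<inter> colon A (p ^ m)" using AB AC by blast
      show "B \<inter> colon A (p ^ m) \<subseteq> A"
      proof
        fix x assume "x \<in> B \<inter> colon A (p ^ m)"
        then obtain a r where x: "x = a + r * p ^ m" "a \<in> A" "x * p ^ m \<in> A"
          by (auto simp: B_def adjoin_def colon_def)
        have "r * p ^ (m + m) = x * p ^ m - a * p ^ m" by (simp add: x algebra_simps power_add)
        then have "r * p ^ (m + m) \<in> A" using x(2,3) A(4,6) by metis
        then have "r * p ^ m \<in> A" by (rule m)
        then show "x \<in> A" using x A(2) by blast
      qed
    qed
    obtain P1 Q1 where 1: "ring_ideal P1" "ring_ideal Q1" "P \<subseteq> ideal_radical P1" "Q \<subseteq> ideal_radical Q1" "P1 \<inter> Q1 = B"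
      using less.IH[OF B AB] less.prems ideal_radical_mono[of A B] AB by (metis psubsetE subset_trans)
    obtain P2 Q2 where 2: "ring_ideal P2" "ring_ideal Q2" "P \<subseteq> ideal_radical P2" "Q \<subseteq> ideal_radical Q2"
        "P2 \<inter> Q2 = colon A (p ^ m)"
      using less.IH[OF ring_ideal_colon[OF less.hyps] AC] less.prems
        ideal_radical_mono[of A "colon A (p ^ m)"] AC by (metis psubsetE subset_trans)
    have "ring_ideal (P1 \<inter> P2)" "ring_ideal (Q1 \<inter> Q2)"
      using 1 2 by (auto simp: ring_ideal_def)
    moreover have "(P1 \<inter> P2) \<inter> (Q1 \<inter> Q2) = A" using 1(5) 2(5) BC by blast
    moreover have "P \<subseteq> ideal_radical (P1 \<inter> P2)" "Q \<subseteq> ideal_radical (Q1 \<inter> Q2)"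
      using 1 2 by (auto simp: ideal_radical_Int)
    ultimately show ?thesis by blast
  qed
qed

section \<open>The polynomial ring is Noetherian\<close>

text \<open>Every sequence has a monotone subsequence, and a decreasing sequence of natural numbers
  is constant from its minimum on, so that its tail is also nondecreasing.\<close>

lemma nat_seq_mono_subseq:
  fixes g :: "nat \<Rightarrow> nat"
  shows "\<exists>\<psi>::nat \<Rightarrow> nat. strict_mono \<psi> \<and> mono (g \<circ> \<psi>)"
proof -
  obtain \<psi> where \<psi>: "strict_mono \<psi>" "monoseq (\<lambda>n. g (\<psi> n))" using seq_monosub by blast
  show ?thesis
  proof (cases "\<forall>m. \<forall>n\<ge>m. g (\<psi> m) \<le> g (\<psi> n)")
    case True
    then show ?thesis using \<psi>(1) by (intro exI[of _ \<psi>]) (auto simp: mono_def)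
  next
    case False
    then have dec: "m \<le> n \<Longrightarrow> g (\<psi> n) \<le> g (\<psi> m)" for m n using \<psi>(2) by (auto simp: monoseq_def)
    obtain N where N: "\<And>n. g (\<psi> N) \<le> g (\<psi> n)"
      using ex_has_least_nat[of "\<lambda>_. True" 0 "\<lambda>n. g (\<psi> n)"] by auto
    have "g (\<psi> (n + N)) = g (\<psi> N)" for n using N[of "n + N"] dec[of N "n + N"] by simp
    moreover have "strict_mono (\<lambda>n. \<psi> (n + N))" using \<psi>(1) by (auto simp: strict_mono_def)
    ultimately show ?thesis by (intro exI[of _ "\<lambda>n. \<psi> (n + N)"]) (auto simp: mono_def)
  qed
qed

text \<open>Subsequences are refined one variable at a time until every coordinate is nondecreasing;
  this ends because there are finitely many variables. The first two terms of the result are then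
  comparable.\<close>

lemma dickson:
  fixes s :: "nat \<Rightarrow> ('n::finite \<Rightarrow>\<^sub>0 nat)"
  shows "\<exists>i j. i < j \<and> (\<forall>x. Poly_Mapping.lookup (s i) x \<le> Poly_Mapping.lookup (s j) x)"
proof -
  have "\<exists>\<phi>::nat \<Rightarrow> nat. strict_mono \<phi> \<and> (\<forall>x\<in>V. mono (\<lambda>n. Poly_Mapping.lookup (s (\<phi> n)) x))"
    if "finite V" for V :: "'n set"
    using that
  proof induction
    case empty
    then show ?case by (intro exI[of _ id]) (auto simp: strict_mono_def)
  next
    case (insert x V)
    then obtain \<phi> :: "nat \<Rightarrow> nat" where \<phi>: "strict_mono \<phi>" "\<And>y. y \<in> V \<Longrightarrow> mono (\<lambda>n. Poly_Mapping.lookup (s (\<phi> n)) y)"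
      by blast
    obtain \<psi> :: "nat \<Rightarrow> nat" where \<psi>: "strict_mono \<psi>" "mono ((\<lambda>n. Poly_Mapping.lookup (s (\<phi> n)) x) \<circ> \<psi>)"
      using nat_seq_mono_subseq by blast
    have "mono (\<lambda>n. Poly_Mapping.lookup (s (\<phi> (\<psi> n))) y)" if "y \<in> insert x V" for y
      using that \<psi> \<phi>(2)[of y] by (auto simp: mono_def strict_mono_less_eq)
    moreover have "strict_mono (\<phi> \<circ> \<psi>)" using \<phi>(1) \<psi>(1) by (rule strict_mono_o)
    ultimately show ?case by (intro exI[of _ "\<phi> \<circ> \<psi>"]) (auto simp: comp_def)
  qed
  from this[OF finite_UNIV] obtain \<phi> :: "nat \<Rightarrow> nat" where
    "strict_mono \<phi>" "\<And>x. mono (\<lambda>n. Poly_Mapping.lookup (s (\<phi> n)) x)" by auto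
  then show ?thesis
    by (intro exI[of _ "\<phi> 0"] exI[of _ "\<phi> 1"]) (auto simp: mono_def strict_mono_def)
qed

text \<open>The lexicographic order on exponents. The type of variables carries no order, so
  \<open>e\<close> ranks the variables; the lowest-ranked variable in which two exponents differ
  decides.\<close>

definition lex_less :: "('n \<Rightarrow> nat) \<Rightarrow> ('n \<Rightarrow>\<^sub>0 nat) \<Rightarrow> ('n \<Rightarrow>\<^sub>0 nat) \<Rightarrow> bool" where
  "lex_less e m m' \<longleftrightarrow> (\<exists>x. Poly_Mapping.lookup m x < Poly_Mapping.lookup m' x \<and>
     (\<forall>y. e y < e x \<longrightarrow> Poly_Mapping.lookup m y = Poly_Mapping.lookup m' y))"

lemma lex_total:
  assumes "inj e" "m \<noteq> m'" shows "lex_less e m m' \<or> lex_less e m' m"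
proof -
  obtain x0 where x0: "Poly_Mapping.lookup m x0 \<noteq> Poly_Mapping.lookup m' x0"
    using assms(2) by (auto intro: poly_mapping_eqI)
  obtain x where "Poly_Mapping.lookup m x \<noteq> Poly_Mapping.lookup m' x"
    "\<And>y. Poly_Mapping.lookup m y \<noteq> Poly_Mapping.lookup m' y \<Longrightarrow> e x \<le> e y"
    using ex_has_least_nat[of "\<lambda>x. Poly_Mapping.lookup m x \<noteq> Poly_Mapping.lookup m' x" x0 e] x0 by auto
  then show ?thesis unfolding lex_less_def by (metis not_le nat_neq_iff)
qed

lemma lex_trans:
  assumes "inj e" "lex_less e m m'" "lex_less e m' m''" shows "lex_less e m m''"
proof -
  obtain x y where x: "Poly_Mapping.lookup m x < Poly_Mapping.lookup m' x"
      "\<And>z. e z < e x \<Longrightarrow> Poly_Mapping.lookup m z = Poly_Mapping.lookup m' z"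
    and y: "Poly_Mapping.lookup m' y < Poly_Mapping.lookup m'' y"
      "\<And>z. e z < e y \<Longrightarrow> Poly_Mapping.lookup m' z = Poly_Mapping.lookup m'' z"
    using assms(2,3) by (auto simp: lex_less_def)
  consider "e x < e y" | "e y < e x" | "x = y" using assms(1) by (metis injD nat_neq_iff)
  then show ?thesis
    unfolding lex_less_def by cases (metis x y order.strict_trans)+
qed

lemma lex_add: "lex_less e m m' \<Longrightarrow> lex_less e (k + m) (k + m')"
  unfolding lex_less_def lookup_add by auto

text \<open>In an infinite descending chain, Dickson's lemma yields a later exponent that dominates
  an earlier one in every variable, so it cannot be lexicographically smaller.\<close>

lemma wfp_lex_less:
  fixes e :: "'n::finite \<Rightarrow> nat"
  assumes "inj e" shows "wfP (lex_less e)"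
proof -
  have False if s: "\<And>i. lex_less e (s (Suc i)) (s i)" for s
  proof -
    have dec: "lex_less e (s j) (s i)" if "i < j" for i j
      using that by (induction rule: less_Suc_induct) (use s lex_trans[OF assms] in blast)+
    obtain i j where "i < j" and le: "\<And>x. Poly_Mapping.lookup (s i) x \<le> Poly_Mapping.lookup (s j) x"
      using dickson[of s] by blast
    from dec[OF this(1)] show False unfolding lex_less_def using le by (meson not_le)
  qed
  then show ?thesis by (auto simp: wfp_def wf_iff_no_infinite_down_chain)
qed

definition leading :: "('n \<Rightarrow> nat) \<Rightarrow> (('n \<Rightarrow>\<^sub>0 nat) \<Rightarrow>\<^sub>0 'k::zero) \<Rightarrow> ('n \<Rightarrow>\<^sub>0 nat) \<Rightarrow> bool" where
  "leading e p m \<longleftrightarrow> m \<in> Poly_Mapping.keys p \<and> (\<forall>m'\<in>Poly_Mapping.keys p. m' = m \<or> lex_less e m' m)"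

lemma leading_exists:
  assumes "inj e" "p \<noteq> 0" shows "\<exists>m. leading e p m"
proof -
  have "\<exists>m\<in>M. \<forall>m'\<in>M. m' = m \<or> lex_less e m' m" if "finite M" "M \<noteq> {}" for M
    using that
  proof (induction rule: finite_ne_induct)
    case (insert x M)
    then show ?case using lex_total[OF assms(1), of x] lex_trans[OF assms(1)] by (metis insert_iff)
  qed auto
  from this[of "Poly_Mapping.keys p"] show ?thesis
    using assms(2) by (metis finite_keys keys_eq_empty leading_def)
qed

lemma lookup_single_times:
  fixes p :: "('n \<Rightarrow>\<^sub>0 nat) \<Rightarrow>\<^sub>0 'k::comm_ring_1"
  shows "Poly_Mapping.lookup (Poly_Mapping.single k c * p) (k + m) = c * Poly_Mapping.lookup p m"
  by (simp add: lookup_mult lookup_single when_mult)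

lemma keys_single_times_subset:
  fixes p :: "('n \<Rightarrow>\<^sub>0 nat) \<Rightarrow>\<^sub>0 'k::comm_ring_1"
  shows "Poly_Mapping.keys (Poly_Mapping.single k c * p) \<subseteq> (+) k ` Poly_Mapping.keys p"
  using keys_mult[of "Poly_Mapping.single k c" p] by (auto split: if_splits)

text \<open>Hilbert's basis theorem: otherwise choose, along a strictly ascending chain of ideals, new
  elements with minimal leading monomials; by Dickson's lemma one of these monomials divides a
  later one, and cancelling the leading term contradicts minimality.\<close>

theorem acc_ideals_mpoly: "acc_ideals TYPE(('n::finite, 'k::field_char_0) mpoly)"
proof -
  obtain e :: "'n \<Rightarrow> nat" where e: "inj e"
    using finite_imp_inj_to_nat_seg[of "UNIV :: 'n set"] by auto
  have False if L: "\<And>i. ring_ideal (L i)" and asc: "\<And>i. L i \<subset> L (Suc i)"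
    for L :: "nat \<Rightarrow> ('n, 'k) mpoly set"
  proof -
    have mono: "i \<le> j \<Longrightarrow> L i \<subseteq> L j" for i j
      by (rule lift_Suc_mono_le[of L]) (use asc in \<open>blast+\<close>)
    have "\<exists>m p. leading e p m \<and> p \<in> L (Suc i) - L i \<and>
        (\<forall>m' p'. leading e p' m' \<longrightarrow> p' \<in> L (Suc i) - L i \<longrightarrow> \<not> lex_less e m' m)" for i
    proof -
      define Q where "Q = {m. \<exists>p. leading e p m \<and> p \<in> L (Suc i) - L i}"
      obtain p where "p \<in> L (Suc i) - L i" using asc[of i] by blast
      moreover have "p \<noteq> 0" using calculation ring_idealD(1)[OF L[of i]] by auto
      ultimately have "Q \<noteq> {}" unfolding Q_def using leading_exists[OF e] by blast
      then obtain m where "m \<in> Q" "\<And>m'. lex_less e m' m \<Longrightarrow> m' \<notin> Q"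
        using wfp_lex_less[OF e] unfolding wfp_iff_ex_minimal by metis
      then show ?thesis by (auto simp: Q_def)
    qed
    then obtain m p where lead: "\<And>i. leading e (p i) (m i)" and p: "\<And>i. p i \<in> L (Suc i) - L i"
      and min: "\<And>i m' p'. leading e p' m' \<Longrightarrow> p' \<in> L (Suc i) - L i \<Longrightarrow> \<not> lex_less e m' (m i)"
      by metis
    obtain i j where ij: "i < j" and le: "\<And>x. Poly_Mapping.lookup (m i) x \<le> Poly_Mapping.lookup (m j) x"
      using dickson[of m] by blast
    \<comment> \<open>The exponent of the monomial by which \<open>p i\<close> is multiplied to
      match the leading monomial of \<open>p j\<close>; divisibility makes the truncated subtraction
      exact.\<close>
    define k where "k = m j - m i"
    have k: "k + m i = m j"
      by (rule poly_mapping_eqI) (simp add: k_def lookup_add lookup_minus le)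
    define c where "c = Poly_Mapping.lookup (p j) (m j) / Poly_Mapping.lookup (p i) (m i)"
    define r where "r = Poly_Mapping.single k c * p i"
    define q where "q = p j - r"
    \<comment> \<open>Because \<open>i < j\<close>, the subtracted multiple already lies in
      \<open>L j\<close>, so \<open>q\<close> is still new at stage \<open>j\<close>.\<close>
    have "p i \<in> L j" using p[of i] mono[of "Suc i" j] ij by auto
    then have r: "r \<in> L j" unfolding r_def by (rule ring_idealD(3)[OF L])
    have "q \<in> L (Suc j)"
      unfolding q_def using ring_idealD(6)[OF L, of "p j"] p[of j] r mono[of j "Suc j"] by auto
    moreover have "q \<notin> L j"
      using ring_idealD(2)[OF L, of q j r] r p[of j] by (auto simp: q_def)
    ultimately have q: "q \<in> L (Suc j) - L j" by blast
    then have "q \<noteq> 0" using ring_idealD(1)[OF L[of j]] by auto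
    then obtain m' where m': "leading e q m'" using leading_exists[OF e] by blast
    have "Poly_Mapping.lookup (p i) (m i) \<noteq> 0" using lead[of i] by (simp add: leading_def in_keys_iff)
    then have "Poly_Mapping.lookup q (m j) = 0"
      using lookup_single_times[of k c "p i" "m i"] by (simp add: q_def r_def lookup_minus c_def k)
    \<comment> \<open>Every exponent of \<open>q\<close> comes from \<open>p j\<close> or from a
      shift of \<open>p i\<close>, hence is at most \<open>m j\<close>; the term at
      \<open>m j\<close> itself has cancelled.\<close>
    then have ne: "m' \<noteq> m j" using m' by (auto simp: leading_def in_keys_iff)
    have "m' \<in> Poly_Mapping.keys (p j) \<or> m' \<in> Poly_Mapping.keys r"
      using m' by (auto simp: leading_def in_keys_iff q_def lookup_minus)
    then have "lex_less e m' (m j)"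
    proof
      assume "m' \<in> Poly_Mapping.keys (p j)"
      then show ?thesis using lead[of j] ne by (auto simp: leading_def)
    next
      assume "m' \<in> Poly_Mapping.keys r"
      then obtain l where "l \<in> Poly_Mapping.keys (p i)" "m' = k + l"
        using keys_single_times_subset unfolding r_def by blast
      then show ?thesis using lead[of i] ne lex_add[of e l "m i" k] by (auto simp: leading_def k)
    qed
    with min[OF m' q] show False by blast
  qed
  then show ?thesis
    unfolding acc_ideals_def wfp_def wf_iff_no_infinite_down_chain mem_Collect_eq case_prod_conv
    by metis
qed

section \<open>Partial derivatives\<close>

text \<open>The truncated subtraction of exponents in the definition is harmless: where it
  truncates, the coefficient carries the factor zero. Comparing coefficients then proves additivity
  at once.\<close>

lemma lookup_partial_deriv:
  "Poly_Mapping.lookup (partial_deriv i p) m =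
    of_nat (Suc (Poly_Mapping.lookup m i)) * Poly_Mapping.lookup p (m + Poly_Mapping.single i 1)"
proof -
  have *: "Poly_Mapping.lookup (Poly_Mapping.single (m' - Poly_Mapping.single i 1)
       (of_nat (Poly_Mapping.lookup m' i) * Poly_Mapping.lookup p m')) m =
     (if m' = m + Poly_Mapping.single i 1 then
       of_nat (Suc (Poly_Mapping.lookup m i)) * Poly_Mapping.lookup p m' else 0)" for m'
  proof (cases "Poly_Mapping.lookup m' i = 0")
    case True
    then have "m' \<noteq> m + Poly_Mapping.single i 1" by (auto simp: lookup_add)
    with True show ?thesis by simp
  next
    case False
    then have "m' = (m' - Poly_Mapping.single i 1) + Poly_Mapping.single i 1"
      by (intro poly_mapping_eqI) (auto simp: lookup_add lookup_minus lookup_single when_def)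
    then have "m' - Poly_Mapping.single i 1 = m \<longleftrightarrow> m' = m + Poly_Mapping.single i 1" by auto
    then show ?thesis by (auto simp: lookup_single when_def lookup_add)
  qed
  show ?thesis
    unfolding partial_deriv_def lookup_sum * by (simp add: in_keys_iff)
qed

lemma partial_deriv_add: "partial_deriv i (p + q) = partial_deriv i p + partial_deriv i q"
  by (rule poly_mapping_eqI) (simp add: lookup_partial_deriv lookup_add algebra_simps)

lemma partial_deriv_sum: "partial_deriv i (\<Sum>x\<in>A. p x) = (\<Sum>x\<in>A. partial_deriv i (p x))"
proof (induction A rule: infinite_finite_induct)
  case (insert x A)
  then show ?case by (simp add: partial_deriv_add)
qed (simp_all add: partial_deriv_def)

lemma partial_deriv_single:
  "partial_deriv i (Poly_Mapping.single m c) =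
    Poly_Mapping.single (m - Poly_Mapping.single i 1) (of_nat (Poly_Mapping.lookup m i) * c)"
  by (simp add: partial_deriv_def)

lemma sum_monomials: "(\<Sum>m\<in>Poly_Mapping.keys p. Poly_Mapping.single m (Poly_Mapping.lookup p m)) = p"
  by (rule poly_mapping_eqI) (auto simp: lookup_sum lookup_single when_def in_keys_iff)

text \<open>Checked on two monomials and extended by additivity, in one factor at a time. Moving the
  truncated subtraction across the sum of exponents requires the variable to occur in the monomial
  being differentiated; otherwise that term vanishes, whence the case split.\<close>

lemma partial_deriv_mult:
  "partial_deriv i (p * q) = partial_deriv i p * q + p * partial_deriv i q"
proof -
  let ?x = "Poly_Mapping.single i (1::nat)"
  have 1: "partial_deriv i (Poly_Mapping.single a c * Poly_Mapping.single b c') =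
     partial_deriv i (Poly_Mapping.single a c) * Poly_Mapping.single b c' +
     Poly_Mapping.single a c * partial_deriv i (Poly_Mapping.single b c')" for a b c c'
  proof -
    have "a - ?x + b = a + b - ?x" if "Poly_Mapping.lookup a i \<noteq> 0"
      using that by (intro poly_mapping_eqI) (auto simp: lookup_add lookup_minus lookup_single when_def)
    moreover have "a + (b - ?x) = a + b - ?x" if "Poly_Mapping.lookup b i \<noteq> 0"
      using that by (intro poly_mapping_eqI) (auto simp: lookup_add lookup_minus lookup_single when_def)
    ultimately show ?thesis
      by (cases "Poly_Mapping.lookup a i = 0"; cases "Poly_Mapping.lookup b i = 0")
        (simp_all add: mult_single partial_deriv_single lookup_add algebra_simps flip: single_add)
  qed
  have 2: "partial_deriv i (Poly_Mapping.single a c * q) =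
     partial_deriv i (Poly_Mapping.single a c) * q + Poly_Mapping.single a c * partial_deriv i q" for a c
    by (subst (1 2 3) sum_monomials[of q, symmetric])
      (simp only: sum_distrib_left partial_deriv_sum 1 sum.distrib)
  show ?thesis
    by (subst (1 2 3) sum_monomials[of p, symmetric])
      (simp only: sum_distrib_right partial_deriv_sum 2 sum.distrib)
qed

section \<open>Torsion and localization\<close>

text \<open>Over the ring formed by a whole type, scalars need no membership conditions, and
  type-class arithmetic applies to them directly.\<close>

locale rta_module = module "rta" M
  for M :: "('a::comm_ring_1, 'e) module" (structure)
begin

lemma smult_simps [simp]:
  assumes "x \<in> carrier M"
  shows "a \<odot> x \<in> carrier M" "1 \<odot> x = x" "0 \<odot> x = \<zero>"
  using assms smult_closed[of a x] smult_one[of x] smult_l_null[of x] by simp_all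

lemma smult_zero [simp]: "a \<odot> \<zero> = \<zero>"
  using smult_r_null[of a] by simp

lemma smult_laws:
  assumes "x \<in> carrier M"
  shows "(a + b) \<odot> x = a \<odot> x \<oplus> b \<odot> x" "(a * b) \<odot> x = a \<odot> (b \<odot> x)" "(- a) \<odot> x = \<ominus> (a \<odot> x)"
  using smult_l_distr[of a b x] smult_assoc1[of a b x] smult_l_minus[of a x] assms by simp_all

lemma smult_commute: "x \<in> carrier M \<Longrightarrow> a \<odot> (b \<odot> x) = b \<odot> (a \<odot> x)"
  using smult_laws(2)[of x a b] smult_laws(2)[of x b a] by (simp add: mult.commute)

lemma smult_add: "x \<in> carrier M \<Longrightarrow> y \<in> carrier M \<Longrightarrow> a \<odot> (x \<oplus> y) = a \<odot> x \<oplus> a \<odot> y"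
  using smult_r_distr[of a x y] by simp

lemma smult_uminus: "x \<in> carrier M \<Longrightarrow> a \<odot> (\<ominus> x) = \<ominus> (a \<odot> x)"
  using smult_r_minus[of a x] by simp

lemma smult_diff: "x \<in> carrier M \<Longrightarrow> y \<in> carrier M \<Longrightarrow> a \<odot> (x \<ominus> y) = a \<odot> x \<ominus> a \<odot> y"
  by (simp add: minus_eq smult_add smult_uminus)

lemma add_diff_swap:
  "\<lbrakk>x \<in> carrier M; y \<in> carrier M; z \<in> carrier M; w \<in> carrier M\<rbrakk> \<Longrightarrow>
    (x \<oplus> y) \<ominus> (z \<oplus> w) = (x \<ominus> z) \<oplus> (y \<ominus> w)"
  by (simp add: minus_eq minus_add a_ac)

lemma diff_eq_zero_iff: "x \<in> carrier M \<Longrightarrow> y \<in> carrier M \<Longrightarrow> x \<ominus> y = \<zero> \<longleftrightarrow> x = y"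
  by (metis add.inv_closed add.inv_equality add.inv_inv minus_eq r_neg)

lemma diff_self [simp]: "x \<in> carrier M \<Longrightarrow> x \<ominus> x = \<zero>"
  by (simp add: diff_eq_zero_iff)

lemma diff_zero [simp]: "x \<in> carrier M \<Longrightarrow> x \<ominus> \<zero> = x"
  using add.inv_one by (simp add: minus_eq)

lemma smult_finsum:
  "g \<in> S \<rightarrow> carrier M \<Longrightarrow> a \<odot> (\<Oplus>j\<in>S. g j) = (\<Oplus>j\<in>S. a \<odot> g j)"
proof (induction S rule: infinite_finite_induct)
  case (insert j S)
  then show ?case by (simp add: Pi_def smult_add)
qed auto

section \<open>Annihilators and torsion\<close>

definition ann :: "'e \<Rightarrow> 'a set" where "ann x = {a. a \<odot> x = \<zero>}"

text \<open>The radical of the annihilator, see \<open>tors_eq\<close>, and therefore an ideal.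
  Torsion conditions stated as membership in it compose without any tracking of exponents.\<close>

definition tors :: "'e \<Rightarrow> 'a set" where "tors x = {f. \<exists>n. f ^ n \<odot> x = \<zero>}"

lemma ring_ideal_ann: "x \<in> carrier M \<Longrightarrow> ring_ideal (ann x)"
  by (rule ring_idealI) (auto simp: ann_def smult_laws)

lemma tors_eq: "tors x = ideal_radical (ann x)"
  by (auto simp: tors_def ann_def ideal_radical_def)

lemma ring_ideal_tors: "x \<in> carrier M \<Longrightarrow> ring_ideal (tors x)"
  unfolding tors_eq by (intro ring_ideal_radical ring_ideal_ann)

lemma tors_power_iff: "f ^ n \<in> tors x \<longleftrightarrow> f \<in> tors x" if "x \<in> carrier M" "n > 0"
proof
  assume "f ^ n \<in> tors x"
  then have "f \<in> ideal_radical (tors x)" by (auto simp: ideal_radical_def)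
  then show "f \<in> tors x" by (simp add: tors_eq ideal_radical_idem)
next
  assume "f \<in> tors x"
  then show "f ^ n \<in> tors x"
    using ring_idealD(4)[OF ring_ideal_tors[OF that(1)], of f "f ^ (n - 1)"] that(2)
    by (cases n) simp_all
qed

lemma tors_add: "\<lbrakk>x \<in> carrier M; y \<in> carrier M; f \<in> tors x; f \<in> tors y\<rbrakk> \<Longrightarrow> f \<in> tors (x \<oplus> y)"
proof -
  assume xy: "x \<in> carrier M" "y \<in> carrier M" "f \<in> tors x" "f \<in> tors y"
  then obtain m n where "f ^ m \<odot> x = \<zero>" "f ^ n \<odot> y = \<zero>" by (auto simp: tors_def)
  moreover have "f ^ (m + n) \<odot> x = f ^ n \<odot> (f ^ m \<odot> x)"
    using xy by (simp add: smult_laws(2)[symmetric] power_add mult.commute)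
  ultimately have "f ^ (m + n) \<odot> x = \<zero>" "f ^ (m + n) \<odot> y = \<zero>"
    using xy by (simp_all add: power_add smult_laws)
  then show ?thesis using xy by (auto simp: tors_def smult_add intro!: exI[of _ "m + n"])
qed

lemma tors_uminus: "x \<in> carrier M \<Longrightarrow> tors (\<ominus> x) = tors x"
  by (simp add: tors_def smult_uminus add.inv_eq_1_iff)

lemma tors_diff: "\<lbrakk>x \<in> carrier M; y \<in> carrier M; f \<in> tors x; f \<in> tors y\<rbrakk> \<Longrightarrow> f \<in> tors (x \<ominus> y)"
  unfolding minus_eq by (rule tors_add) (auto simp: tors_uminus)

lemma tors_zero [simp]: "tors \<zero> = UNIV"
  by (auto simp: tors_def)

lemma tors_smult: "x \<in> carrier M \<Longrightarrow> f \<in> tors x \<Longrightarrow> f \<in> tors (a \<odot> x)"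
proof -
  assume x: "x \<in> carrier M" "f \<in> tors x"
  then obtain n where "f ^ n \<odot> x = \<zero>" by (auto simp: tors_def)
  then have "f ^ n \<odot> (a \<odot> x) = \<zero>" using smult_commute[OF x(1), of "f ^ n" a] by simp
  then show ?thesis by (auto simp: tors_def)
qed

lemma tors_mult: "x \<in> carrier M \<Longrightarrow> f \<in> tors x \<Longrightarrow> f * g \<in> tors x"
  by (rule ring_idealD(4)[OF ring_ideal_tors])

lemma tors_finsum:
  "\<lbrakk>g \<in> S \<rightarrow> carrier M; \<And>j. j \<in> S \<Longrightarrow> f \<in> tors (g j)\<rbrakk> \<Longrightarrow> f \<in> tors (\<Oplus>j\<in>S. g j)"
proof (induction S rule: infinite_finite_induct)
  case (insert j S)
  then show ?case by (auto simp: Pi_def intro!: tors_add)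
qed auto

lemma tors_smult_cancel: "x \<in> carrier M \<Longrightarrow> f \<in> tors (f ^ n \<odot> x) \<longleftrightarrow> f \<in> tors x"
  using tors_smult[of x f "f ^ n"] by (auto simp: tors_def power_add smult_laws[symmetric] intro: exI[of _ "_ + n"])

lemma one_in_tors_iff: "x \<in> carrier M \<Longrightarrow> 1 \<in> tors x \<longleftrightarrow> x = \<zero>"
  by (simp add: tors_def)

text \<open>If \<open>I^s\<close> kills \<open>x\<close>, then so does \<open>f^s\<close> for each
  \<open>f\<close> in \<open>I\<close>. Conversely, \<open>I\<close> lies in the radical of
  \<open>ann x\<close>, and the chain condition puts a whole power of \<open>I\<close> into
  \<open>ann x\<close>.\<close>

lemma carrier_Gamma:
  assumes "acc_ideals TYPE('a)" "ring_ideal I"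
  shows "carrier (Gamma rta I M) = {x \<in> carrier M. I \<subseteq> tors x}"
proof -
  have "(\<exists>s\<ge>1. \<forall>a\<in>I [^]\<^bsub>ideals_set rta\<^esub> (s::nat). a \<odot> x = \<zero>) \<longleftrightarrow> I \<subseteq> tors x"
    if x: "x \<in> carrier M" for x
  proof
    assume "\<exists>s\<ge>1. \<forall>a\<in>I [^]\<^bsub>ideals_set rta\<^esub> (s::nat). a \<odot> x = \<zero>"
    then obtain s :: nat where s: "\<And>a. a \<in> I [^]\<^bsub>ideals_set rta\<^esub> s \<Longrightarrow> a \<odot> x = \<zero>"
      by blast
    have "f ^ n \<in> I [^]\<^bsub>ideals_set rta\<^esub> n" if "f \<in> I" for f and n :: nat
    proof (induction n)
      case 0
      then show ?case by (simp add: nat_pow_def ideals_set_def)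
    next
      case (Suc n)
      then show ?case
        using ideal_prod.prod[OF Suc that, of "rta"]
        unfolding ideals_pow_Suc by (simp add: mult.commute)
    qed
    then show "I \<subseteq> tors x" using s by (auto simp: tors_def)
  next
    assume "I \<subseteq> tors x"
    then obtain s where "s \<ge> 1" "I [^]\<^bsub>ideals_set rta\<^esub> (s::nat) \<subseteq> ann x"
      using ideals_pow_subset_of_radical[OF assms(2,1) ring_ideal_ann[OF x]] by (auto simp: tors_eq)
    then show "\<exists>s\<ge>1. \<forall>a\<in>I [^]\<^bsub>ideals_set rta\<^esub> (s::nat). a \<odot> x = \<zero>"
      by (auto simp: ann_def)
  qed
  then show ?thesis unfolding Gamma_def by auto
qed

lemma rta_module_submodule:
  assumes N: "N \<subseteq> carrier M" "\<zero> \<in> N" "\<And>x y. x \<in> N \<Longrightarrow> y \<in> N \<Longrightarrow> x \<oplus> y \<in> N"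
    "\<And>a x. x \<in> N \<Longrightarrow> a \<odot> x \<in> N"
  shows "rta_module (M\<lparr>carrier := N\<rparr>)"
proof -
  have neg: "\<ominus> x \<in> N" if "x \<in> N" for x using N(4)[OF that, of "-1"] N(1) that by (auto simp: smult_laws)
  have inv: "\<exists>y\<in>N. y \<oplus> x = \<zero>" if "x \<in> N" for x
    using that neg[OF that] N(1) by (auto simp: l_neg intro!: bexI[of _ "\<ominus> x"])
  have "abelian_group (M\<lparr>carrier := N\<rparr>)"
    by (rule abelian_groupI) (use N inv in \<open>auto simp: a_ac subset_iff\<close>)
  then show ?thesis
    unfolding rta_module_def
    by (intro moduleI cring_rta) (use N in \<open>auto simp: smult_laws smult_add subset_iff\<close>)
qed

section \<open>Localization at one element\<close>

abbreviation frac :: "'a \<Rightarrow> 'e \<Rightarrow> nat \<Rightarrow> ('e \<times> nat) set" where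
  "frac f x k \<equiv> fraction rta f M x k"

abbreviation Loc :: "'a \<Rightarrow> ('a, ('e \<times> nat) set) module" where
  "Loc f \<equiv> localization rta f M"

lemma equiv_loc_rel: "equiv (carrier M \<times> UNIV) (loc_rel rta f M)"
proof (rule equivI)
  show "loc_rel rta f M \<subseteq> (carrier M \<times> UNIV) \<times> carrier M \<times> UNIV"
    by (auto simp: loc_rel_def)
  show "refl_on (carrier M \<times> UNIV) (loc_rel rta f M)"
    by (auto simp: refl_on_def loc_rel_def)
  show "sym (loc_rel rta f M)"
    by (auto simp: sym_def loc_rel_def) metis
  show "trans (loc_rel rta f M)"
  proof (rule transI, clarsimp simp: loc_rel_def)
    fix x y z :: 'e and k l m s t
    assume c: "x \<in> carrier M" "y \<in> carrier M" "z \<in> carrier M"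
      and s: "f ^ (s + l) \<odot> x = f ^ (s + k) \<odot> y" and t: "f ^ (t + m) \<odot> y = f ^ (t + l) \<odot> z"
    \<comment> \<open>The summand \<open>l\<close> in the witness comes from the middle denominator,
      which occurs once in each of the two given equations.\<close>
    have "f ^ ((s + t + l) + m) \<odot> x = f ^ (t + m) \<odot> (f ^ (s + l) \<odot> x)"
      using c by (simp add: smult_laws(2)[symmetric] power_add[symmetric] ac_simps)
    also have "\<dots> = f ^ (s + k) \<odot> (f ^ (t + m) \<odot> y)" unfolding s using c by (rule_tac smult_commute)
    also have "\<dots> = f ^ ((s + t + l) + k) \<odot> z"
      unfolding t using c by (simp add: smult_laws(2)[symmetric] power_add[symmetric] ac_simps)
    finally show "\<exists>r. f ^ (r + m) \<odot> x = f ^ (r + k) \<odot> z" by blast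
  qed
qed

lemma frac_eq_iff:
  assumes "x \<in> carrier M" "y \<in> carrier M"
  shows "frac f x k = frac f y l \<longleftrightarrow> (\<exists>t. f ^ (t + l) \<odot> x = f ^ (t + k) \<odot> y)"
  unfolding fraction_def
  by (subst eq_equiv_class_iff[OF equiv_loc_rel]) (use assms in \<open>auto simp: loc_rel_def\<close>)

text \<open>Torsion with respect to \<open>f\<close> is insensitive to factors of \<open>f\<close>,
  so the denominator drops out. This is the bridge between equations in localizations and membership
  in \<open>tors\<close>.\<close>

lemma frac_eq_same_denom:
  assumes "x \<in> carrier M" "y \<in> carrier M"
  shows "frac f x k = frac f y k \<longleftrightarrow> f \<in> tors (x \<ominus> y)"
proof -
  have "(\<exists>t. f ^ (t + k) \<odot> x = f ^ (t + k) \<odot> y) \<longleftrightarrow> (\<exists>t. f ^ (t + k) \<odot> (x \<ominus> y) = \<zero>)"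
    using assms by (simp add: smult_diff diff_eq_zero_iff)
  also have "\<dots> \<longleftrightarrow> f \<in> tors (f ^ k \<odot> (x \<ominus> y))"
    using assms by (simp add: tors_def power_add smult_laws)
  finally show ?thesis using assms by (simp add: frac_eq_iff tors_smult_cancel)
qed

lemma frac_expand: "x \<in> carrier M \<Longrightarrow> frac f (f ^ l \<odot> x) (k + l) = frac f x k"
  by (subst frac_eq_iff) (auto simp: smult_laws(2)[symmetric] power_add[symmetric] ac_simps)

lemma carrier_Loc: "carrier (Loc f) = {frac f x k | x k. x \<in> carrier M}"
  by (auto simp: localization_def quotient_def fraction_def)

lemma frac_in_Loc [simp]: "x \<in> carrier M \<Longrightarrow> frac f x k \<in> carrier (Loc f)"
  by (auto simp: carrier_Loc)

lemma in_frac_iff: "x \<in> carrier M \<Longrightarrow> (y, l) \<in> frac f x k \<longleftrightarrow> y \<in> carrier M \<and> frac f y l = frac f x k"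
proof -
  assume x: "x \<in> carrier M"
  have "(y, l) \<in> frac f x k \<longleftrightarrow> ((x, k), (y, l)) \<in> loc_rel rta f M"
    by (simp add: fraction_def)
  also have "\<dots> \<longleftrightarrow> y \<in> carrier M \<and> frac f x k = frac f y l"
    using x by (simp add: loc_rel_def frac_eq_iff cong: conj_cong)
  finally show ?thesis by auto
qed

text \<open>Operations on fractions are written as unions over representatives; once the value is
  independent of the representative, the union equals that common value.\<close>

lemma UN_frac:
  assumes "x \<in> carrier M" "\<And>y l. y \<in> carrier M \<Longrightarrow> frac f y l = frac f x k \<Longrightarrow> F y l = A"
  shows "(\<Union>(y, l)\<in>frac f x k. F y l) = A"
proof -
  have "(x, k) \<in> frac f x k" using assms(1) by (simp add: in_frac_iff)
  moreover have "(case p of (y, l) \<Rightarrow> F y l) = A" if "p \<in> frac f x k" for p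
    using that assms in_frac_iff[OF assms(1)] by (cases p) auto
  ultimately show ?thesis by blast
qed

lemma frac_add_same_denom_cong:
  assumes c: "x \<in> carrier M" "y \<in> carrier M" "x' \<in> carrier M" "y' \<in> carrier M"
    and "frac f x k = frac f x' k'" "frac f y l = frac f y' l'"
  shows "frac f (f ^ l \<odot> x \<oplus> f ^ k \<odot> y) (k + l) = frac f (f ^ l' \<odot> x' \<oplus> f ^ k' \<odot> y') (k' + l')"
proof -
  obtain s t where s: "f ^ (s + k') \<odot> x = f ^ (s + k) \<odot> x'" and t: "f ^ (t + l') \<odot> y = f ^ (t + l) \<odot> y'"
    using assms by (auto simp: frac_eq_iff)
  have "f ^ (s + t + (k' + l')) \<odot> (f ^ l \<odot> x \<oplus> f ^ k \<odot> y) =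
      f ^ (t + l + l') \<odot> (f ^ (s + k') \<odot> x) \<oplus> f ^ (s + k + k') \<odot> (f ^ (t + l') \<odot> y)"
    using c by (simp add: smult_add smult_laws(2)[symmetric] power_add[symmetric] ac_simps)
  also have "\<dots> = f ^ (s + t + (k + l)) \<odot> (f ^ l' \<odot> x' \<oplus> f ^ k' \<odot> y')"
    unfolding s t using c by (simp add: smult_add smult_laws(2)[symmetric] power_add[symmetric] ac_simps)
  finally show ?thesis using c by (auto simp: frac_eq_iff)
qed

lemma Loc_add:
  assumes "x \<in> carrier M" "y \<in> carrier M"
  shows "frac f x k \<oplus>\<^bsub>Loc f\<^esub> frac f y l = frac f (f ^ l \<odot> x \<oplus> f ^ k \<odot> y) (k + l)"
proof -
  have "(\<Union>(x', k')\<in>frac f x k. \<Union>(y', l')\<in>frac f y l.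
       frac f (f ^ l' \<odot> x' \<oplus> f ^ k' \<odot> y') (k' + l')) = frac f (f ^ l \<odot> x \<oplus> f ^ k \<odot> y) (k + l)"
    by (intro UN_frac assms frac_add_same_denom_cong) auto
  then show ?thesis by (simp add: localization_def)
qed

lemma Loc_add_same_denom:
  assumes "x \<in> carrier M" "y \<in> carrier M"
  shows "frac f x k \<oplus>\<^bsub>Loc f\<^esub> frac f y k = frac f (x \<oplus> y) k"
  using assms by (simp add: Loc_add smult_add[symmetric] frac_expand)

lemma Loc_smult:
  assumes "x \<in> carrier M"
  shows "a \<odot>\<^bsub>Loc f\<^esub> frac f x k = frac f (a \<odot> x) k"
proof -
  have "frac f (a \<odot> y) l = frac f (a \<odot> x) k" if "y \<in> carrier M" "frac f y l = frac f x k" for y l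
    using that assms smult_commute[of _ _ a] by (simp add: frac_eq_iff) metis
  then have "(\<Union>(y, l)\<in>frac f x k. frac f (a \<odot> y) l) = frac f (a \<odot> x) k"
    by (rule UN_frac[OF assms])
  then show ?thesis by (simp add: localization_def)
qed

lemma Loc_zero: "\<zero>\<^bsub>Loc f\<^esub> = frac f \<zero> k"
  by (simp add: localization_def frac_eq_iff)

lemma frac_eq_zero_iff: "x \<in> carrier M \<Longrightarrow> frac f x k = \<zero>\<^bsub>Loc f\<^esub> \<longleftrightarrow> f \<in> tors x"
  by (subst Loc_zero[of _ k], subst frac_eq_same_denom) auto

lemma Loc_common_denom:
  assumes "C \<in> carrier (Loc f)" "D \<in> carrier (Loc f)" "B \<in> carrier (Loc f)"
  obtains x y z k where "C = frac f x k" "D = frac f y k" "B = frac f z k"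
    "x \<in> carrier M" "y \<in> carrier M" "z \<in> carrier M"
proof -
  obtain x y z k l m where *: "C = frac f x k" "D = frac f y l" "B = frac f z m"
    and c: "x \<in> carrier M" "y \<in> carrier M" "z \<in> carrier M"
    using assms by (auto simp: carrier_Loc)
  have "C = frac f (f ^ (l + m) \<odot> x) (k + l + m)" "D = frac f (f ^ (k + m) \<odot> y) (k + l + m)"
    "B = frac f (f ^ (k + l) \<odot> z) (k + l + m)"
    using frac_expand[of x f "l + m" k] frac_expand[of y f "k + m" l] frac_expand[of z f "k + l" m] c
    by (simp_all add: * ac_simps)
  then show ?thesis by (rule that) (use c in auto)
qed

lemma rta_module_Loc: "rta_module (Loc f)"
proof -
  have inv: "\<exists>D\<in>carrier (Loc f). D \<oplus>\<^bsub>Loc f\<^esub> C = \<zero>\<^bsub>Loc f\<^esub>" if C: "C \<in> carrier (Loc f)" for C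
  proof -
    obtain x k where "C = frac f x k" "x \<in> carrier M" using C by (auto simp: carrier_Loc)
    then show ?thesis
      by (intro bexI[of _ "frac f (\<ominus> x) k"]) (auto simp: Loc_add_same_denom l_neg Loc_zero[symmetric])
  qed
  have "abelian_group (Loc f)"
  proof (rule abelian_groupI)
    fix B C D assume *: "B \<in> carrier (Loc f)" "C \<in> carrier (Loc f)" "D \<in> carrier (Loc f)"
    then obtain x y z k where B: "B = frac f x k" "C = frac f y k" "D = frac f z k"
      and c: "x \<in> carrier M" "y \<in> carrier M" "z \<in> carrier M" by (rule Loc_common_denom)
    show "B \<oplus>\<^bsub>Loc f\<^esub> C \<oplus>\<^bsub>Loc f\<^esub> D = B \<oplus>\<^bsub>Loc f\<^esub> (C \<oplus>\<^bsub>Loc f\<^esub> D)"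
      unfolding B using c by (simp add: Loc_add_same_denom a_assoc)
  next
    fix B C assume "B \<in> carrier (Loc f)" "C \<in> carrier (Loc f)"
    then obtain x y z k where B: "B = frac f x k" "C = frac f y k"
      and c: "x \<in> carrier M" "y \<in> carrier M" by (metis Loc_common_denom)
    show "B \<oplus>\<^bsub>Loc f\<^esub> C \<in> carrier (Loc f)" "B \<oplus>\<^bsub>Loc f\<^esub> C = C \<oplus>\<^bsub>Loc f\<^esub> B"
      unfolding B using c by (simp_all add: Loc_add_same_denom a_comm)
  next
    fix B assume "B \<in> carrier (Loc f)"
    then obtain x k where B: "B = frac f x k" "x \<in> carrier M" by (auto simp: carrier_Loc)
    then show "\<zero>\<^bsub>Loc f\<^esub> \<oplus>\<^bsub>Loc f\<^esub> B = B"
      by (subst Loc_zero[of _ k]) (simp add: Loc_add_same_denom)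
  qed (use inv Loc_zero[of f 0] in auto)
  then have "module rta (Loc f)"
  proof (rule moduleI[OF cring_rta], simp_all)
    fix a b :: 'a and C assume "C \<in> carrier (Loc f)"
    then obtain x k where C: "C = frac f x k" "x \<in> carrier M" by (auto simp: carrier_Loc)
    then show "a \<odot>\<^bsub>Loc f\<^esub> C \<in> carrier (Loc f)"
      "(a + b) \<odot>\<^bsub>Loc f\<^esub> C = a \<odot>\<^bsub>Loc f\<^esub> C \<oplus>\<^bsub>Loc f\<^esub> b \<odot>\<^bsub>Loc f\<^esub> C"
      "(a * b) \<odot>\<^bsub>Loc f\<^esub> C = a \<odot>\<^bsub>Loc f\<^esub> (b \<odot>\<^bsub>Loc f\<^esub> C)" "1 \<odot>\<^bsub>Loc f\<^esub> C = C"
      by (simp_all add: Loc_smult Loc_add_same_denom smult_laws)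
    fix D assume "D \<in> carrier (Loc f)"
    with \<open>C \<in> carrier (Loc f)\<close> obtain x y k where "C = frac f x k" "D = frac f y k"
      "x \<in> carrier M" "y \<in> carrier M" by (metis Loc_common_denom)
    then show "a \<odot>\<^bsub>Loc f\<^esub> (C \<oplus>\<^bsub>Loc f\<^esub> D) = a \<odot>\<^bsub>Loc f\<^esub> C \<oplus>\<^bsub>Loc f\<^esub> a \<odot>\<^bsub>Loc f\<^esub> D"
      by (simp add: Loc_smult Loc_add_same_denom smult_add)
  qed
  then show ?thesis by (simp add: rta_module_def)
qed

lemma Loc_finsum:
  assumes "g \<in> S \<rightarrow> carrier M"
  shows "(\<Oplus>\<^bsub>Loc f\<^esub>j\<in>S. frac f (g j) k) = frac f (\<Oplus>j\<in>S. g j) k"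
proof -
  interpret L: rta_module "Loc f" by (rule rta_module_Loc)
  show ?thesis using assms
  proof (induction S rule: infinite_finite_induct)
    case (insert j S)
    then have "(\<Oplus>\<^bsub>Loc f\<^esub>i\<in>insert j S. frac f (g i) k) =
        frac f (g j) k \<oplus>\<^bsub>Loc f\<^esub> (\<Oplus>\<^bsub>Loc f\<^esub>i\<in>S. frac f (g i) k)"
      by (intro L.finsum_insert) (auto simp: Pi_def)
    with insert show ?case by (simp add: Pi_def Loc_add_same_denom)
  qed (auto simp: Loc_zero)
qed

lemma loc_restrict_frac:
  assumes "x \<in> carrier M"
  shows "loc_restrict rta f g M (frac f x k) = frac (f * g) (g ^ k \<odot> x) k"
proof -
  have "frac (f * g) (g ^ l \<odot> y) l = frac (f * g) (g ^ k \<odot> x) k"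
    if y: "y \<in> carrier M" "frac f y l = frac f x k" for y l
  proof -
    obtain t where t: "f ^ (t + k) \<odot> y = f ^ (t + l) \<odot> x"
      using y(2) frac_eq_iff[OF y(1) assms] by blast
    have "(f * g) ^ (t + k) \<odot> (g ^ l \<odot> y) = g ^ (t + k + l) \<odot> (f ^ (t + k) \<odot> y)"
      using y by (simp add: smult_laws(2)[symmetric] power_add power_mult_distrib ac_simps)
    also have "\<dots> = (f * g) ^ (t + l) \<odot> (g ^ k \<odot> x)"
      unfolding t using assms by (simp add: smult_laws(2)[symmetric] power_add power_mult_distrib ac_simps)
    finally show ?thesis using y assms by (auto simp: frac_eq_iff)
  qed
  then have "(\<Union>(y, l)\<in>frac f x k. frac (f * g) (g ^ l \<odot> y) l) = frac (f * g) (g ^ k \<odot> x) k"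
    by (rule UN_frac[OF assms])
  then show ?thesis by (simp add: loc_restrict_def)
qed

lemma loc_functor_frac:
  assumes "rta_module N" and \<phi>: "\<phi> \<in> linear_maps rta M N" and x: "x \<in> carrier M"
  shows "loc_functor rta f N \<phi> (frac f x k) = fraction rta f N (\<phi> x) k"
proof -
  interpret N: rta_module N by fact
  have \<phi>': "\<And>x. x \<in> carrier M \<Longrightarrow> \<phi> x \<in> carrier N"
    "\<And>a x. x \<in> carrier M \<Longrightarrow> \<phi> (a \<odot> x) = a \<odot>\<^bsub>N\<^esub> \<phi> x"
    using \<phi> by (auto simp: linear_maps_def)
  have "N.frac f (\<phi> y) l = N.frac f (\<phi> x) k" if y: "y \<in> carrier M" "frac f y l = frac f x k" for y l
  proof -
    obtain t where t: "f ^ (t + k) \<odot> y = f ^ (t + l) \<odot> x"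
      using y(2) frac_eq_iff[OF y(1) x] by blast
    have "f ^ (t + k) \<odot>\<^bsub>N\<^esub> \<phi> y = f ^ (t + l) \<odot>\<^bsub>N\<^esub> \<phi> x"
      using arg_cong[OF t, of \<phi>] x y by (simp add: \<phi>')
    then show ?thesis using x y \<phi>'(1) by (auto simp: N.frac_eq_iff)
  qed
  then show ?thesis unfolding loc_functor_def by (rule UN_frac[OF x])
qed

end

section \<open>Linear maps and injective resolutions\<close>

locale rta_linear = M: rta_module M + N: rta_module N
  for M :: "('a::comm_ring_1, 'e) module" and N :: "('a, 'f) module" and \<phi> :: "'e \<Rightarrow> 'f" +
  assumes linear: "\<phi> \<in> linear_maps rta M N"
begin

lemma closed [simp]: "x \<in> carrier M \<Longrightarrow> \<phi> x \<in> carrier N"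
  and add: "x \<in> carrier M \<Longrightarrow> y \<in> carrier M \<Longrightarrow> \<phi> (x \<oplus>\<^bsub>M\<^esub> y) = \<phi> x \<oplus>\<^bsub>N\<^esub> \<phi> y"
  and smult: "x \<in> carrier M \<Longrightarrow> \<phi> (a \<odot>\<^bsub>M\<^esub> x) = a \<odot>\<^bsub>N\<^esub> \<phi> x"
  using linear by (auto simp: linear_maps_def)

lemma zero [simp]: "\<phi> \<zero>\<^bsub>M\<^esub> = \<zero>\<^bsub>N\<^esub>"
  using smult[of "\<zero>\<^bsub>M\<^esub>" 0] by simp

lemma uminus: "x \<in> carrier M \<Longrightarrow> \<phi> (\<ominus>\<^bsub>M\<^esub> x) = \<ominus>\<^bsub>N\<^esub> \<phi> x"
  using smult[of x "-1"] by (simp add: M.smult_laws N.smult_laws)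

lemma diff: "x \<in> carrier M \<Longrightarrow> y \<in> carrier M \<Longrightarrow> \<phi> (x \<ominus>\<^bsub>M\<^esub> y) = \<phi> x \<ominus>\<^bsub>N\<^esub> \<phi> y"
  by (simp add: M.minus_eq N.minus_eq add uminus)

lemma finsum: "g \<in> S \<rightarrow> carrier M \<Longrightarrow> \<phi> (\<Oplus>\<^bsub>M\<^esub>j\<in>S. g j) = (\<Oplus>\<^bsub>N\<^esub>j\<in>S. \<phi> (g j))"
proof (induction S rule: infinite_finite_induct)
  case (insert j S)
  then show ?case by (simp add: Pi_def add)
qed auto

lemma tors: "x \<in> carrier M \<Longrightarrow> M.tors x \<subseteq> N.tors (\<phi> x)"
  by (auto simp: M.tors_def N.tors_def smult[symmetric]) (metis zero)

lemma loc_functor: "x \<in> carrier M \<Longrightarrow>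
    loc_functor rta f N \<phi> (M.frac f x k) = N.frac f (\<phi> x) k"
  by (rule M.loc_functor_frac[OF N.rta_module_axioms linear])

end

lemma self_module_simps [simp]:
  "carrier (self_module (rta :: 'a::comm_ring_1 ring)) = UNIV"
  "add (self_module (rta :: 'a ring)) = (+)"
  "ring.zero (self_module (rta :: 'a ring)) = 0"
  "module.smult (self_module (rta :: 'a ring)) = (*)"
  by (simp_all add: self_module_def)

lemma rta_module_self: "rta_module (self_module (rta :: 'a::comm_ring_1 ring))"
proof -
  have "\<exists>y. y + x = 0" for x :: 'a by (rule exI[of _ "-x"]) simp
  then have "abelian_group (self_module (rta :: 'a ring))"
    by (intro abelian_groupI) (auto simp: ac_simps)
  then show ?thesis
    unfolding rta_module_def by (intro moduleI cring_rta) (auto simp: algebra_simps)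
qed

text \<open>The algebraic counterpart of covariant differentiation along the vector field \<theta>.
  Two such maps differ by a linear one, which is how they are corrected later.\<close>

definition connection_on :: "('a \<Rightarrow> 'a) \<Rightarrow> ('a::comm_ring_1, 'e) module \<Rightarrow> ('e \<Rightarrow> 'e) \<Rightarrow> bool" where
  "connection_on \<theta> M D \<longleftrightarrow> D \<in> carrier M \<rightarrow> carrier M \<and>
    (\<forall>x\<in>carrier M. \<forall>y\<in>carrier M. D (x \<oplus>\<^bsub>M\<^esub> y) = D x \<oplus>\<^bsub>M\<^esub> D y) \<and>
    (\<forall>a. \<forall>x\<in>carrier M. D (a \<odot>\<^bsub>M\<^esub> x) = \<theta> a \<odot>\<^bsub>M\<^esub> x \<oplus>\<^bsub>M\<^esub> a \<odot>\<^bsub>M\<^esub> D x)"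

section \<open>Baer's criterion, divisibility and decomposition of torsion\<close>

locale noetherian_resolution =
  injective_resolution rta "self_module rta" E d \<epsilon>
  for E :: "nat \<Rightarrow> ('a::comm_ring_1, 'e) module" and d :: "nat \<Rightarrow> 'e \<Rightarrow> 'e" and \<epsilon> :: "'a \<Rightarrow> 'e" +
  assumes acc: "acc_ideals TYPE('a)"
begin

sublocale E: rta_module "E q" for q
  using injective[of q] by (simp add: injective_module_def rta_module_def)

sublocale R: rta_module "self_module rta :: ('a, 'a) module"
  by (rule rta_module_self)

sublocale d: rta_linear "E q" "E (Suc q)" "d q" for q
  by unfold_locales (rule differential)

sublocale eps: rta_linear "self_module rta" "E 0" \<epsilon>
  by unfold_locales (rule augmentation)

lemma d_d [simp]: "x \<in> carrier (E q) \<Longrightarrow> d (Suc q) (d q x) = \<zero>\<^bsub>E (Suc (Suc q))\<^esub>"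
  using exact_Suc[of q] by auto

lemma d_eps [simp]: "d 0 (\<epsilon> a) = \<zero>\<^bsub>E (Suc 0)\<^esub>"
  using exact_0 by auto

lemma exact_eps: "x \<in> carrier (E 0) \<Longrightarrow> d 0 x = \<zero>\<^bsub>E (Suc 0)\<^esub> \<Longrightarrow> \<exists>r. x = \<epsilon> r"
  using exact_0 by auto

lemma exact_d: "x \<in> carrier (E (Suc q)) \<Longrightarrow> d (Suc q) x = \<zero>\<^bsub>E (Suc (Suc q))\<^esub> \<Longrightarrow>
    \<exists>y\<in>carrier (E q). x = d q y"
  using exact_Suc[of q] by auto

lemma inj_eps: "\<epsilon> a = \<epsilon> b \<longleftrightarrow> a = b"
  using augmentation_inj by (auto simp: inj_on_def)

lemma extend_linear:
  fixes M N :: "('a, 'e) module"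
  assumes "rta_linear M N f" "inj_on f (carrier M)" "rta_linear M (E q) g"
  obtains h where "rta_linear N (E q) h" "\<And>x. x \<in> carrier M \<Longrightarrow> h (f x) = g x"
proof -
  interpret f: rta_linear M N f by fact
  interpret g: rta_linear M "E q" g by fact
  obtain h where "h \<in> linear_maps rta N (E q)" "\<And>x. x \<in> carrier M \<Longrightarrow> h (f x) = g x"
    using injective[of q, unfolded injective_module_def, THEN conjunct2, rule_format,
        OF f.M.module_axioms f.N.module_axioms f.linear assms(2) g.linear] by blast
  then show ?thesis by (intro that[of h]) unfold_locales
qed

text \<open>The test modules must have elements of type \<open>'e\<close>, so the ideal and the
  whole ring are replaced by their images under \<epsilon> inside \<open>E 0\<close>. The required
  element is the value of the extended map at \<open>\<epsilon> 1\<close>.\<close>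

lemma baer:
  assumes L: "ring_ideal L" and g: "\<And>a. a \<in> L \<Longrightarrow> g a \<in> carrier (E q)"
    "\<And>a b. a \<in> L \<Longrightarrow> b \<in> L \<Longrightarrow> g (a + b) = g a \<oplus>\<^bsub>E q\<^esub> g b"
    "\<And>a r. a \<in> L \<Longrightarrow> g (r * a) = r \<odot>\<^bsub>E q\<^esub> g a"
  shows "\<exists>y\<in>carrier (E q). \<forall>a\<in>L. g a = a \<odot>\<^bsub>E q\<^esub> y"
proof -
  have eps': "\<epsilon> a \<oplus>\<^bsub>E 0\<^esub> \<epsilon> b = \<epsilon> (a + b)" "r \<odot>\<^bsub>E 0\<^esub> \<epsilon> a = \<epsilon> (r * a)" for a b r
    using eps.add[of a b] eps.smult[of a r] by simp_all
  have sub: "rta_module ((E 0)\<lparr>carrier := \<epsilon> ` L\<rparr>)" if "ring_ideal L" for L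
  proof (rule E.rta_module_submodule)
    show "\<epsilon> ` L \<subseteq> carrier (E 0)" by auto
    show "\<zero>\<^bsub>E 0\<^esub> \<in> \<epsilon> ` L" using eps.zero ring_idealD(1)[OF that] by force
    show "x \<oplus>\<^bsub>E 0\<^esub> y \<in> \<epsilon> ` L" if "x \<in> \<epsilon> ` L" "y \<in> \<epsilon> ` L" for x y
      using that ring_idealD(2)[OF \<open>ring_ideal L\<close>] by (auto simp: eps')
    show "a \<odot>\<^bsub>E 0\<^esub> x \<in> \<epsilon> ` L" if "x \<in> \<epsilon> ` L" for a x
      using that ring_idealD(3)[OF \<open>ring_ideal L\<close>] by (auto simp: eps')
  qed
  define M where "M = (E 0)\<lparr>carrier := \<epsilon> ` L\<rparr>"
  define N where "N = (E 0)\<lparr>carrier := range \<epsilon>\<rparr>"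
  interpret M: rta_module M unfolding M_def by (rule sub[OF L])
  interpret N: rta_module N unfolding N_def by (rule sub) (auto simp: ring_ideal_def)
  define g' where "g' = (\<lambda>x. g (inv_into UNIV \<epsilon> x))"
  have inv: "inv_into UNIV \<epsilon> (\<epsilon> a) = a" for a using inj_eps by (simp add: inj_def)
  have lin: "rta_linear M N id"
    by unfold_locales (auto simp: linear_maps_def M_def N_def)
  have lin': "rta_linear M (E q) g'"
    by unfold_locales (use g in \<open>auto simp: linear_maps_def M_def g'_def inv eps'\<close>)
  obtain h where h: "rta_linear N (E q) h" "\<And>x. x \<in> carrier M \<Longrightarrow> h (id x) = g' x"
    by (rule extend_linear[OF lin _ lin']) auto
  interpret h: rta_linear N "E q" h by fact
  have N: "\<epsilon> 1 \<in> carrier N" by (auto simp: N_def)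
  have "g a = a \<odot>\<^bsub>E q\<^esub> h (\<epsilon> 1)" if "a \<in> L" for a
  proof -
    have "g a = h (\<epsilon> a)" using h(2)[of "\<epsilon> a"] that by (simp add: M_def g'_def inv)
    also have "\<epsilon> a = a \<odot>\<^bsub>N\<^esub> \<epsilon> 1" using eps'(2)[of a 1] by (simp add: N_def)
    finally show ?thesis using h.smult[OF N] by simp
  qed
  then show ?thesis using h.closed[OF N] by blast
qed

text \<open>The canonical map from an injective module to its localization is onto. The assignment
  \<open>r f^(m+k) \<mapsto> r f^m x\<close> is well-defined since, for the stable exponent
  \<open>m\<close>, any element whose product with a power of \<open>f\<close> kills
  \<open>x\<close> already does so after multiplication by \<open>f^m\<close>. Baer's criterion then
  gives \<open>f^(m+k) y = f^m x\<close>, that is, \<open>y / 1 = x / f^k\<close>.\<close>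

lemma divisible:
  assumes x: "x \<in> carrier (E q)"
  obtains y where "y \<in> carrier (E q)" "E.frac q f y 0 = E.frac q f x k"
proof -
  obtain m where m: "\<And>n a. a * f ^ n \<in> E.ann q x \<Longrightarrow> a * f ^ m \<in> E.ann q x"
    using colon_power_stable[OF acc E.ring_ideal_ann[OF x], of f] by blast
  define p where "p = f ^ (m + k)"
  define g where "g = (\<lambda>a. ((SOME r. a = r * p) * f ^ m) \<odot>\<^bsub>E q\<^esub> x)"
  have g: "g (r * p) = (r * f ^ m) \<odot>\<^bsub>E q\<^esub> x" for r
  proof -
    define s where "s = (SOME s. r * p = s * p)"
    have "r * p = s * p" unfolding s_def by (rule someI[of _ r]) simp
    then have "(r - s) * f ^ (m + k) \<in> E.ann q x"
      using x by (simp add: E.ann_def p_def algebra_simps)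
    then have "(r - s) * f ^ m \<in> E.ann q x" by (rule m)
    then have "(r * f ^ m) \<odot>\<^bsub>E q\<^esub> x = (s * f ^ m) \<odot>\<^bsub>E q\<^esub> x"
      using x E.smult_laws(1)[of x q "(r - s) * f ^ m" "s * f ^ m"]
      by (simp add: E.ann_def algebra_simps)
    then show ?thesis by (simp add: g_def s_def)
  qed
  have "ring_ideal (range (\<lambda>r. r * p))"
  proof (rule ring_idealI)
    show "0 \<in> range (\<lambda>r. r * p)" by (rule range_eqI[of _ _ 0]) simp
    show "a + b \<in> range (\<lambda>r. r * p)" if "a \<in> range (\<lambda>r. r * p)" "b \<in> range (\<lambda>r. r * p)" for a b
      using that by (auto simp: distrib_right[symmetric])
    show "r * a \<in> range (\<lambda>r. r * p)" if "a \<in> range (\<lambda>r. r * p)" for a r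
      using that by (auto simp: mult.assoc[symmetric])
  qed
  then have "\<exists>y\<in>carrier (E q). \<forall>a\<in>range (\<lambda>r. r * p). g a = a \<odot>\<^bsub>E q\<^esub> y"
  proof (rule baer)
    fix a b r assume "a \<in> range (\<lambda>r. r * p)"
    then obtain s where a: "a = s * p" by auto
    show "g a \<in> carrier (E q)" using x by (simp add: a g)
    have "g ((r * s) * p) = r \<odot>\<^bsub>E q\<^esub> g a"
      unfolding a g using x by (simp add: E.smult_laws(2)[symmetric] mult.assoc)
    then show "g (r * a) = r \<odot>\<^bsub>E q\<^esub> g a" by (simp add: a mult.assoc)
    assume "b \<in> range (\<lambda>r. r * p)"
    then obtain t where b: "b = t * p" by auto
    have "g ((s + t) * p) = g a \<oplus>\<^bsub>E q\<^esub> g b"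
      unfolding a b g using x by (simp add: E.smult_laws(1)[symmetric] distrib_right)
    then show "g (a + b) = g a \<oplus>\<^bsub>E q\<^esub> g b" by (simp add: a b distrib_right)
  qed
  then obtain y where y: "y \<in> carrier (E q)" "g (1 * p) = (1 * p) \<odot>\<^bsub>E q\<^esub> y" by blast
  then have "f ^ (m + k) \<odot>\<^bsub>E q\<^esub> y = f ^ (m + 0) \<odot>\<^bsub>E q\<^esub> x" unfolding g by (simp add: p_def)
  with y(1) x show ?thesis by (intro that[of y]) (auto simp: E.frac_eq_iff)
qed

text \<open>For \<open>P' \<inter> Q' = ann x\<close> the assignment \<open>p + q \<mapsto> p x\<close> is well-defined on \<open>P' + Q'\<close>, and any
  extension of it to the whole ring is multiplication by the second summand.\<close>

lemma torsion_decomposition: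
  assumes x: "x \<in> carrier (E q)" and P: "ring_ideal P" and Q: "ring_ideal Q"
    and sub: "P \<inter> Q \<subseteq> E.tors q x"
  obtains y z where "y \<in> carrier (E q)" "z \<in> carrier (E q)" "x = y \<oplus>\<^bsub>E q\<^esub> z"
    "P \<subseteq> E.tors q y" "Q \<subseteq> E.tors q z"
proof -
  obtain P' Q' where P': "ring_ideal P'" and Q': "ring_ideal Q'"
    and rad: "P \<subseteq> ideal_radical P'" "Q \<subseteq> ideal_radical Q'" and int: "P' \<inter> Q' = E.ann q x"
    using separate_radicals[OF acc E.ring_ideal_ann[OF x] _ P Q] sub by (auto simp: E.tors_eq)
  define L where "L = {a + b | a b. a \<in> P' \<and> b \<in> Q'}"
  define g where "g = (\<lambda>c. (SOME a. a \<in> P' \<and> c - a \<in> Q') \<odot>\<^bsub>E q\<^esub> x)"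
  have g: "g (a + b) = a \<odot>\<^bsub>E q\<^esub> x" if "a \<in> P'" "b \<in> Q'" for a b
  proof -
    define a' where "a' = (SOME a'. a' \<in> P' \<and> a + b - a' \<in> Q')"
    have a': "a' \<in> P' \<and> a + b - a' \<in> Q'"
      unfolding a'_def by (rule someI[of _ a]) (use that in simp)
    have "a' - a \<in> P'" using a' that ring_idealD(6)[OF P'] by blast
    moreover have "a' - a = b - (a + b - a')" by simp
    then have "a' - a \<in> Q'" using a' that ring_idealD(6)[OF Q'] by metis
    ultimately have "a' - a \<in> E.ann q x" using int by blast
    then have "a' \<odot>\<^bsub>E q\<^esub> x = a \<odot>\<^bsub>E q\<^esub> x"
      using E.smult_laws(1)[OF x, of "a' - a" a] x by (simp add: E.ann_def)
    then show ?thesis by (simp add: g_def a'_def)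
  qed
  have LI: "a + b \<in> L" if "a \<in> P'" "b \<in> Q'" for a b using that by (auto simp: L_def)
  have sum: "(a + b) + (a' + b') = (a + a') + (b + b')" for a b a' b' :: 'a by simp
  have L: "ring_ideal L"
  proof (rule ring_idealI)
    show "0 \<in> L" using LI[OF ring_idealD(1)[OF P'] ring_idealD(1)[OF Q']] by simp
    fix u v r assume "u \<in> L"
    then obtain a b where u: "u = a + b" "a \<in> P'" "b \<in> Q'" by (auto simp: L_def)
    show "r * u \<in> L"
      using LI[of "r * a" "r * b"] u ring_idealD(3)[OF P'] ring_idealD(3)[OF Q']
      by (simp add: distrib_left)
    assume "v \<in> L"
    then obtain a' b' where v: "v = a' + b'" "a' \<in> P'" "b' \<in> Q'" by (auto simp: L_def)
    show "u + v \<in> L"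
      unfolding u v sum using LI u v ring_idealD(2)[OF P'] ring_idealD(2)[OF Q'] by blast
  qed
  have "\<exists>z\<in>carrier (E q). \<forall>c\<in>L. g c = c \<odot>\<^bsub>E q\<^esub> z"
    using L
  proof (rule baer)
    fix u v r assume "u \<in> L"
    then obtain a b where u: "u = a + b" "a \<in> P'" "b \<in> Q'" by (auto simp: L_def)
    show "g u \<in> carrier (E q)" using x u by (simp add: g)
    show "g (r * u) = r \<odot>\<^bsub>E q\<^esub> g u"
      unfolding u distrib_left using x u ring_idealD(3)[OF P'] ring_idealD(3)[OF Q']
      by (simp add: g E.smult_laws)
    assume "v \<in> L"
    then obtain a' b' where v: "v = a' + b'" "a' \<in> P'" "b' \<in> Q'" by (auto simp: L_def)
    show "g (u + v) = g u \<oplus>\<^bsub>E q\<^esub> g v"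
      unfolding u v sum using x u v ring_idealD(2)[OF P'] ring_idealD(2)[OF Q']
      by (simp add: g E.smult_laws)
  qed
  then obtain z where z: "z \<in> carrier (E q)" "\<And>c. c \<in> L \<Longrightarrow> g c = c \<odot>\<^bsub>E q\<^esub> z" by blast
  \<comment> \<open>The map sends \<open>a\<close> in \<open>P'\<close> to \<open>a x\<close> and
    vanishes on \<open>Q'\<close>; as multiplication by \<open>z\<close> it thus shows that
    \<open>P'\<close> kills \<open>x - z\<close> and \<open>Q'\<close> kills
    \<open>z\<close>.\<close>
  have "P' \<subseteq> E.ann q (x \<ominus>\<^bsub>E q\<^esub> z)"
  proof
    fix a assume a: "a \<in> P'"
    then have "a \<odot>\<^bsub>E q\<^esub> z = a \<odot>\<^bsub>E q\<^esub> x"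
      using z(2)[of "a + 0"] g[of a 0] LI[of a 0] ring_idealD(1)[OF Q'] by simp
    then show "a \<in> E.ann q (x \<ominus>\<^bsub>E q\<^esub> z)" using x z by (simp add: E.ann_def E.smult_diff)
  qed
  moreover have "Q' \<subseteq> E.ann q z"
  proof
    fix b assume b: "b \<in> Q'"
    then have "b \<odot>\<^bsub>E q\<^esub> z = 0 \<odot>\<^bsub>E q\<^esub> x"
      using z(2)[of "0 + b"] g[of 0 b] LI[of 0 b] ring_idealD(1)[OF P'] by simp
    then show "b \<in> E.ann q z" using x by (simp add: E.ann_def)
  qed
  moreover have "x = (x \<ominus>\<^bsub>E q\<^esub> z) \<oplus>\<^bsub>E q\<^esub> z"
    using x z by (simp add: E.minus_eq E.a_assoc E.l_neg)
  ultimately show ?thesis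
    using rad x z(1) ideal_radical_mono[of P' "E.ann q (x \<ominus>\<^bsub>E q\<^esub> z)"]
      ideal_radical_mono[of Q' "E.ann q z"]
    by (intro that[of "x \<ominus>\<^bsub>E q\<^esub> z" z]) (auto simp: E.tors_eq)
qed

text \<open>Applies the decomposition to the ideals generated by the two sets. Products of their
  elements lie in \<open>tors x\<close>, so each element of the intersection has its square there,
  hence lies there itself because \<open>tors x\<close> is radical.\<close>

lemma torsion_decomposition_mult:
  assumes x: "x \<in> carrier (E q)" and "F \<subseteq> E.tors q x" and "f * g \<in> E.tors q x"
  obtains y z where "y \<in> carrier (E q)" "z \<in> carrier (E q)" "x = y \<oplus>\<^bsub>E q\<^esub> z"
    "insert f F \<subseteq> E.tors q y" "insert g F \<subseteq> E.tors q z"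
proof -
  define gen where "gen = (\<lambda>S :: 'a set. \<Inter>{I. ring_ideal I \<and> S \<subseteq> I})"
  have gen: "ring_ideal (gen S)" "S \<subseteq> gen S" for S
    unfolding gen_def by (auto intro!: ring_idealI dest: ring_idealD)
  have gen_least: "gen S \<subseteq> I" if "ring_ideal I" "S \<subseteq> I" for S I
    using that by (auto simp: gen_def)
  let ?T = "E.tors q x"
  note T = E.ring_ideal_tors[OF x]
  have col: "ring_ideal {a. \<forall>b\<in>B. a * b \<in> ?T}" for B
    by (rule ring_idealI) (auto simp: distrib_right ring_idealD[OF T] mult.assoc)
  \<comment> \<open>The generating sets are replaced by ideals one at a time: for a fixed set
    \<open>B\<close>, the elements whose products with \<open>B\<close> lie in \<open>tors x\<close>
    form an ideal.\<close>
  have "gen (insert g F) \<subseteq> {a. \<forall>b\<in>insert f F. a * b \<in> ?T}"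
    by (rule gen_least[OF col])
      (use assms ring_idealD(3,4)[OF T] in \<open>auto simp: mult.commute[of g f]\<close>)
  then have "insert f F \<subseteq> {a. \<forall>b\<in>gen (insert g F). a * b \<in> ?T}"
    unfolding subset_iff mem_Collect_eq by (metis mult.commute)
  then have prod: "a * b \<in> ?T" if "a \<in> gen (insert f F)" "b \<in> gen (insert g F)" for a b
    using gen_least[OF col] that by blast
  have "gen (insert f F) \<inter> gen (insert g F) \<subseteq> ?T"
  proof
    fix a assume "a \<in> gen (insert f F) \<inter> gen (insert g F)"
    then have "a ^ 2 \<in> ?T" using prod by (simp add: power2_eq_square)
    then show "a \<in> ?T" using E.tors_power_iff[OF x, of 2] by simp
  qed
  then obtain y z where "y \<in> carrier (E q)" "z \<in> carrier (E q)" "x = y \<oplus>\<^bsub>E q\<^esub> z"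
    "gen (insert f F) \<subseteq> E.tors q y" "gen (insert g F) \<subseteq> E.tors q z"
    by (rule torsion_decomposition[OF x gen(1) gen(1)])
  then show ?thesis
    using gen(2)[of "insert f F"] gen(2)[of "insert g F"] by (intro that[of y z]) blast+
qed

end

section \<open>Lifting derivations to injective resolutions\<close>

text \<open>Injectivity of \<open>E q\<close> is only assumed with respect to test modules on its own element type, so
  modules on other types have to be moved there.\<close>

definition transport_module :: "('e \<Rightarrow> 'f) \<Rightarrow> ('a, 'e) module \<Rightarrow> ('a, 'f) module" where
  "transport_module b N = (let c = inv_into (carrier N) b in
     \<lparr>carrier = b ` carrier N, monoid.mult = undefined, one = undefined, ring.zero = b \<zero>\<^bsub>N\<^esub>,
      add = (\<lambda>u v. b (c u \<oplus>\<^bsub>N\<^esub> c v)), module.smult = (\<lambda>a u. b (a \<odot>\<^bsub>N\<^esub> c u))\<rparr>)"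

context rta_module
begin

context
  fixes b :: "'e \<Rightarrow> 'f"
  assumes inj: "inj_on b (carrier M)"
begin

lemma transport_simps:
  "carrier (transport_module b M) = b ` carrier M"
  "ring.zero (transport_module b M) = b \<zero>"
  "x \<in> carrier M \<Longrightarrow> y \<in> carrier M \<Longrightarrow> b x \<oplus>\<^bsub>transport_module b M\<^esub> b y = b (x \<oplus> y)"
  "x \<in> carrier M \<Longrightarrow> a \<odot>\<^bsub>transport_module b M\<^esub> b x = b (a \<odot> x)"
  using inj by (simp_all add: transport_module_def Let_def inv_into_f_f)

lemma rta_module_transport: "rta_module (transport_module b M)"
proof -
  have inv: "\<exists>y\<in>carrier M. b (y \<oplus> x) = b \<zero>" "\<exists>y\<in>carrier M. b (x \<oplus> y) = b \<zero>"
    if "x \<in> carrier M" for x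
    using that by (auto simp: l_neg r_neg intro!: bexI[of _ "\<ominus> x"])
  have "abelian_group (transport_module b M)"
    by (rule abelian_groupI) (auto simp: transport_simps a_ac inv)
  then show ?thesis
    unfolding rta_module_def
    by (intro moduleI cring_rta) (auto simp: transport_simps smult_laws smult_add)
qed

lemma rta_linear_transport: "rta_linear M (transport_module b M) b"
  unfolding rta_linear_def rta_linear_axioms_def
  using rta_module_axioms rta_module_transport by (auto simp: linear_maps_def transport_simps)

end

lemma add_diff_cancel: "x \<in> carrier M \<Longrightarrow> y \<in> carrier M \<Longrightarrow> x \<oplus> (y \<ominus> x) = y"
  by (simp add: minus_eq a_lcomm[of x y] r_neg)

lemma connection_closed: "connection_on \<theta> M D \<Longrightarrow> x \<in> carrier M \<Longrightarrow> D x \<in> carrier M"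
  and connection_add: "connection_on \<theta> M D \<Longrightarrow> x \<in> carrier M \<Longrightarrow> y \<in> carrier M \<Longrightarrow> D (x \<oplus> y) = D x \<oplus> D y"
  and connection_smult: "connection_on \<theta> M D \<Longrightarrow> x \<in> carrier M \<Longrightarrow> D (a \<odot> x) = \<theta> a \<odot> x \<oplus> a \<odot> D x"
  by (auto simp: connection_on_def)

lemma connection_zero: "connection_on \<theta> M D \<Longrightarrow> D \<zero> = \<zero>"
  using connection_add[of \<theta> D \<zero> \<zero>] connection_closed[of \<theta> D \<zero>] by simp

text \<open>Applying \<open>D\<close> to \<open>f^n x = 0\<close> leaves an extra term
  \<open>\<theta>(f^n) x\<close>; another factor \<open>f^n\<close> kills it, so
  \<open>f^(2n) D x = 0\<close>.\<close>

lemma connection_tors: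
  assumes D: "connection_on \<theta> M D" and x: "x \<in> carrier M" shows "tors x \<subseteq> tors (D x)"
proof
  fix f assume "f \<in> tors x"
  then obtain n where n: "f ^ n \<odot> x = \<zero>" by (auto simp: tors_def)
  note c = x connection_closed[OF D x]
  have "\<theta> (f ^ n) \<odot> x \<oplus> f ^ n \<odot> D x = \<zero>"
    using connection_smult[OF D x, of "f ^ n"] connection_zero[OF D] by (simp add: n)
  then have "f ^ n \<odot> (\<theta> (f ^ n) \<odot> x \<oplus> f ^ n \<odot> D x) = \<zero>" by simp
  then have "\<theta> (f ^ n) \<odot> (f ^ n \<odot> x) \<oplus> (f ^ n * f ^ n) \<odot> D x = \<zero>"
    using c smult_commute[OF x, of "f ^ n"] by (simp add: smult_add smult_laws)
  then have "f ^ (n + n) \<odot> D x = \<zero>" using c by (simp add: n power_add)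
  then show "f \<in> tors (D x)" by (auto simp: tors_def)
qed

end

text \<open>Splittings of the inclusion of \<open>M\<close> as second summand correspond to connections on \<open>M\<close>.\<close>

definition twisted_sum :: "('a \<Rightarrow> 'a) \<Rightarrow> ('a, 'e) module \<Rightarrow> ('a::comm_ring_1, 'e \<times> 'e) module" where
  "twisted_sum \<theta> M = \<lparr>carrier = carrier M \<times> carrier M, monoid.mult = undefined, one = undefined,
     ring.zero = (\<zero>\<^bsub>M\<^esub>, \<zero>\<^bsub>M\<^esub>),
     add = (\<lambda>(x, y) (x', y'). (x \<oplus>\<^bsub>M\<^esub> x', y \<oplus>\<^bsub>M\<^esub> y')),
     module.smult = (\<lambda>a (x, y). (a \<odot>\<^bsub>M\<^esub> x, \<theta> a \<odot>\<^bsub>M\<^esub> x \<oplus>\<^bsub>M\<^esub> a \<odot>\<^bsub>M\<^esub> y))\<rparr>"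

locale derivation =
  fixes \<theta> :: "'a::comm_ring_1 \<Rightarrow> 'a"
  assumes add: "\<theta> (a + b) = \<theta> a + \<theta> b"
    and mult: "\<theta> (a * b) = \<theta> a * b + a * \<theta> b"
begin

lemma one: "\<theta> 1 = 0"
  using mult[of 1 1] by simp

lemma zero: "\<theta> 0 = 0"
  using add[of 0 0] by simp

lemma rta_module_twisted_sum:
  assumes "rta_module M" shows "rta_module (twisted_sum \<theta> M)"
proof -
  interpret rta_module M by fact
  have inv: "\<exists>y\<in>carrier M. y \<oplus>\<^bsub>M\<^esub> x = \<zero>\<^bsub>M\<^esub>" if "x \<in> carrier M" for x
    using that by (intro bexI[of _ "\<ominus>\<^bsub>M\<^esub> x"]) (auto simp: l_neg)
  have "abelian_group (twisted_sum \<theta> M)"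
    by (rule abelian_groupI) (use inv in \<open>auto simp: twisted_sum_def a_ac\<close>)
  then show ?thesis
    unfolding rta_module_def
    by (intro moduleI cring_rta)
      (auto simp: twisted_sum_def smult_laws smult_add add mult one a_ac)
qed

end

context noetherian_resolution
begin

text \<open>Injectivity provides a retraction \<open>r\<close> of the embedding
  \<open>y \<mapsto> (0, y)\<close> into the twisted sum. Decomposing \<open>a (x, 0)\<close> as
  \<open>(a x, 0) + (0, \<theta>(a) x)\<close> shows how \<open>s x = r (x, 0)\<close> fails to be
  linear.\<close>

lemma connection_exists:
  assumes "derivation \<theta>" and inf: "infinite (UNIV :: 'a set)"
  shows "\<exists>D. connection_on \<theta> (E q) D"
proof -
  interpret derivation \<theta> by fact
  \<comment> \<open>The twisted sum consists of pairs; as \<open>'e\<close> contains a copy of the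
    infinite ring, a bijection of \<open>'e \<times> 'e\<close> with \<open>'e\<close> moves it to
    the type on which injectivity is available.\<close>
  have "infinite (UNIV :: 'e set)"
    using inf inj_eps finite_subset[OF subset_UNIV] by (metis finite_imageD injI)
  then have "|(UNIV :: 'e set) \<times> (UNIV :: 'e set)| =o |UNIV :: 'e set|"
    by (rule card_of_Times_same_infinite)
  then obtain b :: "'e \<times> 'e \<Rightarrow> 'e" where bij: "bij_betw b (UNIV \<times> UNIV) UNIV"
    unfolding card_of_ordIso[symmetric] by blast
  have inj: "inj_on b S" for S
    by (rule inj_on_subset[OF bij_betw_imp_inj_on[OF bij]]) auto
  let ?T = "twisted_sum \<theta> (E q)"
  let ?N = "transport_module b ?T"
  interpret T: rta_module ?T by (rule rta_module_twisted_sum) (rule E.rta_module_axioms)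
  note b = T.transport_simps[OF inj]
  interpret b: rta_linear ?T ?N b by (rule T.rta_linear_transport[OF inj])
  have T [simp]: "carrier ?T = carrier (E q) \<times> carrier (E q)"
    "(x, y) \<oplus>\<^bsub>?T\<^esub> (x', y') = (x \<oplus>\<^bsub>E q\<^esub> x', y \<oplus>\<^bsub>E q\<^esub> y')"
    "a \<odot>\<^bsub>?T\<^esub> (x, y) = (a \<odot>\<^bsub>E q\<^esub> x, \<theta> a \<odot>\<^bsub>E q\<^esub> x \<oplus>\<^bsub>E q\<^esub> a \<odot>\<^bsub>E q\<^esub> y)" for x y x' y' a
    by (auto simp: twisted_sum_def)
  have lin: "rta_linear (E q) ?N (\<lambda>y. b (\<zero>\<^bsub>E q\<^esub>, y))"
    unfolding rta_linear_def rta_linear_axioms_def linear_maps_def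
    using E.rta_module_axioms b.N.rta_module_axioms by (auto simp: b)
  have inj': "inj_on (\<lambda>y. b (\<zero>\<^bsub>E q\<^esub>, y)) (carrier (E q))"
  proof (rule inj_onI)
    fix x y assume "b (\<zero>\<^bsub>E q\<^esub>, x) = b (\<zero>\<^bsub>E q\<^esub>, y)"
    then show "x = y" using inj_onD[OF inj[of UNIV], of "(\<zero>\<^bsub>E q\<^esub>, x)" "(\<zero>\<^bsub>E q\<^esub>, y)"] by simp
  qed
  have lin': "rta_linear (E q) (E q) id"
    by unfold_locales (auto simp: linear_maps_def)
  obtain r where r: "rta_linear ?N (E q) r" "\<And>y. y \<in> carrier (E q) \<Longrightarrow> r (b (\<zero>\<^bsub>E q\<^esub>, y)) = id y"
    using extend_linear[OF lin inj' lin'] by blast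
  interpret r: rta_linear ?N "E q" r by fact
  define s where "s = (\<lambda>x. r (b (x, \<zero>\<^bsub>E q\<^esub>)))"
  have s: "s x \<in> carrier (E q)" if "x \<in> carrier (E q)" for x
    unfolding s_def using that by simp
  have s_add: "s (x \<oplus>\<^bsub>E q\<^esub> y) = s x \<oplus>\<^bsub>E q\<^esub> s y" if "x \<in> carrier (E q)" "y \<in> carrier (E q)" for x y
    using that r.add[of "b (x, \<zero>\<^bsub>E q\<^esub>)" "b (y, \<zero>\<^bsub>E q\<^esub>)"] by (simp add: s_def b)
  have s_smult: "a \<odot>\<^bsub>E q\<^esub> s x = s (a \<odot>\<^bsub>E q\<^esub> x) \<oplus>\<^bsub>E q\<^esub> \<theta> a \<odot>\<^bsub>E q\<^esub> x" if x: "x \<in> carrier (E q)" for a x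
  proof -
    have "a \<odot>\<^bsub>E q\<^esub> s x = r (b (a \<odot>\<^bsub>E q\<^esub> x, \<theta> a \<odot>\<^bsub>E q\<^esub> x))"
      using x r.smult[of "b (x, \<zero>\<^bsub>E q\<^esub>)" a] by (simp add: s_def b)
    also have "\<dots> = r (b (a \<odot>\<^bsub>E q\<^esub> x, \<zero>\<^bsub>E q\<^esub>) \<oplus>\<^bsub>?N\<^esub> b (\<zero>\<^bsub>E q\<^esub>, \<theta> a \<odot>\<^bsub>E q\<^esub> x))"
      using x by (simp add: b)
    also have "\<dots> = s (a \<odot>\<^bsub>E q\<^esub> x) \<oplus>\<^bsub>E q\<^esub> \<theta> a \<odot>\<^bsub>E q\<^esub> x"
      using x by (subst r.add) (auto simp: s_def r(2) b)
    finally show ?thesis .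
  qed
  \<comment> \<open>The identity \<open>s (a x) = a s(x) - \<theta>(a) x\<close> is the Leibniz rule
    with the opposite sign, so the connection is \<open>- s\<close>.\<close>
  have "connection_on \<theta> (E q) (\<lambda>x. \<ominus>\<^bsub>E q\<^esub> s x)"
    unfolding connection_on_def
  proof (intro conjI ballI allI)
    show "(\<lambda>x. \<ominus>\<^bsub>E q\<^esub> s x) \<in> carrier (E q) \<rightarrow> carrier (E q)" using s by auto
    show "\<ominus>\<^bsub>E q\<^esub> s (x \<oplus>\<^bsub>E q\<^esub> y) = \<ominus>\<^bsub>E q\<^esub> s x \<oplus>\<^bsub>E q\<^esub> \<ominus>\<^bsub>E q\<^esub> s y"
      if "x \<in> carrier (E q)" "y \<in> carrier (E q)" for x y
      using that s by (simp add: s_add E.minus_add)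
    fix a x assume x: "x \<in> carrier (E q)"
    have "a \<odot>\<^bsub>E q\<^esub> \<ominus>\<^bsub>E q\<^esub> s x = \<ominus>\<^bsub>E q\<^esub> s (a \<odot>\<^bsub>E q\<^esub> x) \<oplus>\<^bsub>E q\<^esub> \<ominus>\<^bsub>E q\<^esub> (\<theta> a \<odot>\<^bsub>E q\<^esub> x)"
      using x s by (simp add: E.smult_uminus s_smult E.minus_add)
    then show "\<ominus>\<^bsub>E q\<^esub> s (a \<odot>\<^bsub>E q\<^esub> x) = \<theta> a \<odot>\<^bsub>E q\<^esub> x \<oplus>\<^bsub>E q\<^esub> a \<odot>\<^bsub>E q\<^esub> (\<ominus>\<^bsub>E q\<^esub> s x)"
      using x s by (simp add: E.a_ac E.r_neg E.r_neg2 E.r_neg1)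
  qed
  then show ?thesis by blast
qed

text \<open>On the image of \<phi>, the difference between the prescribed map
  \<open>\<phi> x \<mapsto> \<phi> (D x)\<close> and an arbitrary connection \<open>C\<close> is
  linear; \<open>ker\<close> makes it well-defined. Its extension \<open>h\<close> to
  \<open>E q\<close> corrects \<open>C\<close> to \<open>C + h\<close>.\<close>

lemma connection_extend:
  assumes "derivation \<theta>" and inf: "infinite (UNIV :: 'a set)"
    and "rta_linear M (E q) \<phi>" and D: "connection_on \<theta> M D"
    and ker: "\<And>x. x \<in> carrier M \<Longrightarrow> \<phi> x = \<zero>\<^bsub>E q\<^esub> \<Longrightarrow> \<phi> (D x) = \<zero>\<^bsub>E q\<^esub>"
  shows "\<exists>D'. connection_on \<theta> (E q) D' \<and> (\<forall>x\<in>carrier M. D' (\<phi> x) = \<phi> (D x))"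
proof -
  interpret derivation \<theta> by fact
  interpret \<phi>: rta_linear M "E q" \<phi> by fact
  obtain C where C: "connection_on \<theta> (E q) C" using connection_exists[OF assms(1,2)] by blast
  note Dm = \<phi>.M.connection_closed[OF D] \<phi>.M.connection_add[OF D] \<phi>.M.connection_smult[OF D]
  note Cm = E.connection_closed[OF C] E.connection_add[OF C] E.connection_smult[OF C]
  define N where "N = (E q)\<lparr>carrier := \<phi> ` carrier M\<rparr>"
  interpret N: rta_module N
    unfolding N_def
  proof (rule E.rta_module_submodule)
    show "\<phi> ` carrier M \<subseteq> carrier (E q)" by auto
    show "\<zero>\<^bsub>E q\<^esub> \<in> \<phi> ` carrier M" using \<phi>.zero by (metis \<phi>.M.zero_closed imageI)
    show "x \<oplus>\<^bsub>E q\<^esub> y \<in> \<phi> ` carrier M" if "x \<in> \<phi> ` carrier M" "y \<in> \<phi> ` carrier M" for x y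
      using that by (auto simp: \<phi>.add[symmetric])
    show "a \<odot>\<^bsub>E q\<^esub> x \<in> \<phi> ` carrier M" if "x \<in> \<phi> ` carrier M" for a x
      using that by (auto simp: \<phi>.smult[symmetric])
  qed
  define g where "g = (\<lambda>y. \<phi> (D (SOME x. x \<in> carrier M \<and> y = \<phi> x)) \<ominus>\<^bsub>E q\<^esub> C y)"
  have g: "g (\<phi> x) = \<phi> (D x) \<ominus>\<^bsub>E q\<^esub> C (\<phi> x)" if x: "x \<in> carrier M" for x
  proof -
    define x' where "x' = (SOME x'. x' \<in> carrier M \<and> \<phi> x = \<phi> x')"
    have x': "x' \<in> carrier M \<and> \<phi> x = \<phi> x'" unfolding x'_def by (rule someI[of _ x]) (use x in simp)
    have "D x = D ((x \<ominus>\<^bsub>M\<^esub> x') \<oplus>\<^bsub>M\<^esub> x')"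
      using x x' by (simp add: \<phi>.M.minus_eq \<phi>.M.a_assoc \<phi>.M.l_neg)
    also have "\<dots> = D (x \<ominus>\<^bsub>M\<^esub> x') \<oplus>\<^bsub>M\<^esub> D x'" using x x' by (simp add: Dm)
    finally have "\<phi> (D x) = \<phi> (D x')"
      using x x' ker[of "x \<ominus>\<^bsub>M\<^esub> x'"] by (simp add: \<phi>.add \<phi>.diff Dm)
    then show ?thesis by (simp add: g_def x'_def)
  qed
  have lin: "rta_linear N (E q) id" by unfold_locales (auto simp: linear_maps_def N_def)
  have lin': "rta_linear N (E q) g"
  proof (unfold_locales, unfold linear_maps_def, safe)
    fix u assume "u \<in> carrier N"
    then obtain x where u: "u = \<phi> x" "x \<in> carrier M" by (auto simp: N_def)
    then show "g u \<in> carrier (E q)" by (simp add: g Dm Cm)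
    {
      fix a :: 'a
      have "g (\<phi> (a \<odot>\<^bsub>M\<^esub> x)) = a \<odot>\<^bsub>E q\<^esub> g (\<phi> x)"
      proof -
        have "g (\<phi> (a \<odot>\<^bsub>M\<^esub> x)) = (\<theta> a \<odot>\<^bsub>E q\<^esub> \<phi> x \<oplus>\<^bsub>E q\<^esub> a \<odot>\<^bsub>E q\<^esub> \<phi> (D x)) \<ominus>\<^bsub>E q\<^esub>
            (\<theta> a \<odot>\<^bsub>E q\<^esub> \<phi> x \<oplus>\<^bsub>E q\<^esub> a \<odot>\<^bsub>E q\<^esub> C (\<phi> x))"
          using u by (subst g) (simp_all add: Dm Cm \<phi>.add \<phi>.smult)
        also have "\<dots> = a \<odot>\<^bsub>E q\<^esub> g (\<phi> x)"
          using u by (simp add: E.add_diff_swap g Dm Cm E.smult_diff)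
        finally show ?thesis .
      qed
      then show "g (a \<odot>\<^bsub>N\<^esub> u) = a \<odot>\<^bsub>E q\<^esub> g u"
        unfolding u using u(2) by (simp add: N_def \<phi>.smult)
    }
    fix v assume "v \<in> carrier N"
    then obtain y where v: "v = \<phi> y" "y \<in> carrier M" by (auto simp: N_def)
    have "g (\<phi> (x \<oplus>\<^bsub>M\<^esub> y)) = (\<phi> (D x) \<oplus>\<^bsub>E q\<^esub> \<phi> (D y)) \<ominus>\<^bsub>E q\<^esub> (C (\<phi> x) \<oplus>\<^bsub>E q\<^esub> C (\<phi> y))"
      using u v by (subst g) (simp_all add: Dm Cm \<phi>.add)
    also have "\<dots> = g u \<oplus>\<^bsub>E q\<^esub> g v"
      using u v by (simp add: E.add_diff_swap g Dm Cm)
    finally show "g (u \<oplus>\<^bsub>N\<^esub> v) = g u \<oplus>\<^bsub>E q\<^esub> g v"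
      unfolding u v using u(2) v(2) by (simp add: N_def \<phi>.add)
  qed
  obtain h where h: "rta_linear (E q) (E q) h" "\<And>x. x \<in> carrier N \<Longrightarrow> h (id x) = g x"
    by (rule extend_linear[OF lin _ lin']) auto
  interpret h: rta_linear "E q" "E q" h by fact
  define D' where "D' = (\<lambda>x. C x \<oplus>\<^bsub>E q\<^esub> h x)"
  have "connection_on \<theta> (E q) D'"
    unfolding connection_on_def D'_def by (auto simp: Cm h.add h.smult E.smult_add E.a_ac)
  moreover have "D' (\<phi> x) = \<phi> (D x)" if x: "x \<in> carrier M" for x
  proof -
    have "D' (\<phi> x) = C (\<phi> x) \<oplus>\<^bsub>E q\<^esub> (\<phi> (D x) \<ominus>\<^bsub>E q\<^esub> C (\<phi> x))"
      using x h(2)[of "\<phi> x"] by (simp add: D'_def g N_def)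
    also have "\<dots> = \<phi> (D x)"
      using x by (simp add: E.add_diff_cancel Dm Cm)
    finally show ?thesis .
  qed
  ultimately show ?thesis by blast
qed

text \<open>Dependent choice in the degree. The invariant includes preservation of the kernel of
  \<open>d q\<close>, which is the condition for extending along \<open>d q\<close> to the next
  degree. By exactness that kernel is the image of \<epsilon> or of the previous differential, on
  which the map is already prescribed.\<close>

lemma derivation_lift:
  assumes "derivation \<theta>" and inf: "infinite (UNIV :: 'a set)"
  obtains D where "\<And>q. connection_on \<theta> (E q) (D q)"
    "\<And>q x. x \<in> carrier (E q) \<Longrightarrow> D (Suc q) (d q x) = d q (D q x)" "\<And>a. D 0 (\<epsilon> a) = \<epsilon> (\<theta> a)"
proof -
  interpret derivation \<theta> by fact
  have "connection_on \<theta> (self_module rta) \<theta>"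
    by (auto simp: connection_on_def add mult)
  from connection_extend[OF assms eps.rta_linear_axioms this]
  obtain D0 where D0: "connection_on \<theta> (E 0) D0" "\<And>a. D0 (\<epsilon> a) = \<epsilon> (\<theta> a)"
    using inj_eps[of _ 0] eps.zero zero by auto
  define P where "P = (\<lambda>q D. connection_on \<theta> (E q) D \<and>
    (q = 0 \<longrightarrow> (\<forall>a. D (\<epsilon> a) = \<epsilon> (\<theta> a))) \<and>
    (\<forall>x\<in>carrier (E q). d q x = \<zero>\<^bsub>E (Suc q)\<^esub> \<longrightarrow> d q (D x) = \<zero>\<^bsub>E (Suc q)\<^esub>))"
  have P0: "P 0 D0" unfolding P_def using D0 by (auto dest!: exact_eps)
  have step: "\<exists>D'. P (Suc q) D' \<and> (\<forall>x\<in>carrier (E q). D' (d q x) = d q (D x))" if D: "P q D" for q D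
  proof -
    obtain D' where D': "connection_on \<theta> (E (Suc q)) D'" "\<And>x. x \<in> carrier (E q) \<Longrightarrow> D' (d q x) = d q (D x)"
      using connection_extend[OF assms d.rta_linear_axioms, of q D] D by (auto simp: P_def)
    have "d (Suc q) (D' x) = \<zero>\<^bsub>E (Suc (Suc q))\<^esub>"
      if x: "x \<in> carrier (E (Suc q))" "d (Suc q) x = \<zero>\<^bsub>E (Suc (Suc q))\<^esub>" for x
    proof -
      obtain y where y: "y \<in> carrier (E q)" "x = d q y" using exact_d[OF x] by blast
      have "D y \<in> carrier (E q)" using D y(1) by (auto simp: P_def intro: E.connection_closed)
      then show ?thesis using y by (simp add: D'(2))
    qed
    then have "P (Suc q) D'" unfolding P_def using D'(1) by simp
    with D' show ?thesis by blast
  qed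
  have "\<exists>D. \<forall>q. P q (D q) \<and> (\<forall>x\<in>carrier (E q). D (Suc q) (d q x) = d q (D q x))"
    by (rule dependent_nat_choice) (use P0 step in blast)+
  then obtain D where "\<And>q. P q (D q)" "\<And>q x. x \<in> carrier (E q) \<Longrightarrow> D (Suc q) (d q x) = d q (D q x)"
    by blast
  then show ?thesis by (intro that[of D]) (auto simp: P_def)
qed

end

section \<open>The Cech complex of an injective module\<close>

lemma cech_elt_rta [simp]: "cech_elt rta (fs :: 'a::comm_ring_1 list) S = (\<Prod>j\<in>S. fs ! j)"
  by (simp add: cech_elt_def rta_finprod)

lemma finite_cech_index: "S \<in> cech_index fs p \<Longrightarrow> finite S"
  by (auto simp: cech_index_def intro: finite_subset)

lemma cech_index_remove: "S \<in> cech_index fs (Suc p) \<Longrightarrow> j \<in> S \<Longrightarrow> S - {j} \<in> cech_index fs p"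
  by (auto simp: cech_index_def)

lemma cech_index_0 [simp]: "cech_index fs 0 = {{}}"
  using finite_subset by (fastforce simp: cech_index_def)

context rta_module
begin

lemma tors_prod:
  assumes "x \<in> carrier M" "finite S" "T \<subseteq> S" "(\<Prod>j\<in>T. f j) \<in> tors x"
  shows "(\<Prod>j\<in>S. f j) \<in> tors x"
  using assms tors_mult[of x "\<Prod>j\<in>T. f j" "\<Prod>j\<in>S - T. f j"] prod.subset_diff[of T S f]
  by (simp add: mult.commute)

text \<open>The alternating sum of the Cech complex on families in \<open>M\<close> itself, thought
  of as numerators over denominator 1. Families are total functions on sets of positions, so no
  index conditions arise.\<close>

definition cdiff :: "(nat set \<Rightarrow> 'e) \<Rightarrow> nat set \<Rightarrow> 'e" where
  "cdiff n S = (\<Oplus>j\<in>S. (- 1) ^ card {l \<in> S. l < j} \<odot> n (S - {j}))"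

lemma cdiff_closed [simp]: "(\<And>S. n S \<in> carrier M) \<Longrightarrow> cdiff n S \<in> carrier M"
  by (auto simp: cdiff_def intro!: finsum_closed)

lemma cdiff_cong:
  "(\<And>S. n S \<in> carrier M) \<Longrightarrow> (\<And>j. j \<in> S \<Longrightarrow> n (S - {j}) = m (S - {j})) \<Longrightarrow> cdiff n S = cdiff m S"
  unfolding cdiff_def by (rule finsum_cong'[symmetric]) (auto simp del: smult_simps intro: smult_simps)

lemma cdiff_add:
  assumes "\<And>S. n S \<in> carrier M" "\<And>S. m S \<in> carrier M"
  shows "cdiff (\<lambda>S. n S \<oplus> m S) S = cdiff n S \<oplus> cdiff m S"
  using assms by (simp add: cdiff_def smult_add finsum_addf Pi_def)

lemma cdiff_smult:
  assumes "\<And>S. n S \<in> carrier M"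
  shows "cdiff (\<lambda>S. a \<odot> n S) S = a \<odot> cdiff n S"
  using assms by (simp add: cdiff_def smult_finsum smult_commute[of _ a] Pi_def)

lemma cdiff_diff:
  assumes "\<And>S. n S \<in> carrier M" "\<And>S. m S \<in> carrier M"
  shows "cdiff (\<lambda>S. n S \<ominus> m S) S = cdiff n S \<ominus> cdiff m S"
  using cdiff_add[OF assms(1), of "\<lambda>S. (- 1) \<odot> m S"] cdiff_smult[OF assms(2), of "- 1"] assms
  by (simp add: minus_eq smult_laws)

lemma cdiff_zero [simp]: "cdiff (\<lambda>S. \<zero>) S = \<zero>"
  by (simp add: cdiff_def)

lemma cdiff_empty [simp]: "cdiff n {} = \<zero>"
  by (simp add: cdiff_def)

lemma cdiff_tors:
  assumes "\<And>S. n S \<in> carrier M" "\<And>j. j \<in> S \<Longrightarrow> f \<in> tors (n (S - {j}))"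
  shows "f \<in> tors (cdiff n S)"
  unfolding cdiff_def using assms by (intro tors_finsum tors_smult) (auto simp: Pi_def)

text \<open>A position above all others leaves the signs at the remaining positions unchanged. This
  is the recursion behind both inductions over the set of positions.\<close>

lemma cdiff_insert_max:
  assumes n: "\<And>S. n S \<in> carrier M" and A: "finite A" "\<And>j. j \<in> A \<Longrightarrow> j < a"
  shows "cdiff n (insert a A) = (- 1) ^ card A \<odot> n A \<oplus> cdiff (\<lambda>T. n (insert a T)) A"
proof -
  have a: "a \<notin> A" using A by blast
  have "{l \<in> insert a A. l < a} = A" using A by auto
  moreover have "insert a A - {a} = A" using a by auto
  moreover have "{l \<in> insert a A. l < j} = {l \<in> A. l < j}" "insert a A - {j} = insert a (A - {j})"
    if "j \<in> A" for j using A(2)[OF that] by auto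
  ultimately show ?thesis
    unfolding cdiff_def using n A(1) a
    by (subst finsum_insert) (auto simp: Pi_def intro!: arg_cong2[of _ _ _ _ "(\<oplus>)"] finsum_cong')
qed

lemma smult_sign_sign [simp]: "x \<in> carrier M \<Longrightarrow> (- 1) ^ k \<odot> ((- 1) ^ k \<odot> x) = x"
  by (simp add: smult_laws(2)[symmetric] power_mult_distrib[symmetric])

lemma cdiff_cdiff:
  assumes "finite S" "\<And>S. n S \<in> carrier M" shows "cdiff (cdiff n) S = \<zero>"
  using assms
proof (induction S arbitrary: n rule: finite_linorder_max_induct)
  case (insert a A)
  have "cdiff (cdiff n) (insert a A) =
      (- 1) ^ card A \<odot> cdiff n A \<oplus> cdiff (\<lambda>T. cdiff n (insert a T)) A"
    using insert by (intro cdiff_insert_max) auto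
  also have "cdiff (\<lambda>T. cdiff n (insert a T)) A =
      cdiff (\<lambda>T. (- 1) ^ (card A - 1) \<odot> n T \<oplus> cdiff (\<lambda>T. n (insert a T)) T) A"
  proof (rule cdiff_cong)
    fix j assume "j \<in> A"
    then show "cdiff n (insert a (A - {j})) = (- 1) ^ (card A - 1) \<odot> n (A - {j}) \<oplus>
        cdiff (\<lambda>T. n (insert a T)) (A - {j})"
      using insert by (subst cdiff_insert_max) auto
  qed (use insert.prems in auto)
  also have "\<dots> = (- 1) ^ (card A - 1) \<odot> cdiff n A"
    using insert by (simp add: cdiff_add cdiff_smult)
  \<comment> \<open>For nonempty \<open>A\<close> the two signs are opposite. For empty
    \<open>A\<close> both differentials vanish, so the truncated \<open>card A - 1\<close> does no
    harm.\<close>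
  also have "(- 1) ^ card A \<odot> cdiff n A \<oplus> (- 1) ^ (card A - 1) \<odot> cdiff n A = \<zero>"
  proof (cases "A = {}")
    case False
    then have "card A = Suc (card A - 1)" using insert.hyps(1) by (simp add: card_gt_0_iff)
    then have "(- 1 :: 'a) ^ card A = - ((- 1) ^ (card A - 1))" by (metis power_Suc mult_minus1)
    then show ?thesis using insert.prems by (simp add: smult_laws l_neg)
  qed simp
  finally show ?case .
qed simp

text \<open>Passing from the denominator over \<open>S - {j}\<close> to that over \<open>S\<close>
  multiplies the numerator by the \<open>k\<close>-th power of \<open>fs ! j\<close>; the common
  exponent \<open>k\<close> lets all summands be added as numerators.\<close>

lemma cech_diff_frac:
  assumes n: "\<And>S. n S \<in> carrier M" and S: "S \<in> cech_index fs (Suc p)"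
    and c: "\<And>T. T \<in> cech_index fs p \<Longrightarrow> c T = frac (\<Prod>j\<in>T. fs ! j) (n T) k"
  shows "cech_diff rta fs M p c S =
    frac (\<Prod>j\<in>S. fs ! j) (\<Oplus>j\<in>S. (- 1) ^ card {l \<in> S. l < j} \<odot> ((fs ! j) ^ k \<odot> n (S - {j}))) k"
proof -
  let ?f = "\<Prod>j\<in>S. fs ! j"
  have fin: "finite S" using S by (rule finite_cech_index)
  interpret L: rta_module "Loc ?f" by (rule rta_module_Loc)
  have restrict: "loc_restrict rta (\<Prod>l\<in>S - {j}. fs ! l) (fs ! j) M (c (S - {j})) =
      frac ?f ((fs ! j) ^ k \<odot> n (S - {j})) k" if "j \<in> S" for j
    using c[OF cech_index_remove[OF S that]] n prod.remove[OF fin that, of "(!) fs"]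
    by (simp add: loc_restrict_frac mult.commute)
  have "cech_diff rta fs M p c S = (\<Oplus>\<^bsub>Loc ?f\<^esub>j\<in>S.
      frac ?f ((- 1) ^ card {l \<in> S. l < j} \<odot> ((fs ! j) ^ k \<odot> n (S - {j}))) k)"
    using S n by (simp add: cech_diff_def, intro L.finsum_cong') (auto simp: restrict Loc_smult)
  also have "\<dots> = frac ?f (\<Oplus>j\<in>S. (- 1) ^ card {l \<in> S. l < j} \<odot> ((fs ! j) ^ k \<odot> n (S - {j}))) k"
    using n by (intro Loc_finsum) auto
  finally show ?thesis .
qed

lemma cech_diff_frac_0:
  assumes n: "\<And>S. n S \<in> carrier M" and S: "S \<in> cech_index fs (Suc p)"
    and c: "\<And>T. T \<in> cech_index fs p \<Longrightarrow> c T = frac (\<Prod>j\<in>T. fs ! j) (n T) 0"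
  shows "cech_diff rta fs M p c S = frac (\<Prod>j\<in>S. fs ! j) (cdiff n S) 0"
  using cech_diff_frac[OF assms] n by (simp add: cdiff_def)

end

lemma (in rta_linear) cdiff:
  assumes "\<And>S. n S \<in> carrier M"
  shows "\<phi> (M.cdiff n S) = N.cdiff (\<lambda>S. \<phi> (n S)) S"
  unfolding M.cdiff_def N.cdiff_def using assms by (subst finsum) (auto simp: smult)

context noetherian_resolution
begin

text \<open>By divisibility cochains with values in localizations of \<open>E q\<close> are represented by families in
  \<open>E q\<close>. The induction removes the last position \<open>a\<close>: a cocycle is changed by a coboundary so that it
  vanishes on sets containing \<open>a\<close>; then its other values are \<open>f S * f a\<close>-torsion, hence modulo
  \<open>f S\<close>-torsion they can be taken to be \<open>f a\<close>-torsion. The set \<open>F\<close> keeps track of such torsion conditions.\<close>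

lemma cech_exact:
  fixes f :: "nat \<Rightarrow> 'a"
  assumes "finite A" "\<And>S. m S \<in> carrier (E q)" "\<And>S. F \<subseteq> E.tors q (m S)"
    "\<And>S. S \<subseteq> A \<Longrightarrow> card S = Suc (Suc p) \<Longrightarrow> prod f S \<in> E.tors q (E.cdiff q m S)"
  shows "\<exists>b. (\<forall>S. b S \<in> carrier (E q)) \<and> (\<forall>S. F \<subseteq> E.tors q (b S)) \<and>
    (\<forall>S\<subseteq>A. card S = Suc p \<longrightarrow> prod f S \<in> E.tors q (m S \<ominus>\<^bsub>E q\<^esub> E.cdiff q b S))"
  using assms
proof (induction A arbitrary: F m rule: finite_linorder_max_induct)
  case empty
  then show ?case by (intro exI[of _ "\<lambda>_. \<zero>\<^bsub>E q\<^esub>"]) auto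
next
  case (insert a A)
  note m = insert.prems(1) and mF = insert.prems(2) and cocycle = insert.prems(3)
  have aA: "a \<notin> A" using insert.hyps(2) by blast
  have fin: "finite T" if "T \<subseteq> insert a A" for T
    using that insert.hyps(1) by (meson finite.insertI finite_subset)
  have ins: "E.cdiff q n (insert a T) =
      (- 1) ^ card T \<odot>\<^bsub>E q\<^esub> n T \<oplus>\<^bsub>E q\<^esub> E.cdiff q (\<lambda>T. n (insert a T)) T"
    if "T \<subseteq> A" "\<And>S. n S \<in> carrier (E q)" for T n
    using that insert.hyps fin[of T] by (intro E.cdiff_insert_max) auto
  \<comment> \<open>A partial contraction towards the position \<open>a\<close>. Its sign inverts
    the one in \<open>ins\<close>, so \<open>m1\<close> vanishes exactly, not just up to torsion, on
    sets containing \<open>a\<close>.\<close>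
  define b1 where "b1 = (\<lambda>T. if a \<in> T then \<zero>\<^bsub>E q\<^esub> else (- 1) ^ card T \<odot>\<^bsub>E q\<^esub> m (insert a T))"
  have b1: "b1 S \<in> carrier (E q)" "F \<subseteq> E.tors q (b1 S)" for S
    using m by (auto simp: b1_def intro: E.tors_smult[OF m subsetD[OF mF]])
  define m1 where "m1 = (\<lambda>S. m S \<ominus>\<^bsub>E q\<^esub> E.cdiff q b1 S)"
  have m1: "m1 S \<in> carrier (E q)" "F \<subseteq> E.tors q (m1 S)" for S
    using m b1(1) subsetD[OF mF] subsetD[OF b1(2)]
    by (auto simp: m1_def intro!: E.tors_diff E.cdiff_tors)
  have m1_a: "m1 (insert a T) = \<zero>\<^bsub>E q\<^esub>" if "T \<subseteq> A" for T
    using that aA m b1 by (auto simp: m1_def ins) (auto simp: b1_def)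
  have m1_cocycle: "prod f S \<in> E.tors q (E.cdiff q m1 S)" if "S \<subseteq> insert a A" "card S = Suc (Suc p)" for S
    using cocycle[OF that] fin[OF that(1)] m b1(1) by (simp add: m1_def E.cdiff_diff E.cdiff_cdiff)
  \<comment> \<open>In the cocycle condition at \<open>insert a S\<close> all terms but the one
    omitting \<open>a\<close> vanish, leaving \<open>m1 S\<close> up to sign.\<close>
  have tors_m1: "prod f S * f a \<in> E.tors q (m1 S)" if S: "S \<subseteq> A" "card S = Suc p" for S
  proof -
    have "a \<notin> S" "finite S" using S aA fin[of S] by auto
    then have "prod f (insert a S) \<in> E.tors q (E.cdiff q m1 (insert a S))"
      using S by (intro m1_cocycle) auto
    moreover have "E.cdiff q m1 (insert a S) = (- 1) ^ card S \<odot>\<^bsub>E q\<^esub> m1 S"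
    proof -
      have "E.cdiff q (\<lambda>T. m1 (insert a T)) S = E.cdiff q (\<lambda>T. \<zero>\<^bsub>E q\<^esub>) S"
        using S m1 by (intro E.cdiff_cong m1_a) auto
      then show ?thesis using S m1 by (simp add: ins)
    qed
    ultimately have "prod f S * f a \<in> E.tors q ((- 1) ^ card S \<odot>\<^bsub>E q\<^esub> m1 S)"
      using \<open>a \<notin> S\<close> \<open>finite S\<close> by (simp add: mult.commute)
    from E.tors_smult[OF _ this, of "(- 1) ^ card S"] show ?thesis using m1 by simp
  qed
  \<comment> \<open>The part of \<open>m1 S\<close> that is torsion for the product over
    \<open>S\<close> may be discarded, since the claim at \<open>S\<close> holds only modulo such
    torsion; the remainder \<open>z S\<close> is \<open>f a\<close>-torsion.\<close>
  have "\<exists>z. z \<in> carrier (E q) \<and> insert (f a) F \<subseteq> E.tors q z \<and>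
      (S \<subseteq> A \<longrightarrow> card S = Suc p \<longrightarrow> prod f S \<in> E.tors q (m1 S \<ominus>\<^bsub>E q\<^esub> z))" for S
  proof (cases "S \<subseteq> A \<and> card S = Suc p")
    case True
    obtain y z where yz: "y \<in> carrier (E q)" "z \<in> carrier (E q)" "m1 S = y \<oplus>\<^bsub>E q\<^esub> z"
      "insert (prod f S) F \<subseteq> E.tors q y" "insert (f a) F \<subseteq> E.tors q z"
      using torsion_decomposition_mult[OF m1(1) m1(2) tors_m1] True by metis
    have "m1 S \<ominus>\<^bsub>E q\<^esub> z = y" using yz(1,2) by (simp add: yz(3) E.minus_eq E.a_assoc E.r_neg)
    then show ?thesis using yz by (intro exI[of _ z]) simp
  qed (auto intro!: exI[of _ "\<zero>\<^bsub>E q\<^esub>"])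
  then obtain z where z: "\<And>S. z S \<in> carrier (E q)" "\<And>S. insert (f a) F \<subseteq> E.tors q (z S)"
    "\<And>S. S \<subseteq> A \<Longrightarrow> card S = Suc p \<Longrightarrow> prod f S \<in> E.tors q (m1 S \<ominus>\<^bsub>E q\<^esub> z S)"
    by metis
  \<comment> \<open>Each discarded value at \<open>S - {j}\<close> is torsion for a divisor of the
    product over \<open>S\<close>, so \<open>z\<close> is again a cocycle and the induction
    hypothesis applies to it with \<open>f a\<close> added to \<open>F\<close>.\<close>
  have "prod f S \<in> E.tors q (E.cdiff q z S)" if S: "S \<subseteq> A" "card S = Suc (Suc p)" for S
  proof -
    have t: "prod f S \<in> E.tors q (E.cdiff q (\<lambda>S. m1 S \<ominus>\<^bsub>E q\<^esub> z S) S)"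
    proof (rule E.cdiff_tors)
      fix j assume j: "j \<in> S"
      then have "prod f (S - {j}) \<in> E.tors q (m1 (S - {j}) \<ominus>\<^bsub>E q\<^esub> z (S - {j}))"
        using S by (intro z(3)) auto
      then show "prod f S \<in> E.tors q (m1 (S - {j}) \<ominus>\<^bsub>E q\<^esub> z (S - {j}))"
        using z m1 card_ge_0_finite[of S] S by (intro E.tors_prod[of _ q S "S - {j}" f]) auto
    qed (use m1 z in auto)
    have "prod f S \<in> E.tors q (E.cdiff q m1 S \<ominus>\<^bsub>E q\<^esub> (E.cdiff q m1 S \<ominus>\<^bsub>E q\<^esub> E.cdiff q z S))"
      by (rule E.tors_diff) (use t m1_cocycle[of S] S m1 z in \<open>auto simp: E.cdiff_diff\<close>)
    also have "E.cdiff q m1 S \<ominus>\<^bsub>E q\<^esub> (E.cdiff q m1 S \<ominus>\<^bsub>E q\<^esub> E.cdiff q z S) = E.cdiff q z S"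
      using m1 z by (simp add: E.minus_eq E.minus_add E.r_neg2)
    finally show ?thesis .
  qed
  from insert.IH[OF z(1,2) this] obtain b2 where b2: "\<And>S. b2 S \<in> carrier (E q)"
    "\<And>S. insert (f a) F \<subseteq> E.tors q (b2 S)"
    "\<And>S. S \<subseteq> A \<Longrightarrow> card S = Suc p \<Longrightarrow> prod f S \<in> E.tors q (z S \<ominus>\<^bsub>E q\<^esub> E.cdiff q b2 S)"
    by auto
  \<comment> \<open>The induction hypothesis constrains \<open>b2\<close> through subsets of
    \<open>A\<close> only; setting it to zero on sets containing \<open>a\<close> removes its
    unwanted contributions.\<close>
  define b3 where "b3 = (\<lambda>T. if a \<in> T then \<zero>\<^bsub>E q\<^esub> else b2 T)"
  have b3: "b3 S \<in> carrier (E q)" "insert (f a) F \<subseteq> E.tors q (b3 S)" for S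
    using b2 by (auto simp: b3_def)
  define b where "b = (\<lambda>S. b1 S \<oplus>\<^bsub>E q\<^esub> b3 S)"
  have split: "m S \<ominus>\<^bsub>E q\<^esub> E.cdiff q b S = m1 S \<ominus>\<^bsub>E q\<^esub> E.cdiff q b3 S" for S
    using m b1 b3 by (simp add: b_def m1_def E.cdiff_add E.minus_eq E.minus_add E.a_assoc)
  have "prod f S \<in> E.tors q (m S \<ominus>\<^bsub>E q\<^esub> E.cdiff q b S)"
    if S: "S \<subseteq> insert a A" "card S = Suc p" for S
  proof (cases "a \<in> S")
    case False
    then have SA: "S \<subseteq> A" using S by auto
    have "E.cdiff q b3 S = E.cdiff q b2 S"
      using b3 False by (intro E.cdiff_cong) (auto simp: b3_def)
    then have "m1 S \<ominus>\<^bsub>E q\<^esub> E.cdiff q b3 S =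
        (m1 S \<ominus>\<^bsub>E q\<^esub> z S) \<oplus>\<^bsub>E q\<^esub> (z S \<ominus>\<^bsub>E q\<^esub> E.cdiff q b2 S)"
      using m1 z b2 by (simp add: E.minus_eq E.a_assoc E.r_neg1)
    then show ?thesis
      unfolding split using z(3)[OF SA S(2)] b2(3)[OF SA S(2)] m1 z b2 by (auto intro!: E.tors_add)
  next
    case True
    define T where "T = S - {a}"
    have T: "S = insert a T" "T \<subseteq> A" "finite T" "a \<notin> T" using True S fin[of S] by (auto simp: T_def)
    have "E.cdiff q (\<lambda>T. b3 (insert a T)) T = \<zero>\<^bsub>E q\<^esub>"
      by (simp add: b3_def)
    then have "m1 S \<ominus>\<^bsub>E q\<^esub> E.cdiff q b3 S = \<zero>\<^bsub>E q\<^esub> \<ominus>\<^bsub>E q\<^esub> (- 1) ^ card T \<odot>\<^bsub>E q\<^esub> b3 T"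
      using T b3 m1_a[of T] by (simp add: ins)
    moreover have "f a \<in> E.tors q (\<zero>\<^bsub>E q\<^esub> \<ominus>\<^bsub>E q\<^esub> (- 1) ^ card T \<odot>\<^bsub>E q\<^esub> b3 T)"
      using b3 by (intro E.tors_diff E.tors_smult) auto
    \<comment> \<open>At sets containing \<open>a\<close> the only error is a signed value of
      \<open>b3\<close>. It is torsion for \<open>f a\<close>, a factor of the product over
      \<open>S\<close>; this is what the enlarged \<open>F\<close> was for.\<close>
    ultimately have "f a * prod f T \<in> E.tors q (m1 S \<ominus>\<^bsub>E q\<^esub> E.cdiff q b3 S)"
      using m1 b3 by (auto intro!: E.tors_mult)
    then show ?thesis unfolding split using T by simp
  qed
  moreover have "b S \<in> carrier (E q)" "F \<subseteq> E.tors q (b S)" for S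
    using b1 b3(1) subsetD[OF b3(2)] by (auto simp: b_def intro!: E.tors_add)
  ultimately show ?case by (intro exI[of _ b]) auto
qed

end

section \<open>Comparison of local cohomology with Cech cohomology\<close>

context rta_module
begin

lemma frac_diff_cong:
  assumes "x \<in> carrier M" "y \<in> carrier M" "x' \<in> carrier M" "y' \<in> carrier M"
    and "frac f x k = frac f x' k" "frac f y k = frac f y' k"
  shows "frac f (x \<ominus> y) k = frac f (x' \<ominus> y') k"
proof -
  have "(x \<ominus> y) \<ominus> (x' \<ominus> y') = (x \<ominus> x') \<ominus> (y \<ominus> y')"
    using assms by (simp add: minus_eq minus_add a_ac)
  then show ?thesis using assms by (simp add: frac_eq_same_denom tors_diff)
qed

lemma cdiff_frac_cong:
  assumes n: "\<And>S. n S \<in> carrier M" "\<And>S. m S \<in> carrier M" and "finite S"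
    and eq: "\<And>j. j \<in> S \<Longrightarrow> frac (prod f (S - {j})) (n (S - {j})) 0 = frac (prod f (S - {j})) (m (S - {j})) 0"
  shows "frac (prod f S) (cdiff n S) 0 = frac (prod f S) (cdiff m S) 0"
proof -
  have "prod f S \<in> tors (n (S - {j}) \<ominus> m (S - {j}))" if "j \<in> S" for j
    using eq[OF that] n \<open>finite S\<close> tors_prod[of _ S "S - {j}" f] by (auto simp: frac_eq_same_denom)
  then have "prod f S \<in> tors (cdiff (\<lambda>S. n S \<ominus> m S) S)"
    using n by (intro cdiff_tors) auto
  then show ?thesis using n by (simp add: frac_eq_same_denom cdiff_diff)
qed

end

lemma (in rta_linear) frac_cong:
  assumes "x \<in> carrier M" "y \<in> carrier M" "M.frac f x k = M.frac f y k"
  shows "N.frac f (\<phi> x) k = N.frac f (\<phi> y) k"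
  using assms loc_functor by metis

context noetherian_resolution
begin

text \<open>Exactness survives localization: after multiplication by a power \<open>f^t\<close>,
  \<open>x\<close> becomes a genuine cocycle \<open>d q y\<close>, and \<open>divisible\<close>
  replaces \<open>y / f^t\<close> by some \<open>u / 1\<close>.\<close>

lemma frac_exact:
  assumes x: "x \<in> carrier (E (Suc q))" and tors: "f \<in> E.tors (Suc (Suc q)) (d (Suc q) x)"
  shows "\<exists>u\<in>carrier (E q). E.frac (Suc q) f x 0 = E.frac (Suc q) f (d q u) 0"
proof -
  obtain t where "f ^ t \<odot>\<^bsub>E (Suc (Suc q))\<^esub> d (Suc q) x = \<zero>\<^bsub>E (Suc (Suc q))\<^esub>"
    using tors by (auto simp: E.tors_def)
  then have "d (Suc q) (f ^ t \<odot>\<^bsub>E (Suc q)\<^esub> x) = \<zero>\<^bsub>E (Suc (Suc q))\<^esub>"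
    using x by (simp add: d.smult)
  then obtain y where y: "y \<in> carrier (E q)" "f ^ t \<odot>\<^bsub>E (Suc q)\<^esub> x = d q y"
    using exact_d[of "f ^ t \<odot>\<^bsub>E (Suc q)\<^esub> x" q] x by auto
  obtain u where u: "u \<in> carrier (E q)" "E.frac q f u 0 = E.frac q f y t"
    using divisible[OF y(1)] .
  have "E.frac (Suc q) f x 0 = E.frac (Suc q) f (f ^ t \<odot>\<^bsub>E (Suc q)\<^esub> x) (0 + t)"
    using x by (simp only: E.frac_expand)
  also have "\<dots> = loc_functor rta f (E (Suc q)) (d q) (E.frac q f y t)"
    using y by (simp add: d.loc_functor)
  also have "\<dots> = E.frac (Suc q) f (d q u) 0"
    using u(1) by (simp add: u(2)[symmetric] d.loc_functor)
  finally show ?thesis using u(1) by blast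
qed

text \<open>The element \<open>w p S\<close> represents the component at \<open>S\<close> of the step in position \<open>(p, i - p)\<close> of the
  staircase in \<open>cech_corresponds\<close>.\<close>

abbreviation stair_step ::
  "'a list \<Rightarrow> (nat \<Rightarrow> nat set \<Rightarrow> 'e) \<Rightarrow> nat \<Rightarrow> nat \<Rightarrow> (nat set \<Rightarrow> 'e) \<Rightarrow> bool" where
  "stair_step fs w p q u \<equiv> (\<forall>S. u S \<in> carrier (E q)) \<and>
    (\<forall>S\<in>cech_index fs p. E.frac (Suc q) (\<Prod>j\<in>S. fs ! j) (w p S) 0 =
      E.frac (Suc q) (\<Prod>j\<in>S. fs ! j) (d q (u S)) 0) \<and>
    (\<forall>S\<in>cech_index fs (Suc p). E.frac q (\<Prod>j\<in>S. fs ! j) (w (Suc p) S) 0 =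
      E.frac q (\<Prod>j\<in>S. fs ! j) (E.cdiff q u S) 0)"

text \<open>The relation \<open>p + q = i\<close> avoids truncated subtraction. Steps agree only as
  fractions, so each \<open>w p S\<close> matters modulo torsion for the product over
  \<open>S\<close>.\<close>

definition stair :: "'a list \<Rightarrow> nat \<Rightarrow> (nat \<Rightarrow> nat set \<Rightarrow> 'e) \<Rightarrow> bool" where
  "stair fs i w \<longleftrightarrow> (\<forall>p q S. p + q = i \<longrightarrow> w p S \<in> carrier (E q)) \<and>
    (\<forall>p q. p + Suc q = i \<longrightarrow> (\<exists>u. stair_step fs w p q u))"

lemma stairD:
  assumes "stair fs i w"
  shows "p + q = i \<Longrightarrow> w p S \<in> carrier (E q)"
    and "p + Suc q = i \<Longrightarrow> \<exists>u. stair_step fs w p q u"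
  using assms unfolding stair_def by blast+

text \<open>By \<open>divisible\<close>, every cochain linking two steps has representatives with
  denominator 1, so the staircase can be lifted from the localizations to the modules
  \<open>E q\<close>.\<close>

lemma cech_corresponds_imp_stair:
  assumes x: "x \<in> carrier (E i)"
    and corr: "cech_corresponds rta E d \<epsilon> fs i x c"
  shows "\<exists>w. stair fs i w \<and> w 0 {} = x \<and> (\<forall>S\<in>cech_index fs i.
    E.frac 0 (\<Prod>j\<in>S. fs ! j) (w i S) 0 = loc_functor rta (\<Prod>j\<in>S. fs ! j) (E 0) \<epsilon> (c S))"
proof -
  let ?f = "\<lambda>S. \<Prod>j\<in>S. fs ! j"
  obtain v where v0: "v 0 = (\<lambda>S\<in>cech_index fs 0. E.frac i (?f S) x 0)"
    and vi: "v i = (\<lambda>S\<in>cech_index fs i. loc_functor rta (?f S) (E 0) \<epsilon> (c S))"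
    and step: "\<And>p. p < i \<Longrightarrow> \<exists>u \<in> cech_cochains rta fs (E (i - 1 - p)) p.
        v p = (\<lambda>S\<in>cech_index fs p. loc_functor rta (?f S) (E (i - p)) (d (i - 1 - p)) (u S)) \<and>
        v (Suc p) = cech_diff rta fs (E (i - 1 - p)) p u"
    using corr unfolding cech_corresponds_def cech_elt_rta by blast
  have "\<exists>u. p + Suc q = i \<longrightarrow> (\<forall>S. u S \<in> carrier (E q)) \<and>
      (\<forall>S\<in>cech_index fs p. v p S = E.frac (Suc q) (?f S) (d q (u S)) 0) \<and>
      (\<forall>S\<in>cech_index fs (Suc p). v (Suc p) S = E.frac q (?f S) (E.cdiff q u S) 0)" for p q
  proof (cases "p + Suc q = i")
    case True
    then have i: "p < i" "i - 1 - p = q" "i - p = Suc q" by auto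
    obtain C where C: "C \<in> cech_cochains rta fs (E q) p"
      "v p = (\<lambda>S\<in>cech_index fs p. loc_functor rta (?f S) (E (Suc q)) (d q) (C S))"
      "v (Suc p) = cech_diff rta fs (E q) p C"
      using step[OF i(1)] unfolding i by blast
    have "\<exists>u. u \<in> carrier (E q) \<and> (S \<in> cech_index fs p \<longrightarrow> C S = E.frac q (?f S) u 0)" for S
    proof (cases "S \<in> cech_index fs p")
      case True
      then have "C S \<in> carrier (E.Loc q (?f S))" using C(1) by (auto simp: cech_cochains_def)
      then obtain y k where y: "C S = E.frac q (?f S) y k" "y \<in> carrier (E q)" by (auto simp: E.carrier_Loc)
      obtain u where "u \<in> carrier (E q)" "E.frac q (?f S) u 0 = E.frac q (?f S) y k"
        using divisible[OF y(2)] .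
      then show ?thesis using y by auto
    qed auto
    then obtain u where u: "\<And>S. u S \<in> carrier (E q)"
      "\<And>S. S \<in> cech_index fs p \<Longrightarrow> C S = E.frac q (?f S) (u S) 0" by metis
    show ?thesis
      using u C(2,3) by (intro exI[of _ u]) (auto simp: d.loc_functor E.cech_diff_frac_0)
  qed auto
  then obtain U where U: "\<And>p q S. p + Suc q = i \<Longrightarrow> U p q S \<in> carrier (E q)"
      "\<And>p q S. p + Suc q = i \<Longrightarrow> S \<in> cech_index fs p \<Longrightarrow> v p S = E.frac (Suc q) (?f S) (d q (U p q S)) 0"
      "\<And>p q S. p + Suc q = i \<Longrightarrow> S \<in> cech_index fs (Suc p) \<Longrightarrow>
        v (Suc p) S = E.frac q (?f S) (E.cdiff q (U p q) S) 0"
    by metis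
  \<comment> \<open>Every step after the initial \<open>x\<close> is computed from the link before
    it; it then represents \<open>v\<close> by the choice of that link.\<close>
  define w where "w = (\<lambda>p S. case p of 0 \<Rightarrow> x | Suc p' \<Rightarrow> E.cdiff (i - p) (U p' (i - p)) S)"
  have w: "w p S \<in> carrier (E q)" if "p + q = i" for p q S
    using that x U(1)[of _ q] by (cases p) (auto simp: w_def)
  have vw: "v p S = E.frac q (?f S) (w p S) 0" if "p + q = i" "S \<in> cech_index fs p" for p q S
    using that U(3)[of _ q S] by (cases p) (auto simp: w_def v0)
  have "stair fs i w"
    unfolding stair_def
  proof (intro conjI allI impI)
    fix p q assume pq: "p + Suc q = i"
    then show "\<exists>u. stair_step fs w p q u"
      using U[OF pq] vw[OF pq] vw[of "Suc p" q] by (intro exI[of _ "U p q"]) auto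
  qed (use w in auto)
  moreover have "E.frac 0 (?f S) (w i S) 0 = loc_functor rta (?f S) (E 0) \<epsilon> (c S)"
    if "S \<in> cech_index fs i" for S
    using vw[of i 0 S] that vi by auto
  moreover have "w 0 {} = x" by (simp add: w_def)
  ultimately show ?thesis by blast
qed

lemma stair_imp_cech_corresponds:
  assumes w: "stair fs i w"
    and c: "\<And>S. S \<in> cech_index fs i \<Longrightarrow> E.frac 0 (\<Prod>j\<in>S. fs ! j) (w i S) 0 =
      loc_functor rta (\<Prod>j\<in>S. fs ! j) (E 0) \<epsilon> (c S)"
  shows "cech_corresponds rta E d \<epsilon> fs i (w 0 {}) c"
  unfolding cech_corresponds_def cech_elt_rta
proof (intro exI[of _ "\<lambda>p. \<lambda>S\<in>cech_index fs p. E.frac (i - p) (\<Prod>j\<in>S. fs ! j) (w p S) 0"]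
    conjI allI impI)
  let ?f = "\<lambda>S. \<Prod>j\<in>S. fs ! j"
  show "(\<lambda>S\<in>cech_index fs 0. E.frac (i - 0) (?f S) (w 0 S) 0) =
      (\<lambda>S\<in>cech_index fs 0. E.frac i (?f S) (w 0 {}) 0)"
    by (rule restrict_ext) auto
  show "(\<lambda>S\<in>cech_index fs i. E.frac (i - i) (?f S) (w i S) 0) =
      (\<lambda>S\<in>cech_index fs i. loc_functor rta (?f S) (E 0) \<epsilon> (c S))"
    by (rule restrict_ext) (simp add: c)
  fix p assume "p < i"
  then obtain q where pq: "p + Suc q = i" by (metis add_Suc_right less_iff_Suc_add)
  then have i: "i - 1 - p = q" "i - p = Suc q" "i - Suc p = q" by auto
  obtain u where u: "\<And>S. u S \<in> carrier (E q)"
    "\<And>S. S \<in> cech_index fs p \<Longrightarrow> E.frac (Suc q) (?f S) (w p S) 0 = E.frac (Suc q) (?f S) (d q (u S)) 0"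
    "\<And>S. S \<in> cech_index fs (Suc p) \<Longrightarrow> E.frac q (?f S) (w (Suc p) S) 0 = E.frac q (?f S) (E.cdiff q u S) 0"
    using stairD(2)[OF w pq] by blast
  let ?u = "\<lambda>S\<in>cech_index fs p. E.frac q (?f S) (u S) 0"
  show "\<exists>u\<in>cech_cochains rta fs (E (i - 1 - p)) p.
      (\<lambda>S\<in>cech_index fs p. E.frac (i - p) (?f S) (w p S) 0) =
      (\<lambda>S\<in>cech_index fs p. loc_functor rta (?f S) (E (i - p)) (d (i - 1 - p)) (u S)) \<and>
      (\<lambda>S\<in>cech_index fs (Suc p). E.frac (i - Suc p) (?f S) (w (Suc p) S) 0) =
      cech_diff rta fs (E (i - 1 - p)) p u"
    unfolding i
  proof (intro bexI[of _ ?u] conjI)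
    show "?u \<in> cech_cochains rta fs (E q) p"
      using u(1) by (auto simp: cech_cochains_def)
    show "(\<lambda>S\<in>cech_index fs p. E.frac (Suc q) (?f S) (w p S) 0) =
        (\<lambda>S\<in>cech_index fs p. loc_functor rta (?f S) (E (Suc q)) (d q) (?u S))"
      by (rule restrict_ext) (simp add: u d.loc_functor)
    show "(\<lambda>S\<in>cech_index fs (Suc p). E.frac q (?f S) (w (Suc p) S) 0) =
        cech_diff rta fs (E q) p ?u"
    proof
      fix S
      show "(\<lambda>S\<in>cech_index fs (Suc p). E.frac q (?f S) (w (Suc p) S) 0) S =
        cech_diff rta fs (E q) p ?u S"
        using E.cech_diff_frac_0[of u q S fs p ?u] u
        by (cases "S \<in> cech_index fs (Suc p)") (simp, simp add: cech_diff_def)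
    qed
  qed
qed

section \<open>Staircases ending in zero\<close>

lemma stair_diff:
  assumes "stair fs i w" "stair fs i w'"
  shows "stair fs i (\<lambda>p S. w p S \<ominus>\<^bsub>E (i - p)\<^esub> w' p S)"
  unfolding stair_def
proof (intro conjI allI impI)
  show "w p S \<ominus>\<^bsub>E (i - p)\<^esub> w' p S \<in> carrier (E q)" if "p + q = i" for p q S
    using that stairD(1)[OF assms(1), of p q S] stairD(1)[OF assms(2), of p q S] by auto
  fix p q assume pq: "p + Suc q = i"
  then have i: "i - p = Suc q" "i - Suc p = q" by auto
  let ?f = "\<lambda>S. \<Prod>j\<in>S. fs ! j"
  obtain u where u: "\<And>S. u S \<in> carrier (E q)"
    "\<And>S. S \<in> cech_index fs p \<Longrightarrow> E.frac (Suc q) (?f S) (w p S) 0 = E.frac (Suc q) (?f S) (d q (u S)) 0"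
    "\<And>S. S \<in> cech_index fs (Suc p) \<Longrightarrow> E.frac q (?f S) (w (Suc p) S) 0 = E.frac q (?f S) (E.cdiff q u S) 0"
    using stairD(2)[OF assms(1) pq] by blast
  obtain u' where u': "\<And>S. u' S \<in> carrier (E q)"
    "\<And>S. S \<in> cech_index fs p \<Longrightarrow> E.frac (Suc q) (?f S) (w' p S) 0 = E.frac (Suc q) (?f S) (d q (u' S)) 0"
    "\<And>S. S \<in> cech_index fs (Suc p) \<Longrightarrow> E.frac q (?f S) (w' (Suc p) S) 0 = E.frac q (?f S) (E.cdiff q u' S) 0"
    using stairD(2)[OF assms(2) pq] by blast
  have w: "w p S \<in> carrier (E (Suc q))" "w' p S \<in> carrier (E (Suc q))"
    "w (Suc p) S \<in> carrier (E q)" "w' (Suc p) S \<in> carrier (E q)" for S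
    using stairD(1)[OF assms(1)] stairD(1)[OF assms(2)] pq by auto
  show "\<exists>u. stair_step fs (\<lambda>p S. w p S \<ominus>\<^bsub>E (i - p)\<^esub> w' p S) p q u"
    unfolding i
  proof (intro exI[of _ "\<lambda>S. u S \<ominus>\<^bsub>E q\<^esub> u' S"] conjI allI ballI)
    fix S
    show "u S \<ominus>\<^bsub>E q\<^esub> u' S \<in> carrier (E q)" using u(1) u'(1) by simp
    show "E.frac (Suc q) (?f S) (w p S \<ominus>\<^bsub>E (Suc q)\<^esub> w' p S) 0 =
        E.frac (Suc q) (?f S) (d q (u S \<ominus>\<^bsub>E q\<^esub> u' S)) 0" if "S \<in> cech_index fs p"
      unfolding d.diff[OF u(1) u'(1)]
      by (rule E.frac_diff_cong) (use that u u' w in simp_all)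
    show "E.frac q (?f S) (w (Suc p) S \<ominus>\<^bsub>E q\<^esub> w' (Suc p) S) 0 =
        E.frac q (?f S) (E.cdiff q (\<lambda>S. u S \<ominus>\<^bsub>E q\<^esub> u' S) S) 0" if "S \<in> cech_index fs (Suc p)"
      unfolding E.cdiff_diff[OF u(1) u'(1)]
      by (rule E.frac_diff_cong) (use that u u' w in simp_all)
  qed
qed

text \<open>The vanishing is propagated back from the end of the staircase. If the link
  \<open>u\<close> and the \<open>d\<close>-closed family \<open>e\<close> have the same Cech
  differential, then \<open>u - e\<close> is a Cech cocycle in positive degree, so it agrees with
  \<open>cdiff b\<close> up to torsion. Hence \<open>d u = d (u - e)\<close> agrees with
  \<open>cdiff (d b)\<close>, and \<open>d b\<close> is the family for the previous step.\<close>

lemma stair_zero_end: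
  assumes w: "stair fs i w"
    and "\<And>S. S \<in> cech_index fs i \<Longrightarrow> E.frac 0 (\<Prod>j\<in>S. fs ! j) (w i S) 0 = E.frac 0 (\<Prod>j\<in>S. fs ! j) \<zero>\<^bsub>E 0\<^esub> 0"
  shows "Suc p + q = i \<Longrightarrow> \<exists>e. (\<forall>S. e S \<in> carrier (E q)) \<and> (\<forall>S. d q (e S) = \<zero>\<^bsub>E (Suc q)\<^esub>) \<and>
    (\<forall>S\<in>cech_index fs (Suc p). E.frac q (\<Prod>j\<in>S. fs ! j) (w (Suc p) S) 0 =
      E.frac q (\<Prod>j\<in>S. fs ! j) (E.cdiff q e S) 0)"
proof (induction q arbitrary: p)
  case 0
  then show ?case using assms(2) by (intro exI[of _ "\<lambda>_. \<zero>\<^bsub>E 0\<^esub>"]) auto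
next
  case (Suc q)
  let ?f = "\<lambda>S. \<Prod>j\<in>S. fs ! j"
  obtain e where e: "\<And>S. e S \<in> carrier (E q)" "\<And>S. d q (e S) = \<zero>\<^bsub>E (Suc q)\<^esub>"
    "\<And>S. S \<in> cech_index fs (Suc (Suc p)) \<Longrightarrow>
      E.frac q (?f S) (w (Suc (Suc p)) S) 0 = E.frac q (?f S) (E.cdiff q e S) 0"
    using Suc.IH[of "Suc p"] Suc.prems by (metis add_Suc_shift)
  obtain u where u: "\<And>S. u S \<in> carrier (E q)"
    "\<And>S. S \<in> cech_index fs (Suc p) \<Longrightarrow>
      E.frac (Suc q) (?f S) (w (Suc p) S) 0 = E.frac (Suc q) (?f S) (d q (u S)) 0"
    "\<And>S. S \<in> cech_index fs (Suc (Suc p)) \<Longrightarrow>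
      E.frac q (?f S) (w (Suc (Suc p)) S) 0 = E.frac q (?f S) (E.cdiff q u S) 0"
    using stairD(2)[OF w Suc.prems] by blast
  define m where "m = (\<lambda>S. u S \<ominus>\<^bsub>E q\<^esub> e S)"
  have m: "m S \<in> carrier (E q)" for S using u e by (simp add: m_def)
  have "?f S \<in> E.tors q (E.cdiff q m S)" if "S \<subseteq> {..<length fs}" "card S = Suc (Suc p)" for S
  proof -
    have "S \<in> cech_index fs (Suc (Suc p))" using that by (simp add: cech_index_def)
    then have "E.frac q (?f S) (E.cdiff q u S) 0 = E.frac q (?f S) (E.cdiff q e S) 0"
      using u(3)[of S] e(3)[of S] by simp
    then show ?thesis
      using u(1) e(1) by (simp add: E.frac_eq_same_denom E.cdiff_diff m_def)
  qed
  then obtain b where b: "\<And>S. b S \<in> carrier (E q)"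
    "\<And>S. S \<subseteq> {..<length fs} \<Longrightarrow> card S = Suc p \<Longrightarrow> ?f S \<in> E.tors q (m S \<ominus>\<^bsub>E q\<^esub> E.cdiff q b S)"
    using cech_exact[of "{..<length fs}" m q "{}" p "\<lambda>j. fs ! j"] m by auto
  have "E.frac (Suc q) (?f S) (w (Suc p) S) 0 = E.frac (Suc q) (?f S) (E.cdiff (Suc q) (\<lambda>S. d q (b S)) S) 0"
    if S: "S \<in> cech_index fs (Suc p)" for S
  proof -
    have "E.frac (Suc q) (?f S) (w (Suc p) S) 0 = E.frac (Suc q) (?f S) (d q (m S)) 0"
      using u e S by (simp add: m_def d.diff)
    also have "E.frac q (?f S) (m S) 0 = E.frac q (?f S) (E.cdiff q b S) 0"
      using b[of S] m S by (simp add: E.frac_eq_same_denom cech_index_def b(1))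
    then have "E.frac (Suc q) (?f S) (d q (m S)) 0 = E.frac (Suc q) (?f S) (d q (E.cdiff q b S)) 0"
      using m b(1) by (intro d.frac_cong) auto
    also have "d q (E.cdiff q b S) = E.cdiff (Suc q) (\<lambda>S. d q (b S)) S" using b(1) by (rule d.cdiff)
    finally show ?thesis .
  qed
  then show ?case using b(1) by (intro exI[of _ "\<lambda>S. d q (b S)"]) auto
qed

text \<open>In degree 0 the Cech complex is not exact: the kernel of its differential consists of
  the elements that are torsion for every entry of \<open>fs\<close>. So \<open>u - e\<close> at the
  empty set is a torsion primitive of the starting element. There the localization is at 1, which
  turns equality of fractions into equality.\<close>

lemma stair_zero_end_imp_coboundary:
  assumes w: "stair fs i w"
    and 0: "\<And>S. S \<in> cech_index fs i \<Longrightarrow> E.frac 0 (\<Prod>j\<in>S. fs ! j) (w i S) 0 = E.frac 0 (\<Prod>j\<in>S. fs ! j) \<zero>\<^bsub>E 0\<^esub> 0"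
  shows "case i of 0 \<Rightarrow> w 0 {} = \<zero>\<^bsub>E 0\<^esub> |
    Suc q \<Rightarrow> \<exists>y\<in>carrier (E q). set fs \<subseteq> E.tors q y \<and> w 0 {} = d q y"
proof (cases i)
  case 0
  then have "1 \<in> E.tors 0 (w 0 {})"
    using assms(2)[of "{}"] stairD(1)[OF w, of 0 0 "{}"] by (simp add: E.frac_eq_same_denom)
  then show ?thesis using stairD(1)[OF w, of 0 0 "{}"] 0 by (simp add: E.one_in_tors_iff)
next
  case (Suc q)
  let ?f = "\<lambda>S. \<Prod>j\<in>S. fs ! j"
  obtain e where e: "\<And>S. e S \<in> carrier (E q)" "\<And>S. d q (e S) = \<zero>\<^bsub>E (Suc q)\<^esub>"
    "\<And>S. S \<in> cech_index fs (Suc 0) \<Longrightarrow> E.frac q (?f S) (w (Suc 0) S) 0 = E.frac q (?f S) (E.cdiff q e S) 0"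
    using stair_zero_end[OF assms, of 0 q] unfolding Suc by (metis plus_1_eq_Suc One_nat_def)
  obtain u where u: "\<And>S. u S \<in> carrier (E q)"
    "\<And>S. S \<in> cech_index fs 0 \<Longrightarrow> E.frac (Suc q) (?f S) (w 0 S) 0 = E.frac (Suc q) (?f S) (d q (u S)) 0"
    "\<And>S. S \<in> cech_index fs (Suc 0) \<Longrightarrow> E.frac q (?f S) (w (Suc 0) S) 0 = E.frac q (?f S) (E.cdiff q u S) 0"
    using stairD(2)[OF w, of 0 q] unfolding Suc by (metis plus_nat.add_0)
  have wc: "w 0 {} \<in> carrier (E (Suc q))" using stairD(1)[OF w, of 0 "Suc q"] Suc by simp
  have "fs ! j \<in> E.tors q (u {} \<ominus>\<^bsub>E q\<^esub> e {})" if "j < length fs" for j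
  proof -
    \<comment> \<open>At a singleton the differential returns the value at the empty set.\<close>
    have "{j} \<in> cech_index fs (Suc 0)" using that by (auto simp: cech_index_def)
    then have "E.frac q (?f {j}) (E.cdiff q u {j}) 0 = E.frac q (?f {j}) (E.cdiff q e {j}) 0"
      using u(3) e(3) by metis
    moreover have "{l. l = j \<and> l < j} = {}" by auto
    ultimately show ?thesis using u(1) e(1) by (simp add: E.frac_eq_same_denom E.cdiff_def Pi_def)
  qed
  then have "set fs \<subseteq> E.tors q (u {} \<ominus>\<^bsub>E q\<^esub> e {})" by (auto simp: in_set_conv_nth)
  moreover have "1 \<in> E.tors (Suc q) (w 0 {} \<ominus>\<^bsub>E (Suc q)\<^esub> d q (u {}))"
    using u(1) u(2)[of "{}"] wc by (simp add: E.frac_eq_same_denom)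
  then have "w 0 {} = d q (u {} \<ominus>\<^bsub>E q\<^esub> e {})"
    using u(1) e wc by (simp add: E.one_in_tors_iff E.diff_eq_zero_iff d.diff)
  ultimately show ?thesis using Suc u(1) e(1) by auto
qed

text \<open>Two staircases over the same \<open>c\<close> have a difference ending in zero. This is
  injectivity of the comparison on cohomology, in terms of representatives.\<close>

lemma cech_corresponds_unique:
  assumes "x \<in> carrier (E i)" "x' \<in> carrier (E i)"
    and "cech_corresponds rta E d \<epsilon> fs i x c"
    and "cech_corresponds rta E d \<epsilon> fs i x' c"
  shows "case i of 0 \<Rightarrow> x = x' |
    Suc q \<Rightarrow> \<exists>y\<in>carrier (E q). set fs \<subseteq> E.tors q y \<and> x \<ominus>\<^bsub>E i\<^esub> x' = d q y"
proof -
  obtain w where w: "stair fs i w" "w 0 {} = x" "\<And>S. S \<in> cech_index fs i \<Longrightarrow>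
    E.frac 0 (\<Prod>j\<in>S. fs ! j) (w i S) 0 = loc_functor rta (\<Prod>j\<in>S. fs ! j) (E 0) \<epsilon> (c S)"
    using cech_corresponds_imp_stair[OF assms(1,3)] by blast
  obtain w' where w': "stair fs i w'" "w' 0 {} = x'" "\<And>S. S \<in> cech_index fs i \<Longrightarrow>
    E.frac 0 (\<Prod>j\<in>S. fs ! j) (w' i S) 0 = loc_functor rta (\<Prod>j\<in>S. fs ! j) (E 0) \<epsilon> (c S)"
    using cech_corresponds_imp_stair[OF assms(2,4)] by blast
  have "E.frac 0 (\<Prod>j\<in>S. fs ! j) (w i S \<ominus>\<^bsub>E (i - i)\<^esub> w' i S) 0 = E.frac 0 (\<Prod>j\<in>S. fs ! j) \<zero>\<^bsub>E 0\<^esub> 0"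
    if "S \<in> cech_index fs i" for S
  proof -
    have "E.frac 0 (\<Prod>j\<in>S. fs ! j) (w i S) 0 = E.frac 0 (\<Prod>j\<in>S. fs ! j) (w' i S) 0"
      using w(3)[OF that] w'(3)[OF that] by simp
    then show ?thesis
      using stairD(1)[OF w(1), of i 0 S] stairD(1)[OF w'(1), of i 0 S]
      by (simp add: E.frac_eq_same_denom)
  qed
  from stair_zero_end_imp_coboundary[OF stair_diff[OF w(1) w'(1)] this]
  show ?thesis using assms by (simp add: w w' E.diff_eq_zero_iff split: nat.splits)
qed

end

context noetherian_resolution
begin

text \<open>The staircase is built from \<open>x\<close> on. Up to torsion for the product over the
  respective set, its current last step stays annihilated by \<open>d\<close> and by the Cech
  differential: the first property produces the next link through \<open>frac_exact\<close>, the
  second restores the first one step later. At the end, clearing denominators puts the values into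
  the image of \<epsilon>.\<close>

lemma cech_corresponds_exists:
  assumes x: "x \<in> carrier (E i)" "d i x = \<zero>\<^bsub>E (Suc i)\<^esub>" "set fs \<subseteq> E.tors i x"
  shows "\<exists>c\<in>cech_cocycles rta fs (self_module rta) i.
    cech_corresponds rta E d \<epsilon> fs i x c"
proof -
  let ?f = "\<lambda>S. \<Prod>j\<in>S. fs ! j"
  have "\<exists>w. (\<forall>p q S. p + q = i \<longrightarrow> w p S \<in> carrier (E q)) \<and> w 0 {} = x \<and>
      (\<forall>p q. p + Suc q = i \<longrightarrow> p < l \<longrightarrow> (\<exists>u. stair_step fs w p q u)) \<and>
      (\<forall>q. l + q = i \<longrightarrow>
        (\<forall>S\<in>cech_index fs l. ?f S \<in> E.tors (Suc q) (d q (w l S))) \<and>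
        (\<forall>S\<in>cech_index fs (Suc l). ?f S \<in> E.tors q (E.cdiff q (w l) S)))" if "l \<le> i" for l
    using that
  proof (induction l)
    case 0
    \<comment> \<open>Only the value at 0 counts yet. Its Cech differential at \<open>{j}\<close> is
      torsion for \<open>fs ! j\<close> because \<open>x\<close> is.\<close>
    define w where "w = (\<lambda>p (S :: nat set). if p = 0 then x else \<zero>\<^bsub>E (i - p)\<^esub>)"
    have "?f S \<in> E.tors i (E.cdiff i (w 0) S)" if S: "S \<in> cech_index fs (Suc 0)" for S
    proof -
      obtain j where j: "S = {j}" "j < length fs"
        using S by (auto simp: cech_index_def card_1_singleton_iff)
      then have "fs ! j \<in> E.tors i x" using x(3) nth_mem by blast
      then have "fs ! j \<in> E.tors i (E.cdiff i (\<lambda>S. x) {j})" by (intro E.cdiff_tors x(1))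
      then show ?thesis using j by (simp add: w_def)
    qed
    then show ?case using x by (intro exI[of _ w]) (auto simp: w_def)
  next
    case (Suc l)
    from Suc.IH[OF Suc_leD[OF Suc.prems]]
    obtain w where w: "\<And>p q S. p + q = i \<Longrightarrow> w p S \<in> carrier (E q)" "w 0 {} = x"
      "\<And>p q. p + Suc q = i \<Longrightarrow> p < l \<Longrightarrow> \<exists>u. stair_step fs w p q u"
      and wl: "\<And>q. l + q = i \<Longrightarrow>
        (\<forall>S\<in>cech_index fs l. ?f S \<in> E.tors (Suc q) (d q (w l S))) \<and>
        (\<forall>S\<in>cech_index fs (Suc l). ?f S \<in> E.tors q (E.cdiff q (w l) S))"
      by blast
    obtain q where q: "l + Suc q = i" using Suc.prems by (metis add_Suc_shift le_Suc_ex)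
    note wc = w(1)[OF q]
    have "\<exists>u. u \<in> carrier (E q) \<and> (S \<in> cech_index fs l \<longrightarrow>
        E.frac (Suc q) (?f S) (w l S) 0 = E.frac (Suc q) (?f S) (d q u) 0)" for S
      using frac_exact[OF wc, of "?f S" S] wl[OF q] by (cases "S \<in> cech_index fs l") auto
    then obtain u where u: "\<And>S. u S \<in> carrier (E q)"
      "\<And>S. S \<in> cech_index fs l \<Longrightarrow> E.frac (Suc q) (?f S) (w l S) 0 = E.frac (Suc q) (?f S) (d q (u S)) 0"
      by metis
    define w' where "w' = w(Suc l := E.cdiff q u)"
    have link: "stair_step fs w' l q u" using u by (auto simp: w'_def)
    have links: "\<exists>u. stair_step fs w' p q' u" if "p + Suc q' = i" "p < l" for p q'
      using w(3)[OF that] that by (simp add: w'_def)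
    have links': "\<exists>u. stair_step fs w' p q' u" if p: "p + Suc q' = i" "p < Suc l" for p q'
    proof (cases "p = l")
      case True
      then have "q' = q" using p(1) q by simp
      then show ?thesis unfolding True using link by blast
    next
      case False
      then have "p < l" using p(2) by simp
      then show ?thesis by (rule links[OF p(1)])
    qed
    have closed: "w' p S \<in> carrier (E q')" if "p + q' = i" for p q' S
    proof (cases "p = Suc l")
      case True
      then have "q' = q" using that q by simp
      then show ?thesis using True u(1) by (simp add: w'_def)
    qed (use w(1)[OF that] in \<open>simp add: w'_def\<close>)
    have start: "w' 0 {} = x" using w(2) by (simp add: w'_def)
    \<comment> \<open>Here \<open>d\<close> of the new step is the Cech differential of
      \<open>d u\<close>, which agrees up to torsion with that of the old step.\<close>
    have tors_d: "?f S \<in> E.tors (Suc q) (d q (w' (Suc l) S))" if S: "S \<in> cech_index fs (Suc l)" for S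
    proof -
      have "E.frac (Suc q) (?f S) (E.cdiff (Suc q) (\<lambda>S. d q (u S)) S) 0 =
          E.frac (Suc q) (?f S) (E.cdiff (Suc q) (w l) S) 0"
        using u wc cech_index_remove[OF S] finite_cech_index[OF S]
        by (intro E.cdiff_frac_cong) auto
      also have "\<dots> = \<zero>\<^bsub>E.Loc (Suc q) (?f S)\<^esub>"
        using wl[OF q] S wc by (simp add: E.frac_eq_zero_iff)
      finally show ?thesis using u(1) by (simp add: E.frac_eq_zero_iff w'_def d.cdiff)
    qed
    have tors_cdiff: "?f S \<in> E.tors q (E.cdiff q (w' (Suc l)) S)" if S: "S \<in> cech_index fs (Suc (Suc l))" for S
      using u(1) finite_cech_index[OF S] by (simp add: w'_def E.cdiff_cdiff)
    have ends: "(\<forall>S\<in>cech_index fs (Suc l). ?f S \<in> E.tors (Suc q') (d q' (w' (Suc l) S))) \<and>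
        (\<forall>S\<in>cech_index fs (Suc (Suc l)). ?f S \<in> E.tors q' (E.cdiff q' (w' (Suc l)) S))"
      if "Suc l + q' = i" for q'
    proof -
      have "q' = q" using that q by simp
      then show ?thesis using tors_d tors_cdiff by blast
    qed
    show ?case
    proof (intro exI[of _ w'] conjI allI impI)
      show "w' p S \<in> carrier (E q')" if "p + q' = i" for p q' S using that by (rule closed)
      show "w' 0 {} = x" by (rule start)
      show "\<exists>u. stair_step fs w' p q' u" if "p + Suc q' = i" "p < Suc l" for p q' using that by (rule links')
      fix q' assume "Suc l + q' = i"
      from ends[OF this] show
        "\<forall>S\<in>cech_index fs (Suc l). ?f S \<in> E.tors (Suc q') (d q' (w' (Suc l) S))"
        "\<forall>S\<in>cech_index fs (Suc (Suc l)). ?f S \<in> E.tors q' (E.cdiff q' (w' (Suc l)) S)"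
        by blast+
    qed
  qed
  from this[OF order_refl]
  obtain w where w: "\<forall>p q S. p + q = i \<longrightarrow> w p S \<in> carrier (E q)" "w 0 {} = x"
      "\<forall>p q. p + Suc q = i \<longrightarrow> p < i \<longrightarrow> (\<exists>u. stair_step fs w p q u)"
    and ends: "\<forall>q. i + q = i \<longrightarrow>
        (\<forall>S\<in>cech_index fs i. ?f S \<in> E.tors (Suc q) (d q (w i S))) \<and>
        (\<forall>S\<in>cech_index fs (Suc i). ?f S \<in> E.tors q (E.cdiff q (w i) S))"
    by (elim exE conjE) (rule that)
  have wi: "\<And>S. S \<in> cech_index fs i \<Longrightarrow> ?f S \<in> E.tors (Suc 0) (d 0 (w i S))"
      "\<And>S. S \<in> cech_index fs (Suc i) \<Longrightarrow> ?f S \<in> E.tors 0 (E.cdiff 0 (w i) S)"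
    using ends[rule_format, of 0] by auto
  have stair: "stair fs i w"
    unfolding stair_def
  proof (intro conjI allI impI)
    show "w p S \<in> carrier (E q)" if "p + q = i" for p q S using w(1) that by blast
    show "\<exists>u. stair_step fs w p q u" if "p + Suc q = i" for p q
      by (rule w(3)[rule_format]) (use that in auto)
  qed
  have wc: "w i S \<in> carrier (E 0)" for S using w(1) by simp
  have "\<exists>t. S \<in> cech_index fs i \<longrightarrow> (\<exists>r. ?f S ^ t \<odot>\<^bsub>E 0\<^esub> w i S = \<epsilon> r)" for S
  proof (cases "S \<in> cech_index fs i")
    case True
    then obtain t where "?f S ^ t \<odot>\<^bsub>E (Suc 0)\<^esub> d 0 (w i S) = \<zero>\<^bsub>E (Suc 0)\<^esub>"
      using wi(1)[OF True] by (auto simp: E.tors_def)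
    then have "d 0 (?f S ^ t \<odot>\<^bsub>E 0\<^esub> w i S) = \<zero>\<^bsub>E (Suc 0)\<^esub>" using wc by (simp add: d.smult)
    then show ?thesis using exact_eps[of "?f S ^ t \<odot>\<^bsub>E 0\<^esub> w i S"] wc by auto
  qed auto
  then obtain t where t: "\<And>S. S \<in> cech_index fs i \<Longrightarrow> \<exists>r. ?f S ^ t S \<odot>\<^bsub>E 0\<^esub> w i S = \<epsilon> r" by metis
  \<comment> \<open>A single exponent for all sets, as \<open>cech_diff_frac\<close> requires; any
    bound for the finitely many \<open>t S\<close> would serve.\<close>
  define k where "k = (\<Sum>S\<in>cech_index fs i. t S)"
  have fin: "finite (cech_index fs i)"
    by (rule finite_subset[of _ "Pow {..<length fs}"]) (auto simp: cech_index_def)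
  have "\<exists>r. S \<in> cech_index fs i \<longrightarrow> ?f S ^ k \<odot>\<^bsub>E 0\<^esub> w i S = \<epsilon> r" for S
  proof (cases "S \<in> cech_index fs i")
    case True
    then have "t S \<le> k" unfolding k_def using fin by (intro member_le_sum) auto
    then have "?f S ^ k \<odot>\<^bsub>E 0\<^esub> w i S = ?f S ^ (k - t S) \<odot>\<^bsub>E 0\<^esub> (?f S ^ t S \<odot>\<^bsub>E 0\<^esub> w i S)"
      using wc by (simp add: E.smult_laws(2)[symmetric] power_add[symmetric])
    moreover obtain r where "?f S ^ t S \<odot>\<^bsub>E 0\<^esub> w i S = \<epsilon> r" using t[OF True] by blast
    ultimately have "?f S ^ k \<odot>\<^bsub>E 0\<^esub> w i S = \<epsilon> (?f S ^ (k - t S) * r)"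
      using eps.smult[of r "?f S ^ (k - t S)"] by simp
    then show ?thesis by blast
  qed auto
  then obtain r where r: "\<And>S. S \<in> cech_index fs i \<Longrightarrow> ?f S ^ k \<odot>\<^bsub>E 0\<^esub> w i S = \<epsilon> (r S)" by metis
  define c where "c = (\<lambda>S\<in>cech_index fs i. R.frac (?f S) (r S) k)"
  have c: "c S = R.frac (?f S) (r S) k" if "S \<in> cech_index fs i" for S using that by (simp add: c_def)
  have eps_c: "E.frac 0 (?f S) (w i S) 0 = loc_functor rta (?f S) (E 0) \<epsilon> (c S)"
    if S: "S \<in> cech_index fs i" for S
  proof -
    have "E.frac 0 (?f S) (w i S) 0 = E.frac 0 (?f S) (?f S ^ k \<odot>\<^bsub>E 0\<^esub> w i S) (0 + k)"
      using wc by (simp only: E.frac_expand)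
    then show ?thesis using S by (simp add: c r eps.loc_functor)
  qed
  have coc: "cech_diff rta fs (self_module rta) i c S = \<zero>\<^bsub>R.Loc (?f S)\<^esub>"
    if S: "S \<in> cech_index fs (Suc i)" for S
  proof -
    let ?s = "\<lambda>j. (- 1 :: 'a) ^ card {l \<in> S. l < j}"
    let ?a = "\<Oplus>\<^bsub>self_module rta\<^esub>j\<in>S. ?s j * ((fs ! j) ^ k * r (S - {j}))"
    \<comment> \<open>The numerator of the Cech differential of \<open>c\<close> is examined in
      \<open>E 0\<close>, where it becomes a multiple of \<open>cdiff\<close> of the last step and
      hence torsion; injectivity of \<epsilon> carries this back to the ring.\<close>
    have "\<epsilon> ?a = (\<Oplus>\<^bsub>E 0\<^esub>j\<in>S. \<epsilon> (?s j * ((fs ! j) ^ k * r (S - {j}))))"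
      by (rule eps.finsum) auto
    also have "\<dots> = (\<Oplus>\<^bsub>E 0\<^esub>j\<in>S. ?s j \<odot>\<^bsub>E 0\<^esub> (?f S ^ k \<odot>\<^bsub>E 0\<^esub> w i (S - {j})))"
    proof (rule E.finsum_cong')
      fix j assume j: "j \<in> S"
      have "?f S = fs ! j * ?f (S - {j})"
        by (rule prod.remove[OF finite_cech_index[OF S] j])
      then have "(fs ! j) ^ k \<odot>\<^bsub>E 0\<^esub> \<epsilon> (r (S - {j})) = ?f S ^ k \<odot>\<^bsub>E 0\<^esub> w i (S - {j})"
        using r[OF cech_index_remove[OF S j]] wc
        by (simp add: E.smult_laws(2) power_mult_distrib)
      then show "\<epsilon> (?s j * ((fs ! j) ^ k * r (S - {j}))) =
          ?s j \<odot>\<^bsub>E 0\<^esub> (?f S ^ k \<odot>\<^bsub>E 0\<^esub> w i (S - {j}))"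
        using eps.smult[of "(fs ! j) ^ k * r (S - {j})" "?s j"] eps.smult[of "r (S - {j})" "(fs ! j) ^ k"]
        by simp
    qed (use wc in auto)
    also have "\<dots> = E.cdiff 0 (\<lambda>T. ?f S ^ k \<odot>\<^bsub>E 0\<^esub> w i T) S" by (simp add: E.cdiff_def)
    also have "\<dots> = ?f S ^ k \<odot>\<^bsub>E 0\<^esub> E.cdiff 0 (w i) S" using wc by (rule E.cdiff_smult)
    finally have "?f S \<in> E.tors 0 (\<epsilon> ?a)" using wi(2)[OF S] wc by (simp add: E.tors_smult)
    then obtain m where "?f S ^ m \<odot>\<^bsub>E 0\<^esub> \<epsilon> ?a = \<zero>\<^bsub>E 0\<^esub>" by (auto simp: E.tors_def)
    then have "\<epsilon> (?f S ^ m * ?a) = \<epsilon> 0" using eps.smult[of ?a "?f S ^ m"] eps.zero by simp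
    then have "?f S \<in> R.tors ?a" unfolding inj_eps by (auto simp: R.tors_def)
    then have "R.frac (?f S) ?a k = \<zero>\<^bsub>R.Loc (?f S)\<^esub>" by (subst R.frac_eq_zero_iff) auto
    then show ?thesis using R.cech_diff_frac[OF _ S c] by simp
  qed
  have "cech_diff rta fs (self_module rta) i c =
      (\<lambda>S\<in>cech_index fs (Suc i). \<zero>\<^bsub>R.Loc (?f S)\<^esub>)"
  proof
    show "cech_diff rta fs (self_module rta) i c S =
        (\<lambda>S\<in>cech_index fs (Suc i). \<zero>\<^bsub>R.Loc (?f S)\<^esub>) S" for S
      by (cases "S \<in> cech_index fs (Suc i)") (simp add: coc, simp add: cech_diff_def)
  qed
  then have "c \<in> cech_cocycles rta fs (self_module rta) i"
    by (auto simp: cech_cocycles_def cech_cochains_def c_def intro!: R.frac_in_Loc)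
  then show ?thesis
    using stair_imp_cech_corresponds[OF stair eps_c] w(2) by auto
qed

text \<open>Additive endomorphisms of the resolution compatible with torsion act on staircases; they need
  not be linear over the ring.\<close>

definition chain_op :: "(nat \<Rightarrow> 'e \<Rightarrow> 'e) \<Rightarrow> bool" where
  "chain_op L \<longleftrightarrow> (\<forall>q. \<forall>x\<in>carrier (E q). L q x \<in> carrier (E q) \<and> d q (L q x) = L (Suc q) (d q x) \<and>
      E.tors q x \<subseteq> E.tors q (L q x) \<and>
      (\<forall>y\<in>carrier (E q). L q (x \<oplus>\<^bsub>E q\<^esub> y) = L q x \<oplus>\<^bsub>E q\<^esub> L q y))"

context
  fixes L assumes L: "chain_op L"
begin

lemma chain_op_closed [simp]: "x \<in> carrier (E q) \<Longrightarrow> L q x \<in> carrier (E q)"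
  and chain_op_d: "x \<in> carrier (E q) \<Longrightarrow> d q (L q x) = L (Suc q) (d q x)"
  and chain_op_tors: "x \<in> carrier (E q) \<Longrightarrow> E.tors q x \<subseteq> E.tors q (L q x)"
  and chain_op_add: "x \<in> carrier (E q) \<Longrightarrow> y \<in> carrier (E q) \<Longrightarrow>
    L q (x \<oplus>\<^bsub>E q\<^esub> y) = L q x \<oplus>\<^bsub>E q\<^esub> L q y"
  using L by (auto simp: chain_op_def)

lemma chain_op_zero [simp]: "L q \<zero>\<^bsub>E q\<^esub> = \<zero>\<^bsub>E q\<^esub>"
  using chain_op_add[of "\<zero>\<^bsub>E q\<^esub>" q "\<zero>\<^bsub>E q\<^esub>"] chain_op_closed[of "\<zero>\<^bsub>E q\<^esub>" q] by simp

lemma chain_op_uminus: "x \<in> carrier (E q) \<Longrightarrow> L q (\<ominus>\<^bsub>E q\<^esub> x) = \<ominus>\<^bsub>E q\<^esub> L q x"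
  using chain_op_add[of "\<ominus>\<^bsub>E q\<^esub> x" q x] by (intro E.minus_equality[symmetric]) (auto simp: E.l_neg)

lemma chain_op_diff:
  "x \<in> carrier (E q) \<Longrightarrow> y \<in> carrier (E q) \<Longrightarrow> L q (x \<ominus>\<^bsub>E q\<^esub> y) = L q x \<ominus>\<^bsub>E q\<^esub> L q y"
  by (simp add: E.minus_eq chain_op_add chain_op_uminus)

lemma chain_op_sign: "x \<in> carrier (E q) \<Longrightarrow> L q ((- 1) ^ k \<odot>\<^bsub>E q\<^esub> x) = (- 1) ^ k \<odot>\<^bsub>E q\<^esub> L q x"
  by (induction k) (simp_all add: E.smult_laws chain_op_uminus)

lemma chain_op_finsum:
  "g \<in> S \<rightarrow> carrier (E q) \<Longrightarrow> L q (\<Oplus>\<^bsub>E q\<^esub>j\<in>S. g j) = (\<Oplus>\<^bsub>E q\<^esub>j\<in>S. L q (g j))"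
proof (induction S rule: infinite_finite_induct)
  case (insert j S)
  then show ?case by (simp add: Pi_def chain_op_add)
qed auto

lemma chain_op_cdiff:
  "(\<And>S. n S \<in> carrier (E q)) \<Longrightarrow> L q (E.cdiff q n S) = E.cdiff q (\<lambda>S. L q (n S)) S"
  unfolding E.cdiff_def by (subst chain_op_finsum) (auto simp: chain_op_sign)

text \<open>Equality of these fractions means torsion of the difference, a condition that
  \<open>L\<close> preserves. Thus \<open>L\<close> acts on fractions represented with denominator
  1.\<close>

lemma chain_op_frac_cong:
  "\<lbrakk>x \<in> carrier (E q); y \<in> carrier (E q); E.frac q f x 0 = E.frac q f y 0\<rbrakk> \<Longrightarrow>
    E.frac q f (L q x) 0 = E.frac q f (L q y) 0"
  using chain_op_tors[of "x \<ominus>\<^bsub>E q\<^esub> y" q] by (auto simp: E.frac_eq_same_denom chain_op_diff)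

lemma chain_op_stair:
  assumes w: "stair fs i w"
  shows "stair fs i (\<lambda>p S. L (i - p) (w p S))"
  unfolding stair_def
proof (intro conjI allI impI)
  show "L (i - p) (w p S) \<in> carrier (E q)" if "p + q = i" for p q S
    using that stairD(1)[OF w that] by auto
  fix p q assume pq: "p + Suc q = i"
  then have i: "i - p = Suc q" "i - Suc p = q" by auto
  let ?f = "\<lambda>S. \<Prod>j\<in>S. fs ! j"
  obtain u where u: "\<And>S. u S \<in> carrier (E q)"
    "\<And>S. S \<in> cech_index fs p \<Longrightarrow> E.frac (Suc q) (?f S) (w p S) 0 = E.frac (Suc q) (?f S) (d q (u S)) 0"
    "\<And>S. S \<in> cech_index fs (Suc p) \<Longrightarrow> E.frac q (?f S) (w (Suc p) S) 0 = E.frac q (?f S) (E.cdiff q u S) 0"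
    using stairD(2)[OF w pq] by blast
  have wc: "w p S \<in> carrier (E (Suc q))" "w (Suc p) S \<in> carrier (E q)" for S
    using stairD(1)[OF w] pq by auto
  show "\<exists>u. stair_step fs (\<lambda>p S. L (i - p) (w p S)) p q u"
    unfolding i
  proof (intro exI[of _ "\<lambda>S. L q (u S)"] conjI allI ballI)
    fix S
    show "L q (u S) \<in> carrier (E q)" using u(1) by simp
    show "E.frac (Suc q) (?f S) (L (Suc q) (w p S)) 0 = E.frac (Suc q) (?f S) (d q (L q (u S))) 0"
      if "S \<in> cech_index fs p"
      unfolding chain_op_d[OF u(1)] by (rule chain_op_frac_cong) (use that u wc in simp_all)
    show "E.frac q (?f S) (L q (w (Suc p) S)) 0 = E.frac q (?f S) (E.cdiff q (\<lambda>S. L q (u S)) S) 0"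
      if "S \<in> cech_index fs (Suc p)"
      unfolding chain_op_cdiff[of u q S, OF u(1), symmetric]
      by (rule chain_op_frac_cong) (use that u wc in simp_all)
  qed
qed

text \<open>The image of a staircase is a staircase, so only its last step has to be compared with
  the action on Cech cochains; \<open>act\<close> is that comparison.\<close>

lemma chain_op_cech_corresponds:
  assumes x: "x \<in> carrier (E i)" and corr: "cech_corresponds rta E d \<epsilon> fs i x c"
    and act: "\<And>S y. S \<in> cech_index fs i \<Longrightarrow> y \<in> carrier (E 0) \<Longrightarrow>
      E.frac 0 (\<Prod>j\<in>S. fs ! j) y 0 = loc_functor rta (\<Prod>j\<in>S. fs ! j) (E 0) \<epsilon> (c S) \<Longrightarrow>
      E.frac 0 (\<Prod>j\<in>S. fs ! j) (L 0 y) 0 = loc_functor rta (\<Prod>j\<in>S. fs ! j) (E 0) \<epsilon> (c' S)"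
  shows "cech_corresponds rta E d \<epsilon> fs i (L i x) c'"
proof -
  obtain w where w: "stair fs i w" "w 0 {} = x" "\<And>S. S \<in> cech_index fs i \<Longrightarrow>
    E.frac 0 (\<Prod>j\<in>S. fs ! j) (w i S) 0 = loc_functor rta (\<Prod>j\<in>S. fs ! j) (E 0) \<epsilon> (c S)"
    using cech_corresponds_imp_stair[OF x corr] by blast
  have "cech_corresponds rta E d \<epsilon> fs i (L (i - 0) (w 0 {})) c'"
    by (rule stair_imp_cech_corresponds[OF chain_op_stair[OF w(1)]])
      (use act w stairD(1)[OF w(1), of i 0] in simp)
  then show ?thesis by (simp add: w(2))
qed

end

end

section \<open>The Weyl algebra action\<close>

context rta_module
begin

section \<open>Additive operators and iterated commutators\<close>

definition additive :: "('e \<Rightarrow> 'e) \<Rightarrow> bool" where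
  "additive U \<longleftrightarrow> (\<forall>x\<in>carrier M. U x \<in> carrier M \<and> (\<forall>y\<in>carrier M. U (x \<oplus> y) = U x \<oplus> U y))"

lemma additiveD:
  assumes "additive U" "x \<in> carrier M"
  shows "U x \<in> carrier M" "y \<in> carrier M \<Longrightarrow> U (x \<oplus> y) = U x \<oplus> U y"
  using assms by (auto simp: additive_def)

lemma additive_zero: "additive U \<Longrightarrow> U \<zero> = \<zero>"
  using additiveD(1)[of U \<zero>] additiveD(2)[of U \<zero> \<zero>] by simp

lemma additive_uminus: "additive U \<Longrightarrow> x \<in> carrier M \<Longrightarrow> U (\<ominus> x) = \<ominus> U x"
  using additiveD(2)[of U "\<ominus> x" x] additiveD(1)[of U x] additiveD(1)[of U "\<ominus> x"] additive_zero[of U]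
  by (intro minus_equality[symmetric]) (auto simp: l_neg)

lemma additive_diff:
  "additive U \<Longrightarrow> x \<in> carrier M \<Longrightarrow> y \<in> carrier M \<Longrightarrow> U (x \<ominus> y) = U x \<ominus> U y"
  by (simp add: minus_eq additiveD additive_uminus)

lemma additive_smult: "additive ((\<odot>) a)"
  by (simp add: additive_def smult_add)

lemma additive_comp: "additive U \<Longrightarrow> additive V \<Longrightarrow> additive (\<lambda>x. U (V x))"
  by (simp add: additive_def)

lemma additive_sum: "additive U \<Longrightarrow> additive V \<Longrightarrow> additive (\<lambda>x. U x \<oplus> V x)"
  by (simp add: additive_def a_ac)

definition commutator :: "'a \<Rightarrow> ('e \<Rightarrow> 'e) \<Rightarrow> 'e \<Rightarrow> 'e" where
  "commutator f U x = U (f \<odot> x) \<ominus> f \<odot> U x"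

lemma additive_commutator:
  assumes U: "additive U" shows "additive (commutator f U)"
proof -
  have "commutator f U (x \<oplus> y) = commutator f U x \<oplus> commutator f U y"
    if "x \<in> carrier M" "y \<in> carrier M" for x y
    using that additiveD[OF U] by (simp add: commutator_def smult_add add_diff_swap)
  then show ?thesis
    using additiveD[OF U] by (simp add: additive_def commutator_def)
qed

text \<open>Grothendieck's condition for differential operators, tested against the single element
  \<open>f\<close>. Index 0 means the zero operator, so multiplications have index 1 and derivations
  index 2.\<close>

primrec ad_nilpotent :: "'a \<Rightarrow> nat \<Rightarrow> ('e \<Rightarrow> 'e) \<Rightarrow> bool" where
  "ad_nilpotent f 0 U \<longleftrightarrow> (\<forall>x\<in>carrier M. U x = \<zero>)"
| "ad_nilpotent f (Suc n) U \<longleftrightarrow> ad_nilpotent f n (commutator f U)"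

lemma ad_nilpotent_cong:
  "(\<And>x. x \<in> carrier M \<Longrightarrow> U x = V x) \<Longrightarrow> ad_nilpotent f n U \<Longrightarrow> ad_nilpotent f n V"
proof (induction n arbitrary: U V)
  case (Suc n)
  have "commutator f U x = commutator f V x" if "x \<in> carrier M" for x
    using that by (simp add: commutator_def Suc.prems(1))
  moreover have "ad_nilpotent f n (commutator f U)" using Suc.prems(2) by simp
  ultimately have "ad_nilpotent f n (commutator f V)" by (rule Suc.IH)
  then show ?case by simp
next
  case 0
  then show ?case by (metis ad_nilpotent.simps(1))
qed

lemma ad_nilpotent_mono:
  assumes "ad_nilpotent f m U" "m \<le> n" shows "ad_nilpotent f n U"
proof -
  have step: "ad_nilpotent f (Suc n) U" if "ad_nilpotent f n U" for n U
    using that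
  proof (induction n arbitrary: U)
    case (Suc n)
    then show ?case using Suc.IH[of "commutator f U"] by simp
  qed (simp add: commutator_def)
  show ?thesis using assms(2)
    by (induction n rule: dec_induct) (use assms(1) step in blast)+
qed

lemma ad_nilpotent_sum:
  "\<lbrakk>additive U; additive V; ad_nilpotent f n U; ad_nilpotent f n V\<rbrakk> \<Longrightarrow>
    ad_nilpotent f n (\<lambda>x. U x \<oplus> V x)"
proof (induction n arbitrary: U V)
  case (Suc n)
  have "commutator f U x \<oplus> commutator f V x = commutator f (\<lambda>x. U x \<oplus> V x) x" if "x \<in> carrier M" for x
    using that Suc.prems(1,2) additiveD by (simp add: commutator_def smult_add add_diff_swap)
  then have "ad_nilpotent f n (commutator f (\<lambda>x. U x \<oplus> V x))"
    by (rule ad_nilpotent_cong) (use Suc in \<open>auto intro!: Suc.IH additive_commutator\<close>)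
  then show ?case by simp
qed simp

text \<open>The commutator of a composite is \<open>U [V, f] + [U, f] V\<close>, where each summand
  has total index smaller by one. If either index is 0, the composite vanishes.\<close>

lemma ad_nilpotent_comp:
  "\<lbrakk>additive U; additive V; ad_nilpotent f m U; ad_nilpotent f n V\<rbrakk> \<Longrightarrow>
    ad_nilpotent f (m + n) (\<lambda>x. U (V x))"
proof (induction "m + n" arbitrary: U V m n)
  case 0
  then show ?case by (simp add: additive_def)
next
  case (Suc k)
  note U = Suc.prems(1) and V = Suc.prems(2)
  show ?case
  proof (cases "m = 0 \<or> n = 0")
    case True
    then have "ad_nilpotent f 0 (\<lambda>x. U (V x))"
      using Suc.prems additiveD[OF V] additive_zero[OF U] by auto
    then show ?thesis by (rule ad_nilpotent_mono) simp
  next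
    case False
    then obtain m' n' where mn: "m = Suc m'" "n = Suc n'" by (metis not0_implies_Suc)
    have "ad_nilpotent f (m + n') (\<lambda>x. U (commutator f V x))"
      using Suc mn by (intro Suc.hyps(1)) (auto intro: additive_commutator)
    moreover have "ad_nilpotent f (m' + n) (\<lambda>x. commutator f U (V x))"
      using Suc mn by (intro Suc.hyps(1)) (auto intro: additive_commutator)
    then have "ad_nilpotent f (m + n') (\<lambda>x. commutator f U (V x))" by (simp add: mn)
    ultimately have "ad_nilpotent f (m + n') (\<lambda>x. U (commutator f V x) \<oplus> commutator f U (V x))"
      by (intro ad_nilpotent_sum additive_comp[OF U] additive_comp[OF _ V] additive_commutator U V)
    moreover have "U (commutator f V x) \<oplus> commutator f U (V x) = commutator f (\<lambda>x. U (V x)) x"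
      if x: "x \<in> carrier M" for x
    proof -
      note c = x additiveD[OF U] additiveD[OF V] additive_diff[OF U]
      have "U (commutator f V x) = U (V (f \<odot> x)) \<ominus> U (f \<odot> V x)"
        using c by (simp add: commutator_def)
      then show ?thesis using c by (simp add: commutator_def minus_eq a_assoc r_neg1)
    qed
    ultimately have "ad_nilpotent f (m + n') (commutator f (\<lambda>x. U (V x)))"
      by (rule ad_nilpotent_cong[rotated])
    then show ?thesis using mn by simp
  qed
qed

lemma ad_nilpotent_smult: "ad_nilpotent f 1 ((\<odot>) a)"
  by (simp add: commutator_def smult_commute[of _ a f])

section \<open>The quotient rule for a connection\<close>

context
  fixes \<theta> D
  assumes \<theta>: "derivation \<theta>" and D: "connection_on \<theta> M D"
begin

interpretation derivation \<theta> by (rule \<theta>)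

text \<open>Expanding \<open>x / f^k\<close> by \<open>f^j\<close> multiplies the numerator of the
  quotient rule by \<open>f^(2j)\<close>, exactly as much as its denominator, since the mixed terms
  cancel.\<close>

lemma connection_quotient_rule_expand:
  assumes x: "x \<in> carrier M"
  shows "f ^ (k + j) \<odot> D (f ^ j \<odot> x) \<ominus> \<theta> (f ^ (k + j)) \<odot> (f ^ j \<odot> x) =
    f ^ (2 * j) \<odot> (f ^ k \<odot> D x \<ominus> \<theta> (f ^ k) \<odot> x)"
proof -
  note c = x connection_closed[OF D x]
  have "f ^ (k + j) \<odot> D (f ^ j \<odot> x) = (f ^ (k + j) * \<theta> (f ^ j)) \<odot> x \<oplus> (f ^ (2 * j) * f ^ k) \<odot> D x"
    using c by (simp add: connection_smult[OF D] smult_add smult_laws(2)[symmetric] power_add mult_2 mult_2_right ac_simps)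
  moreover have "\<theta> (f ^ (k + j)) \<odot> (f ^ j \<odot> x) =
      (f ^ (k + j) * \<theta> (f ^ j)) \<odot> x \<oplus> (f ^ (2 * j) * \<theta> (f ^ k)) \<odot> x"
    using c by (simp add: power_add mult smult_laws(1,2)[symmetric] algebra_simps mult_2 mult_2_right)
  ultimately show ?thesis
    using c by (simp add: add_diff_swap smult_diff smult_laws(2))
qed

lemma connection_frac_cong:
  assumes x: "x \<in> carrier M" and y: "y \<in> carrier M" and eq: "frac f x k = frac f y l"
  shows "frac f (f ^ k \<odot> D x \<ominus> \<theta> (f ^ k) \<odot> x) (2 * k) = frac f (f ^ l \<odot> D y \<ominus> \<theta> (f ^ l) \<odot> y) (2 * l)"
proof -
  have expand: "frac f (f ^ k \<odot> D x \<ominus> \<theta> (f ^ k) \<odot> x) (2 * k) =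
      frac f (f ^ (k + j) \<odot> D (f ^ j \<odot> x) \<ominus> \<theta> (f ^ (k + j)) \<odot> (f ^ j \<odot> x)) (2 * (k + j))"
    if "x \<in> carrier M" for x k j
    unfolding connection_quotient_rule_expand[OF that]
    using that connection_closed[OF D that] frac_expand[of "f ^ k \<odot> D x \<ominus> \<theta> (f ^ k) \<odot> x" f "2 * j" "2 * k"]
    by (simp add: distrib_left)
  obtain t where t: "f ^ (t + l) \<odot> x = f ^ (t + k) \<odot> y" using eq x y by (auto simp: frac_eq_iff)
  \<comment> \<open>Both fractions are expanded to the exponent \<open>k + l + t\<close>, at which
    their numerators coincide.\<close>
  have "k + (t + l) = l + (t + k)" by simp
  then show ?thesis using expand[OF x, of k "t + l"] expand[OF y, of l "t + k"] t by metis
qed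

end

end

section \<open>Weyl operators on localizations of the polynomial ring\<close>

lemma derivation_partial_deriv: "derivation (partial_deriv i)"
  by unfold_locales (rule partial_deriv_add partial_deriv_mult)+

lemma partial_deriv_one [simp]: "partial_deriv i 1 = 0"
  by (rule derivation.one[OF derivation_partial_deriv])

interpretation poly: rta_module "self_module mpoly_ring :: (('n::finite, 'k::field_char_0) mpoly, _) module"
  by (rule rta_module_self)

interpretation poly_loc: rta_module "poly_loc f" for f :: "('n::finite, 'k::field_char_0) mpoly"
  by (rule poly.rta_module_Loc)

context
  fixes f :: "('n::finite, 'k::field_char_0) mpoly"
begin

lemma poly_diff [simp]: "a \<ominus>\<^bsub>self_module mpoly_ring\<^esub> b = a - (b :: ('n, 'k) mpoly)"
proof -
  have "\<ominus>\<^bsub>self_module mpoly_ring\<^esub> b = - b" by (rule poly.minus_equality) auto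
  then show ?thesis by (simp add: poly.minus_eq)
qed

lemma loc_deriv_frac:
  "loc_deriv f i (poly.frac f r k) = poly.frac f (partial_deriv i r * f ^ k - r * partial_deriv i (f ^ k)) (2 * k)"
proof -
  have conn: "connection_on (partial_deriv i) (self_module mpoly_ring) (partial_deriv i :: ('n, 'k) mpoly \<Rightarrow> _)"
    by (auto simp: connection_on_def partial_deriv_add partial_deriv_mult)
  show ?thesis
    unfolding loc_deriv_def
  proof (rule poly.UN_frac)
    fix s l assume "poly.frac f s l = poly.frac f r k"
    from poly.connection_frac_cong[OF derivation_partial_deriv conn _ _ this]
    show "poly.frac f (partial_deriv i s * f ^ l - s * partial_deriv i (f ^ l)) (2 * l) =
        poly.frac f (partial_deriv i r * f ^ k - r * partial_deriv i (f ^ k)) (2 * k)"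
      by (simp add: mult.commute)
  qed simp
qed

lemma additive_loc_deriv: "poly_loc.additive f (loc_deriv f i)"
proof -
  have 1: "\<exists>r k. C = poly.frac f r k" if "C \<in> carrier (poly_loc f)" for C
    using that by (auto simp: poly.carrier_Loc)
  have 2: "\<exists>r s k. C = poly.frac f r k \<and> D = poly.frac f s k"
    if "C \<in> carrier (poly_loc f)" "D \<in> carrier (poly_loc f)" for C D
    using poly.Loc_common_denom[OF that that(1)] by metis
  have "loc_deriv f i C \<in> carrier (poly_loc f)" if "C \<in> carrier (poly_loc f)" for C
    using 1[OF that] by (auto simp: loc_deriv_frac)
  moreover have "loc_deriv f i (C \<oplus>\<^bsub>poly_loc f\<^esub> D) = loc_deriv f i C \<oplus>\<^bsub>poly_loc f\<^esub> loc_deriv f i D"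
    if "C \<in> carrier (poly_loc f)" "D \<in> carrier (poly_loc f)" for C D
    using 2[OF that] by (auto simp: loc_deriv_frac poly.Loc_add_same_denom partial_deriv_add algebra_simps)
  ultimately show ?thesis by (simp add: poly_loc.additive_def)
qed

lemma commutator_loc_deriv:
  assumes "C \<in> carrier (poly_loc f)"
  shows "poly_loc.commutator f f (loc_deriv f i) C = partial_deriv i f \<odot>\<^bsub>poly_loc f\<^esub> C"
proof -
  obtain r k where C: "C = poly.frac f r k" using assms by (auto simp: poly.carrier_Loc)
  let ?q = "partial_deriv i r * f ^ k - r * partial_deriv i (f ^ k)"
  have "partial_deriv i (f * r) * f ^ k - (f * r) * partial_deriv i (f ^ k) =
      f * ?q + f ^ k * (partial_deriv i f * r)"
    by (simp add: partial_deriv_mult algebra_simps)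
  then have "loc_deriv f i (f \<odot>\<^bsub>poly_loc f\<^esub> C) = f \<odot>\<^bsub>poly_loc f\<^esub> loc_deriv f i C \<oplus>\<^bsub>poly_loc f\<^esub>
      poly.frac f (f ^ k * (partial_deriv i f * r)) (2 * k)"
    by (simp add: C poly.Loc_smult loc_deriv_frac poly.Loc_add_same_denom)
  also have "poly.frac f (f ^ k * (partial_deriv i f * r)) (2 * k) = partial_deriv i f \<odot>\<^bsub>poly_loc f\<^esub> C"
    using poly.frac_expand[of "partial_deriv i f * r" f k k] by (simp add: C poly.Loc_smult mult_2)
  finally have "loc_deriv f i (f \<odot>\<^bsub>poly_loc f\<^esub> C) =
      f \<odot>\<^bsub>poly_loc f\<^esub> loc_deriv f i C \<oplus>\<^bsub>poly_loc f\<^esub> partial_deriv i f \<odot>\<^bsub>poly_loc f\<^esub> C" .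
  then show ?thesis
    using assms poly_loc.additiveD(1)[OF additive_loc_deriv assms]
    by (simp add: poly_loc.commutator_def poly_loc.minus_eq poly_loc.a_ac poly_loc.r_neg1 poly_loc.r_neg2 poly_loc.r_neg)
qed

text \<open>An expression in the generators evaluates to a differential operator with respect to
  \<open>f\<close> that agrees with \<open>P\<close> on fractions \<open>r / 1\<close>. These
  properties no longer mention the expression, and they determine the operator.\<close>

lemma weyl_loc_rep_properties:
  assumes "weyl_loc_rep f P T"
  shows "poly_loc.additive f T \<and> (\<exists>n. poly_loc.ad_nilpotent f f n T) \<and>
    (\<forall>r. T (poly.frac f r 0) = poly.frac f (P r) 0)"
  using assms
proof induction
  case (const c)
  then show ?case
    by (intro conjI allI exI[of _ 1] poly_loc.additive_smult poly_loc.ad_nilpotent_smult)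
      (simp add: poly.Loc_smult)
next
  case (var i)
  then show ?case
    by (intro conjI allI exI[of _ 1] poly_loc.additive_smult poly_loc.ad_nilpotent_smult)
      (simp add: poly.Loc_smult)
next
  case (deriv i)
  have "poly_loc.ad_nilpotent f f 1 (poly_loc.commutator f f (loc_deriv f i))"
    by (rule poly_loc.ad_nilpotent_cong[OF _ poly_loc.ad_nilpotent_smult])
      (rule commutator_loc_deriv[symmetric])
  then have "poly_loc.ad_nilpotent f f (Suc 1) (loc_deriv f i)" by simp
  then show ?case
    by (intro conjI allI exI[of _ "Suc 1"] additive_loc_deriv) (auto simp: loc_deriv_frac)
next
  case (add P S Q T)
  then obtain m n where "poly_loc.ad_nilpotent f f m S" "poly_loc.ad_nilpotent f f n T" by blast
  then have "poly_loc.ad_nilpotent f f (max m n) S" "poly_loc.ad_nilpotent f f (max m n) T"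
    by (auto intro: poly_loc.ad_nilpotent_mono)
  then have "poly_loc.ad_nilpotent f f (max m n) (\<lambda>C. S C \<oplus>\<^bsub>poly_loc f\<^esub> T C)"
    using add by (intro poly_loc.ad_nilpotent_sum) auto
  then show ?case
    using add poly_loc.additive_sum[of f S T] by (auto simp: poly.Loc_add_same_denom)
next
  case (comp P S Q T)
  then show ?case
    using poly_loc.ad_nilpotent_comp poly_loc.additive_comp unfolding comp_def by metis
qed

text \<open>By induction \<open>U\<close> commutes with \<open>f\<close>, so it vanishes on \<open>r / f^k\<close> because it vanishes on \<open>r\<close>.\<close>

lemma ad_nilpotent_eq_zero:
  assumes "poly_loc.additive f U" "poly_loc.ad_nilpotent f f n U"
    and "\<And>r. U (poly.frac f r 0) = \<zero>\<^bsub>poly_loc f\<^esub>" and "C \<in> carrier (poly_loc f)"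
  shows "U C = \<zero>\<^bsub>poly_loc f\<^esub>"
  using assms
proof (induction n arbitrary: U C)
  case (Suc n)
  note U = Suc.prems(1)
  have "poly_loc.commutator f f U C = \<zero>\<^bsub>poly_loc f\<^esub>" if "C \<in> carrier (poly_loc f)" for C
  proof (rule Suc.IH[OF poly_loc.additive_commutator[OF U] _ _ that])
    show "poly_loc.ad_nilpotent f f n (poly_loc.commutator f f U)" using Suc.prems(2) by simp
    show "poly_loc.commutator f f U (poly.frac f r 0) = \<zero>\<^bsub>poly_loc f\<^esub>" for r
      by (simp add: poly_loc.commutator_def poly.Loc_smult Suc.prems(3))
  qed
  then have comm: "U (f \<odot>\<^bsub>poly_loc f\<^esub> C) = f \<odot>\<^bsub>poly_loc f\<^esub> U C" if "C \<in> carrier (poly_loc f)" for C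
    using that poly_loc.additiveD(1)[OF U] by (simp add: poly_loc.commutator_def poly_loc.diff_eq_zero_iff)
  have comm_pow: "U (f ^ k \<odot>\<^bsub>poly_loc f\<^esub> C) = f ^ k \<odot>\<^bsub>poly_loc f\<^esub> U C"
    if "C \<in> carrier (poly_loc f)" for C k
    using that poly_loc.additiveD(1)[OF U] by (induction k) (simp_all add: poly_loc.smult_laws comm)
  obtain r k where C: "C = poly.frac f r k" using Suc.prems by (auto simp: poly.carrier_Loc)
  obtain s l where UC: "U C = poly.frac f s l"
    using poly_loc.additiveD(1)[OF U Suc.prems(4)] by (auto simp: poly.carrier_Loc)
  have "f ^ k \<odot>\<^bsub>poly_loc f\<^esub> C = poly.frac f r 0"
    using poly.frac_expand[of r f k 0] by (simp add: C poly.Loc_smult)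
  then have "f ^ k \<odot>\<^bsub>poly_loc f\<^esub> U C = \<zero>\<^bsub>poly_loc f\<^esub>"
    using comm_pow[OF Suc.prems(4), of k] Suc.prems(3) by simp
  then have "f \<in> poly.tors (f ^ k * s)" by (simp add: UC poly.Loc_smult poly.frac_eq_zero_iff)
  then show ?case using poly.tors_smult_cancel[of s f k] by (simp add: UC poly.frac_eq_zero_iff)
qed (metis poly_loc.ad_nilpotent.simps(1))

text \<open>The difference of the two evaluations is ad-nilpotent and vanishes on all
  \<open>r / 1\<close>, hence is zero. Writing it as a sum with \<open>(- 1)\<close> times
  \<open>T\<close> brings it under the closure rules for sums and composites.\<close>

lemma weyl_loc_rep_unique:
  assumes S: "weyl_loc_rep f P S" and T: "weyl_loc_rep f P T" and C: "C \<in> carrier (poly_loc f)"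
  shows "S C = T C"
proof -
  note S' = weyl_loc_rep_properties[OF S] and T' = weyl_loc_rep_properties[OF T]
  define V where "V = (\<lambda>C. (- 1) \<odot>\<^bsub>poly_loc f\<^esub> T C)"
  have V: "poly_loc.additive f V" "\<exists>n. poly_loc.ad_nilpotent f f n V"
    unfolding V_def using T' poly_loc.additive_comp[OF poly_loc.additive_smult]
      poly_loc.ad_nilpotent_comp[OF poly_loc.additive_smult _ poly_loc.ad_nilpotent_smult] by blast+
  obtain m n where "poly_loc.ad_nilpotent f f m S" "poly_loc.ad_nilpotent f f n V" using S' V by blast
  then have "poly_loc.ad_nilpotent f f (max m n) S" "poly_loc.ad_nilpotent f f (max m n) V"
    by (auto intro: poly_loc.ad_nilpotent_mono)
  then have nil: "poly_loc.ad_nilpotent f f (max m n) (\<lambda>C. S C \<oplus>\<^bsub>poly_loc f\<^esub> V C)"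
    using S' V(1) by (intro poly_loc.ad_nilpotent_sum) auto
  have closed: "S C \<in> carrier (poly_loc f)" "T C \<in> carrier (poly_loc f)" if "C \<in> carrier (poly_loc f)" for C
    using S' T' that poly_loc.additiveD(1) by blast+
  have diff: "S C \<oplus>\<^bsub>poly_loc f\<^esub> V C = S C \<ominus>\<^bsub>poly_loc f\<^esub> T C" if "C \<in> carrier (poly_loc f)" for C
    using closed[OF that] by (simp add: V_def poly_loc.smult_laws poly_loc.minus_eq)
  have "S C \<oplus>\<^bsub>poly_loc f\<^esub> V C = \<zero>\<^bsub>poly_loc f\<^esub>"
  proof (rule ad_nilpotent_eq_zero[OF _ nil _ C])
    show "poly_loc.additive f (\<lambda>C. S C \<oplus>\<^bsub>poly_loc f\<^esub> V C)" using S' V(1) poly_loc.additive_sum by blast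
    show "S (poly.frac f r 0) \<oplus>\<^bsub>poly_loc f\<^esub> V (poly.frac f r 0) = \<zero>\<^bsub>poly_loc f\<^esub>" for r
      using S' T' diff[of "poly.frac f r 0"] poly.frac_in_Loc[of r f 0] by simp
  qed
  then show ?thesis using C closed[OF C] by (simp add: diff poly_loc.diff_eq_zero_iff)
qed

lemma weyl_loc_act_eq:
  "weyl_loc_rep f P T \<Longrightarrow> C \<in> carrier (poly_loc f) \<Longrightarrow> weyl_loc_act f P C = T C"
  unfolding weyl_loc_act_def by (rule the_equality) (metis weyl_loc_rep_unique)+

lemma weyl_loc_rep_exists: "P \<in> weyl_ops \<Longrightarrow> \<exists>T. weyl_loc_rep f P T"
  by (induction rule: weyl_ops.induct) (blast intro: weyl_loc_rep.intros)+

lemma weyl_loc_act_closed: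
  "P \<in> weyl_ops \<Longrightarrow> C \<in> carrier (poly_loc f) \<Longrightarrow> weyl_loc_act f P C \<in> carrier (poly_loc f)"
proof -
  assume P: "P \<in> weyl_ops" and C: "C \<in> carrier (poly_loc f)"
  obtain T where T: "weyl_loc_rep f P T" using weyl_loc_rep_exists[OF P] by blast
  then have "poly_loc.additive f T" using weyl_loc_rep_properties by blast
  then show ?thesis using poly_loc.additiveD(1) weyl_loc_act_eq[OF T C] C by simp
qed

lemma weyl_loc_act_add:
  assumes "P \<in> weyl_ops" "Q \<in> weyl_ops" "C \<in> carrier (poly_loc f)"
  shows "weyl_loc_act f (\<lambda>p. P p + Q p) C = weyl_loc_act f P C \<oplus>\<^bsub>poly_loc f\<^esub> weyl_loc_act f Q C"
proof -
  obtain S T where ST: "weyl_loc_rep f P S" "weyl_loc_rep f Q T"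
    using assms weyl_loc_rep_exists by blast
  show ?thesis
    unfolding weyl_loc_act_eq[OF weyl_loc_rep.add[OF ST] assms(3)]
      weyl_loc_act_eq[OF ST(1) assms(3)] weyl_loc_act_eq[OF ST(2) assms(3)] ..
qed

lemma weyl_loc_act_comp:
  assumes "P \<in> weyl_ops" "Q \<in> weyl_ops" "C \<in> carrier (poly_loc f)"
  shows "weyl_loc_act f (P \<circ> Q) C = weyl_loc_act f P (weyl_loc_act f Q C)"
proof -
  obtain S T where ST: "weyl_loc_rep f P S" "weyl_loc_rep f Q T" using assms weyl_loc_rep_exists by blast
  have Q: "weyl_loc_act f Q C = T C" by (rule weyl_loc_act_eq[OF ST(2) assms(3)])
  have "T C \<in> carrier (poly_loc f)" using weyl_loc_act_closed[OF assms(2,3)] unfolding Q .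
  then show ?thesis
    unfolding Q weyl_loc_act_eq[OF weyl_loc_rep.comp[OF ST] assms(3)] by (simp add: weyl_loc_act_eq[OF ST(1)])
qed

end

section \<open>Lifting Weyl operators to the resolution\<close>

locale weyl_resolution = noetherian_resolution E d \<epsilon>
  for E :: "nat \<Rightarrow> (('n::finite, 'k::field_char_0) mpoly, 'e) module" and d :: "nat \<Rightarrow> 'e \<Rightarrow> 'e"
    and \<epsilon> :: "('n, 'k) mpoly \<Rightarrow> 'e"
begin

text \<open>The second clause ties \<open>L 0\<close> to the action on fractions: if
  \<open>x / 1\<close> is the image of \<open>C\<close>, then \<open>L 0 x / 1\<close> is the image
  of \<open>P C\<close>. Asking it for all \<open>f\<close> makes one lift serve every list of
  generators.\<close>

definition weyl_lift :: "(('n, 'k) mpoly \<Rightarrow> ('n, 'k) mpoly) \<Rightarrow> (nat \<Rightarrow> 'e \<Rightarrow> 'e) \<Rightarrow> bool" where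
  "weyl_lift P L \<longleftrightarrow> chain_op L \<and> (\<forall>f C x. C \<in> carrier (poly_loc f) \<longrightarrow> x \<in> carrier (E 0) \<longrightarrow>
     E.frac 0 f x 0 = loc_functor mpoly_ring f (E 0) \<epsilon> C \<longrightarrow>
     E.frac 0 f (L 0 x) 0 = loc_functor mpoly_ring f (E 0) \<epsilon> (weyl_loc_act f P C))"

lemma weyl_lift_smult:
  assumes "\<And>f. weyl_loc_rep f P (\<lambda>C. a \<odot>\<^bsub>poly_loc f\<^esub> C)"
  shows "weyl_lift P (\<lambda>q x. a \<odot>\<^bsub>E q\<^esub> x)"
  unfolding weyl_lift_def
proof (intro conjI allI impI)
  show "chain_op (\<lambda>q x. a \<odot>\<^bsub>E q\<^esub> x)"
    by (auto simp: chain_op_def d.smult E.smult_add E.tors_smult)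
  fix f C x assume C: "C \<in> carrier (poly_loc f)" and x: "x \<in> carrier (E 0)"
    and eq: "E.frac 0 f x 0 = loc_functor mpoly_ring f (E 0) \<epsilon> C"
  obtain r k where rk: "C = poly.frac f r k" using C by (auto simp: poly.carrier_Loc)
  have "E.frac 0 f (a \<odot>\<^bsub>E 0\<^esub> x) 0 = a \<odot>\<^bsub>E.Loc 0 f\<^esub> E.frac 0 f x 0" using x by (simp add: E.Loc_smult)
  also have "\<dots> = E.frac 0 f (\<epsilon> (a * r)) k"
    unfolding eq using eps.smult[of r a] by (simp add: rk eps.loc_functor E.Loc_smult)
  finally show "E.frac 0 f (a \<odot>\<^bsub>E 0\<^esub> x) 0 = loc_functor mpoly_ring f (E 0) \<epsilon> (weyl_loc_act f P C)"
    using C by (simp add: weyl_loc_act_eq[OF assms] rk poly.Loc_smult eps.loc_functor)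
qed

text \<open>Both the lifted connection on \<open>E 0\<close> and the derivative on the polynomial
  ring satisfy the quotient rule, and \<epsilon> intertwines them.\<close>

lemma weyl_lift_deriv: "\<exists>L. weyl_lift (partial_deriv i) L"
proof -
  have inf: "infinite (UNIV :: ('n, 'k) mpoly set)" by (rule infinite_UNIV_char_0)
  obtain D where D: "\<And>q. connection_on (partial_deriv i) (E q) (D q)"
    "\<And>q x. x \<in> carrier (E q) \<Longrightarrow> D (Suc q) (d q x) = d q (D q x)" "\<And>a. D 0 (\<epsilon> a) = \<epsilon> (partial_deriv i a)"
    by (rule derivation_lift[OF derivation_partial_deriv inf, of i]) (rule that)
  have "chain_op D"
    unfolding chain_op_def
    using E.connection_closed[OF D(1)] E.connection_add[OF D(1)] E.connection_tors[OF D(1)] D(2) by auto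
  moreover have "E.frac 0 f (D 0 x) 0 = loc_functor mpoly_ring f (E 0) \<epsilon> (weyl_loc_act f (partial_deriv i) C)"
    if C: "C \<in> carrier (poly_loc f)" and x: "x \<in> carrier (E 0)"
      and eq: "E.frac 0 f x 0 = loc_functor mpoly_ring f (E 0) \<epsilon> C" for f C x
  proof -
    obtain r k where rk: "C = poly.frac f r k" using C by (auto simp: poly.carrier_Loc)
    have "E.frac 0 f x 0 = E.frac 0 f (\<epsilon> r) k" using eq by (simp add: rk eps.loc_functor)
    \<comment> \<open>With exponent 0 on the left, the quotient rule reduces to
      \<open>D 0 x\<close>.\<close>
    from E.connection_frac_cong[OF derivation_partial_deriv D(1) x _ this]
    have "E.frac 0 f (D 0 x) 0 =
        E.frac 0 f (f ^ k \<odot>\<^bsub>E 0\<^esub> \<epsilon> (partial_deriv i r) \<ominus>\<^bsub>E 0\<^esub> partial_deriv i (f ^ k) \<odot>\<^bsub>E 0\<^esub> \<epsilon> r) (2 * k)"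
      using x E.connection_closed[OF D(1) x] by (simp add: D(3))
    also have "f ^ k \<odot>\<^bsub>E 0\<^esub> \<epsilon> (partial_deriv i r) \<ominus>\<^bsub>E 0\<^esub> partial_deriv i (f ^ k) \<odot>\<^bsub>E 0\<^esub> \<epsilon> r =
        \<epsilon> (partial_deriv i r * f ^ k - r * partial_deriv i (f ^ k))"
      using eps.smult[of "partial_deriv i r" "f ^ k"] eps.smult[of r "partial_deriv i (f ^ k)"]
        eps.diff[of "partial_deriv i r * f ^ k" "r * partial_deriv i (f ^ k)"] by (simp add: mult.commute)
    finally show ?thesis
      using C by (simp add: weyl_loc_act_eq[OF weyl_loc_rep.deriv] rk loc_deriv_frac eps.loc_functor)
  qed
  ultimately show ?thesis unfolding weyl_lift_def by blast
qed

lemma weyl_lift_add: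
  assumes P: "P \<in> weyl_ops" "weyl_lift P K" and Q: "Q \<in> weyl_ops" "weyl_lift Q L"
  shows "weyl_lift (\<lambda>p. P p + Q p) (\<lambda>q x. K q x \<oplus>\<^bsub>E q\<^esub> L q x)"
  unfolding weyl_lift_def
proof (intro conjI allI impI)
  have K: "chain_op K" and L: "chain_op L" using P Q by (auto simp: weyl_lift_def)
  note KL = chain_op_closed[OF K] chain_op_closed[OF L] chain_op_add[OF K] chain_op_add[OF L]
    chain_op_d[OF K] chain_op_d[OF L]
  show "chain_op (\<lambda>q x. K q x \<oplus>\<^bsub>E q\<^esub> L q x)"
    unfolding chain_op_def
    by (auto simp: KL d.add E.a_ac intro!: E.tors_add
        intro: subsetD[OF chain_op_tors[OF K]] subsetD[OF chain_op_tors[OF L]])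
  fix f C x assume C: "C \<in> carrier (poly_loc f)" and x: "x \<in> carrier (E 0)"
    and eq: "E.frac 0 f x 0 = loc_functor mpoly_ring f (E 0) \<epsilon> C"
  obtain r s k where rs: "weyl_loc_act f P C = poly.frac f r k" "weyl_loc_act f Q C = poly.frac f s k"
    using poly.Loc_common_denom[OF weyl_loc_act_closed[OF P(1) C] weyl_loc_act_closed[OF Q(1) C] C] by metis
  have "E.frac 0 f (K 0 x) 0 = E.frac 0 f (\<epsilon> r) k" "E.frac 0 f (L 0 x) 0 = E.frac 0 f (\<epsilon> s) k"
    using P(2) Q(2) C x eq rs unfolding weyl_lift_def by (auto simp: eps.loc_functor)
  then have "E.frac 0 f (K 0 x \<oplus>\<^bsub>E 0\<^esub> L 0 x) 0 = E.frac 0 f (\<epsilon> (r + s)) k"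
    using x eps.add[of r s] by (simp add: KL E.Loc_add_same_denom[symmetric])
  then show "E.frac 0 f (K 0 x \<oplus>\<^bsub>E 0\<^esub> L 0 x) 0 =
      loc_functor mpoly_ring f (E 0) \<epsilon> (weyl_loc_act f (\<lambda>p. P p + Q p) C)"
    using C by (simp add: weyl_loc_act_add[OF P(1) Q(1)] rs poly.Loc_add_same_denom eps.loc_functor)
qed

lemma weyl_lift_comp:
  assumes P: "P \<in> weyl_ops" "weyl_lift P K" and Q: "Q \<in> weyl_ops" "weyl_lift Q L"
  shows "weyl_lift (P \<circ> Q) (\<lambda>q x. K q (L q x))"
  unfolding weyl_lift_def
proof (intro conjI allI impI)
  have K: "chain_op K" and L: "chain_op L" using P Q by (auto simp: weyl_lift_def)
  show "chain_op (\<lambda>q x. K q (L q x))"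
    unfolding chain_op_def
    using chain_op_closed[OF K] chain_op_closed[OF L] chain_op_add[OF K] chain_op_add[OF L]
      chain_op_d[OF K] chain_op_d[OF L] chain_op_tors[OF K] chain_op_tors[OF L] by (simp add: subset_iff)
  fix f C x assume C: "C \<in> carrier (poly_loc f)" and x: "x \<in> carrier (E 0)"
    and eq: "E.frac 0 f x 0 = loc_functor mpoly_ring f (E 0) \<epsilon> C"
  have "E.frac 0 f (L 0 x) 0 = loc_functor mpoly_ring f (E 0) \<epsilon> (weyl_loc_act f Q C)"
    using Q(2) C x eq unfolding weyl_lift_def by blast
  then show "E.frac 0 f (K 0 (L 0 x)) 0 = loc_functor mpoly_ring f (E 0) \<epsilon> (weyl_loc_act f (P \<circ> Q) C)"
    using P(2) weyl_loc_act_closed[OF Q(1) C] chain_op_closed[OF L x] C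
    unfolding weyl_lift_def by (simp add: weyl_loc_act_comp[OF P(1) Q(1)])
qed

lemma weyl_lift_exists: "P \<in> weyl_ops \<Longrightarrow> \<exists>L. weyl_lift P L"
proof (induction rule: weyl_ops.induct)
  case (const c)
  show ?case using weyl_lift_smult[OF weyl_loc_rep.const] by blast
next
  case (var i)
  show ?case using weyl_lift_smult[OF weyl_loc_rep.var] by blast
next
  case (deriv i)
  show ?case by (rule weyl_lift_deriv)
next
  case (add P Q)
  then show ?case using weyl_lift_add by blast
next
  case (comp P Q)
  then show ?case using weyl_lift_comp by blast
qed

lemma weyl_lift_cech_corresponds:
  assumes L: "weyl_lift P L" and x: "x \<in> carrier (E i)"
    and c: "c \<in> cech_cochains mpoly_ring fs (self_module mpoly_ring) i"
    and corr: "cech_corresponds mpoly_ring E d \<epsilon> fs i x c"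
  shows "cech_corresponds mpoly_ring E d \<epsilon> fs i (L i x) (weyl_cech_act fs i P c)"
proof (rule chain_op_cech_corresponds[OF _ x corr])
  show "chain_op L" using L by (simp add: weyl_lift_def)
  fix S y assume S: "S \<in> cech_index fs i" and y: "y \<in> carrier (E 0)"
    "E.frac 0 (\<Prod>j\<in>S. fs ! j) y 0 = loc_functor mpoly_ring (\<Prod>j\<in>S. fs ! j) (E 0) \<epsilon> (c S)"
  have "c S \<in> carrier (poly_loc (\<Prod>j\<in>S. fs ! j))" using c S by (auto simp: cech_cochains_def)
  then show "E.frac 0 (\<Prod>j\<in>S. fs ! j) (L 0 y) 0 =
      loc_functor mpoly_ring (\<Prod>j\<in>S. fs ! j) (E 0) \<epsilon> (weyl_cech_act fs i P c S)"
    using L y S unfolding weyl_lift_def by (simp add: weyl_cech_act_def)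
qed

end

section \<open>Local cohomology as a module over the Weyl algebra\<close>

lemma Const_1: "Const 1 = 1"
  by (simp add: Const_def)

lemma Const_uminus_1: "Const (- 1) = - 1"
  by (simp add: Const_def single_uminus)

lemma id_in_weyl_ops: "(id :: ('n::finite, 'k::field_char_0) mpoly \<Rightarrow> _) \<in> weyl_ops"
proof -
  have "(\<lambda>p. Const 1 * p) = (id :: ('n, 'k) mpoly \<Rightarrow> _)" by (simp add: Const_1 fun_eq_iff)
  then show ?thesis using weyl_ops.const by metis
qed

lemma weyl_ops_add: "P \<in> weyl_ops \<Longrightarrow> P (p + q) = P p + P q"
  by (induction arbitrary: p q rule: weyl_ops.induct) (simp_all add: algebra_simps partial_deriv_add)

lemma weyl_algebra_simps [simp]:
  "carrier weyl_algebra = weyl_ops"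
  "P \<otimes>\<^bsub>weyl_algebra\<^esub> Q = P \<circ> Q" "P \<oplus>\<^bsub>weyl_algebra\<^esub> Q = (\<lambda>p. P p + Q p)"
  "\<one>\<^bsub>weyl_algebra\<^esub> = id" "\<zero>\<^bsub>weyl_algebra\<^esub> = (\<lambda>p. 0)"
  by (simp_all add: weyl_algebra_def)

lemma ring_weyl_algebra: "ring (weyl_algebra :: (('n::finite, 'k::field_char_0) mpoly \<Rightarrow> ('n, 'k) mpoly) ring)"
proof (rule ringI)
  have "(\<lambda>p. Const 0 * p) = (\<lambda>p. 0 :: ('n, 'k) mpoly)" by (simp add: Const_def fun_eq_iff)
  then have zero: "(\<lambda>p. 0 :: ('n, 'k) mpoly) \<in> weyl_ops" using weyl_ops.const by metis
  have inv: "\<exists>Q\<in>weyl_ops. (\<lambda>p. Q p + P p) = (\<lambda>p. 0)" if "P \<in> weyl_ops" for P :: "('n, 'k) mpoly \<Rightarrow> _"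
    by (rule bexI[OF _ weyl_ops.comp[OF weyl_ops.const[of "- 1"] that]])
      (simp add: Const_uminus_1)
  show "abelian_group (weyl_algebra :: (('n, 'k) mpoly \<Rightarrow> ('n, 'k) mpoly) ring)"
    by (rule abelian_groupI) (use zero inv in \<open>auto simp: ac_simps intro: weyl_ops.add\<close>)
  show "monoid (weyl_algebra :: (('n, 'k) mpoly \<Rightarrow> ('n, 'k) mpoly) ring)"
    by (rule monoidI) (auto simp: comp_assoc id_in_weyl_ops intro: weyl_ops.comp)
qed (auto simp: weyl_ops_add fun_eq_iff)

lemma left_module_dsum:
  assumes "left_module A M" "left_module A N"
  shows "left_module A (module_dsum M N)"
proof -
  interpret M: left_module A M by fact
  interpret N: left_module A N by fact
  have "abelian_group (module_dsum M N)"
  proof (rule abelian_groupI)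
    fix x assume "x \<in> carrier (module_dsum M N)"
    then show "\<exists>y\<in>carrier (module_dsum M N). y \<oplus>\<^bsub>module_dsum M N\<^esub> x = \<zero>\<^bsub>module_dsum M N\<^esub>"
      by (intro bexI[of _ "(\<ominus>\<^bsub>M\<^esub> fst x, \<ominus>\<^bsub>N\<^esub> snd x)"])
        (auto simp: module_dsum_def M.M.l_neg N.M.l_neg)
  qed (auto simp: module_dsum_def M.M.a_ac N.M.a_ac)
  then show ?thesis
    unfolding left_module_def left_module_axioms_def
    using M.A.ring_axioms
    by (auto simp: module_dsum_def M.smult_closed N.smult_closed M.smult_l_distr N.smult_l_distr
        M.smult_r_distr N.smult_r_distr M.smult_assoc N.smult_assoc M.smult_one N.smult_one)
qed

section \<open>Cohomology classes of the torsion subcomplexes\<close>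

context noetherian_resolution
begin

definition bnd :: "'a set \<Rightarrow> nat \<Rightarrow> 'e set" where
  "bnd I i = coboundaries (Gamma_complex rta E I) d i"

definition cyc :: "'a set \<Rightarrow> nat \<Rightarrow> 'e set" where
  "cyc I i = cocycles (Gamma_complex rta E I) d i"

definition cls :: "'a set \<Rightarrow> nat \<Rightarrow> 'e \<Rightarrow> 'e set" where
  "cls I i = coh_class (Gamma_complex rta E I) d i"

text \<open>Passing to \<Gamma>_I changes only the carrier, so cosets may be formed with the
  addition of \<open>E i\<close>, uniformly for all ideals.\<close>

lemma cls_eq: "cls I i x = bnd I i +>\<^bsub>E i\<^esub> x"
  by (simp add: cls_def bnd_def coh_class_def Gamma_complex_def Gamma_def a_r_coset_def r_coset_def)

context
  fixes I :: "'a set" assumes I: "ring_ideal I"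
begin

lemma mem_cyc_iff: "x \<in> cyc I i \<longleftrightarrow> x \<in> carrier (E i) \<and> I \<subseteq> E.tors i x \<and> d i x = \<zero>\<^bsub>E (Suc i)\<^esub>"
  using E.carrier_Gamma[OF acc I, of i]
  by (auto simp: cyc_def cocycles_def Gamma_complex_def) (simp_all add: Gamma_def)

lemma bnd_0: "bnd I 0 = {\<zero>\<^bsub>E 0\<^esub>}"
  by (simp add: bnd_def coboundaries_def Gamma_complex_def Gamma_def)

lemma mem_bnd_Suc_iff: "x \<in> bnd I (Suc q) \<longleftrightarrow> (\<exists>y\<in>carrier (E q). I \<subseteq> E.tors q y \<and> x = d q y)"
  using E.carrier_Gamma[OF acc I, of q] by (auto simp: bnd_def coboundaries_def Gamma_complex_def)

lemma bnd_subset_cyc: "bnd I i \<subseteq> cyc I i"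
proof
  fix x assume "x \<in> bnd I i"
  then show "x \<in> cyc I i"
    using d.tors by (cases i) (fastforce simp: mem_bnd_Suc_iff mem_cyc_iff bnd_0)+
qed

lemma cyc_subset: "cyc I i \<subseteq> carrier (E i)"
  by (auto simp: mem_cyc_iff)

lemma cyc_add: "x \<in> cyc I i \<Longrightarrow> y \<in> cyc I i \<Longrightarrow> x \<oplus>\<^bsub>E i\<^esub> y \<in> cyc I i"
  by (auto simp: mem_cyc_iff d.add intro!: E.tors_add)

lemma cyc_uminus: "x \<in> cyc I i \<Longrightarrow> \<ominus>\<^bsub>E i\<^esub> x \<in> cyc I i"
  by (auto simp: mem_cyc_iff d.uminus E.tors_uminus E.add.inv_one)

lemma cyc_zero: "\<zero>\<^bsub>E i\<^esub> \<in> cyc I i"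
  by (auto simp: mem_cyc_iff)

lemma bnd_uminus: "x \<in> bnd I i \<Longrightarrow> \<ominus>\<^bsub>E i\<^esub> x \<in> bnd I i"
proof (cases i)
  case (Suc q)
  assume "x \<in> bnd I i"
  then obtain y where "y \<in> carrier (E q)" "I \<subseteq> E.tors q y" "x = d q y" by (auto simp: Suc mem_bnd_Suc_iff)
  then show ?thesis
    unfolding Suc mem_bnd_Suc_iff
    by (intro bexI[of _ "\<ominus>\<^bsub>E q\<^esub> y"]) (auto simp: d.uminus E.tors_uminus)
qed (auto simp: bnd_0)

lemma bnd_add: "x \<in> bnd I i \<Longrightarrow> y \<in> bnd I i \<Longrightarrow> x \<oplus>\<^bsub>E i\<^esub> y \<in> bnd I i"
proof (cases i)
  case (Suc q)
  assume "x \<in> bnd I i" "y \<in> bnd I i"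
  then obtain u v where "u \<in> carrier (E q)" "I \<subseteq> E.tors q u" "x = d q u"
    "v \<in> carrier (E q)" "I \<subseteq> E.tors q v" "y = d q v" unfolding Suc mem_bnd_Suc_iff by blast
  then show ?thesis
    unfolding Suc mem_bnd_Suc_iff
    by (intro bexI[of _ "u \<oplus>\<^bsub>E q\<^esub> v"]) (auto simp: d.add intro!: E.tors_add)
qed (auto simp: bnd_0)

lemma bnd_zero: "\<zero>\<^bsub>E i\<^esub> \<in> bnd I i"
  using bnd_0 d.zero by (cases i) (auto simp: mem_bnd_Suc_iff intro!: bexI[of _ "\<zero>\<^bsub>E _\<^esub>"])

lemma abelian_subgroup_bnd: "abelian_subgroup (bnd I i) (E i)"
proof (rule abelian_subgroupI3[OF additive_subgroupI E.abelian_group_axioms])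
  show "subgroup (bnd I i) (add_monoid (E i))"
    by (rule E.add.subgroupI)
      (use bnd_subset_cyc cyc_subset bnd_zero bnd_uminus bnd_add in blast)+
qed

interpretation B: abelian_subgroup "bnd I i" "E i" for i
  by (rule abelian_subgroup_bnd)

lemma mem_cls_iff:
  assumes "x \<in> carrier (E i)" "y \<in> carrier (E i)"
  shows "y \<in> cls I i x \<longleftrightarrow> y \<ominus>\<^bsub>E i\<^esub> x \<in> bnd I i"
proof
  assume "y \<in> cls I i x"
  then obtain b where b: "b \<in> bnd I i" "y = b \<oplus>\<^bsub>E i\<^esub> x" by (auto simp: cls_eq a_r_coset_def')
  then have "b \<in> carrier (E i)" using bnd_subset_cyc cyc_subset by blast
  then have "y \<ominus>\<^bsub>E i\<^esub> x = b" using assms(1) by (simp add: b(2) E.minus_eq E.a_assoc E.r_neg)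
  then show "y \<ominus>\<^bsub>E i\<^esub> x \<in> bnd I i" using b(1) by simp
next
  assume "y \<ominus>\<^bsub>E i\<^esub> x \<in> bnd I i"
  moreover have "y = (y \<ominus>\<^bsub>E i\<^esub> x) \<oplus>\<^bsub>E i\<^esub> x"
    using assms by (simp add: E.minus_eq E.a_assoc E.l_neg)
  ultimately show "y \<in> cls I i x" by (auto simp: cls_eq a_r_coset_def')
qed

lemma cls_self: "x \<in> carrier (E i) \<Longrightarrow> x \<in> cls I i x"
  unfolding cls_eq by (rule B.a_rcos_self)

lemma cls_eqI:
  assumes "x \<in> carrier (E i)" "y \<in> carrier (E i)" "y \<ominus>\<^bsub>E i\<^esub> x \<in> bnd I i"
  shows "cls I i y = cls I i x"
  using E.a_repr_independence[OF _ assms(1) B.a_subgroup, of y] mem_cls_iff[OF assms(1,2)] assms(3)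
  by (simp add: cls_eq)

lemma mem_clsD:
  assumes "x \<in> cyc I i" "y \<in> cls I i x"
  shows "y \<in> cyc I i" "y \<ominus>\<^bsub>E i\<^esub> x \<in> bnd I i" "cls I i y = cls I i x"
proof -
  obtain b where b: "b \<in> bnd I i" "y = b \<oplus>\<^bsub>E i\<^esub> x" using assms(2) by (auto simp: cls_eq a_r_coset_def')
  then show y: "y \<in> cyc I i" using assms(1) bnd_subset_cyc cyc_add by blast
  then show "y \<ominus>\<^bsub>E i\<^esub> x \<in> bnd I i" using assms mem_cls_iff cyc_subset by blast
  then show "cls I i y = cls I i x" using y assms(1) cyc_subset by (intro cls_eqI) auto
qed

lemma cls_add:
  "x \<in> carrier (E i) \<Longrightarrow> y \<in> carrier (E i) \<Longrightarrow> cls I i x <+>\<^bsub>E i\<^esub> cls I i y = cls I i (x \<oplus>\<^bsub>E i\<^esub> y)"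
  unfolding cls_eq by (rule B.a_rcos_sum)

lemma cls_zero: "cls I i \<zero>\<^bsub>E i\<^esub> = bnd I i"
  unfolding cls_eq using B.a_subset by (rule E.a_coset_add_zero)

text \<open>Stated for any record with this additive structure, so that it applies to
  \<open>weyl_local_cohomology\<close>, where only the scalar multiplication is new.\<close>

lemma abelian_group_cls:
  assumes "carrier H = cls I i ` cyc I i" "add H = set_add (E i)" "ring.zero H = bnd I i"
  shows "abelian_group H"
proof -
  have c: "x \<in> carrier (E i)" if "x \<in> cyc I i" for x using that cyc_subset by blast
  have inv: "\<exists>y\<in>cyc I i. cls I i (y \<oplus>\<^bsub>E i\<^esub> x) = bnd I i" if "x \<in> cyc I i" for x
    using that c[OF that] cls_zero by (intro bexI[of _ "\<ominus>\<^bsub>E i\<^esub> x"]) (auto simp: E.l_neg cyc_uminus)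
  show ?thesis
  proof (rule abelian_groupI, unfold assms)
    show "bnd I i \<in> cls I i ` cyc I i" using cls_zero cyc_zero by (metis imageI)
    fix U assume "U \<in> cls I i ` cyc I i"
    then obtain x where x: "U = cls I i x" "x \<in> cyc I i" by blast
    show "bnd I i <+>\<^bsub>E i\<^esub> U = U"
      using x c cls_add[of "\<zero>\<^bsub>E i\<^esub>" i x] cls_zero by simp
    show "\<exists>V\<in>cls I i ` cyc I i. V <+>\<^bsub>E i\<^esub> U = bnd I i"
      using inv[OF x(2)] x c by (metis cls_add imageI)
    fix V assume "V \<in> cls I i ` cyc I i"
    then obtain y where y: "V = cls I i y" "y \<in> cyc I i" by blast
    show "U <+>\<^bsub>E i\<^esub> V \<in> cls I i ` cyc I i" using x y c by (auto simp: cls_add cyc_add)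
    show "U <+>\<^bsub>E i\<^esub> V = V <+>\<^bsub>E i\<^esub> U" using x y c by (simp add: cls_add E.a_comm)
    fix W assume "W \<in> cls I i ` cyc I i"
    then obtain z where z: "W = cls I i z" "z \<in> cyc I i" by blast
    show "U <+>\<^bsub>E i\<^esub> V <+>\<^bsub>E i\<^esub> W = U <+>\<^bsub>E i\<^esub> (V <+>\<^bsub>E i\<^esub> W)"
      using x y z c by (simp add: cls_add E.a_assoc)
  qed
qed

lemma chain_op_cyc: "chain_op L \<Longrightarrow> x \<in> cyc I i \<Longrightarrow> L i x \<in> cyc I i"
  using chain_op_tors[of L x i] chain_op_d[of L x i] chain_op_zero[of L "Suc i"]
  by (auto simp: mem_cyc_iff chain_op_closed)

lemma chain_op_bnd:
  assumes L: "chain_op L" and x: "x \<in> bnd I i" shows "L i x \<in> bnd I i"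
proof (cases i)
  case 0
  then show ?thesis using x chain_op_zero[OF L] by (simp add: bnd_0)
next
  case (Suc q)
  then obtain y where y: "y \<in> carrier (E q)" "I \<subseteq> E.tors q y" "x = d q y" using x by (auto simp: mem_bnd_Suc_iff)
  then show ?thesis
    unfolding Suc mem_bnd_Suc_iff
    using chain_op_tors[OF L y(1)] chain_op_d[OF L y(1)] chain_op_closed[OF L y(1)]
    by (intro bexI[of _ "L q y"]) auto
qed

lemma chain_op_cls_cong:
  assumes "chain_op L" "x \<in> cyc I i" "y \<in> cls I i x"
  shows "cls I i (L i y) = cls I i (L i x)"
proof -
  have c: "x \<in> carrier (E i)" "y \<in> carrier (E i)"
    using assms(2) mem_clsD(1)[OF assms(2,3)] cyc_subset by auto
  have "L i (y \<ominus>\<^bsub>E i\<^esub> x) \<in> bnd I i" by (rule chain_op_bnd[OF assms(1) mem_clsD(2)[OF assms(2,3)]])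
  then show ?thesis
    using c chain_op_closed[OF assms(1)] by (intro cls_eqI) (auto simp: chain_op_diff[OF assms(1)])
qed

end

lemma cyc_mono: "ring_ideal I \<Longrightarrow> ring_ideal J \<Longrightarrow> J \<subseteq> I \<Longrightarrow> cyc I i \<subseteq> cyc J i"
  by (auto simp: mem_cyc_iff subset_iff)

lemma bnd_mono:
  assumes I: "ring_ideal I" and J: "ring_ideal J" and "J \<subseteq> I"
  shows "bnd I i \<subseteq> bnd J i"
proof (cases i)
  case (Suc q)
  show ?thesis
    unfolding Suc subset_iff mem_bnd_Suc_iff[OF I] mem_bnd_Suc_iff[OF J] using assms(3) by blast
qed (simp add: bnd_0 I J)

text \<open>A smaller ideal has more boundaries, so the map on classes induced by the inclusion of
  \<Gamma>_I into \<Gamma>_J does not depend on representatives.\<close>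

lemma UN_cls:
  assumes "ring_ideal I" "ring_ideal J" "J \<subseteq> I" "x \<in> cyc I i"
  shows "(\<Union>y\<in>cls I i x. cls J i y) = cls J i x"
proof -
  have "bnd I i \<subseteq> bnd J i" using assms(1-3) by (rule bnd_mono)
  then have "cls J i y = cls J i x" if "y \<in> cls I i x" for y
    using mem_clsD[OF assms(1,4) that] assms(4) cyc_subset[OF assms(1)]
    by (intro cls_eqI[OF assms(2)]) auto
  moreover have "x \<in> cls I i x" using assms cyc_subset by (intro cls_self) auto
  ultimately show ?thesis by blast
qed

end

section \<open>The Weyl action on classes\<close>

context weyl_resolution
begin

lemma weyl_local_cohomology_simps:
  "carrier (weyl_local_cohomology E d \<epsilon> fs I i) = cls I i ` cyc I i"
  "add (weyl_local_cohomology E d \<epsilon> fs I i) = set_add (E i)"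
  "ring.zero (weyl_local_cohomology E d \<epsilon> fs I i) = bnd I i"
  by (simp_all add: weyl_local_cohomology_def local_cohomology_def cohomology_def Let_def
      cls_def cyc_def bnd_def Gamma_complex_def Gamma_def set_add_def set_mult_def fun_eq_iff)

text \<open>The transported action is computed by any lift. A Cech cocycle \<open>c\<close> joined
  to \<open>x\<close> exists, and \<open>L\<close> carries that staircase to one joining
  \<open>L x\<close> to \<open>P c\<close>; the remaining work is uniqueness of the described
  class.\<close>

lemma weyl_smult_cls:
  assumes I: "ring_ideal I" and fs: "Idl\<^bsub>mpoly_ring\<^esub> (set fs) = I"
    and L: "weyl_lift P L" and x: "x \<in> cyc I i"
  shows "P \<odot>\<^bsub>weyl_local_cohomology E d \<epsilon> fs I i\<^esub> cls I i x = cls I i (L i x)"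
proof -
  have chain: "chain_op L" using L by (simp add: weyl_lift_def)
  have fs_I: "set fs \<subseteq> I" using fs by (auto simp: genideal_def)
  have I_least: "I \<subseteq> J" if "ring_ideal J" "set fs \<subseteq> J" for J
    using that fs ideal_rta_iff[of J] by (auto simp: genideal_def)
  let ?Q = "\<lambda>V. V \<in> cls I i ` cyc I i \<and> (\<exists>y\<in>cls I i x. \<exists>z\<in>V.
      \<exists>c\<in>cech_cocycles mpoly_ring fs (self_module mpoly_ring) i.
        cech_corresponds mpoly_ring E d \<epsilon> fs i y c \<and>
        cech_corresponds mpoly_ring E d \<epsilon> fs i z (weyl_cech_act fs i P c))"
  have smult: "P \<odot>\<^bsub>weyl_local_cohomology E d \<epsilon> fs I i\<^esub> cls I i x = (THE V. ?Q V)"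
    by (simp add: weyl_local_cohomology_def Let_def local_cohomology_def cohomology_def
        cls_def cyc_def)
  also have "(THE V. ?Q V) = cls I i (L i x)"
  proof (rule the_equality)
    have xc: "x \<in> carrier (E i)" "d i x = \<zero>\<^bsub>E (Suc i)\<^esub>" "set fs \<subseteq> E.tors i x"
      using x fs_I by (auto simp: mem_cyc_iff[OF I])
    then obtain c where c: "c \<in> cech_cocycles mpoly_ring fs (self_module mpoly_ring) i"
      "cech_corresponds mpoly_ring E d \<epsilon> fs i x c" using cech_corresponds_exists by blast
    then have "cech_corresponds mpoly_ring E d \<epsilon> fs i (L i x) (weyl_cech_act fs i P c)"
      using weyl_lift_cech_corresponds[OF L xc(1)] by (auto simp: cech_cocycles_def)
    then show "?Q (cls I i (L i x))"
      using c chain_op_cyc[OF I chain x] xc(1) cls_self[OF I] chain_op_closed[OF chain xc(1)] by blast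
  next
    \<comment> \<open>Both \<open>z\<close> and \<open>L y\<close> are joined to the same Cech
      cochain, so they differ by a coboundary of an element that is torsion for
      \<open>set fs\<close>; as \<open>tors\<close> is an ideal, it is torsion for all of
      \<open>I\<close>.\<close>
    fix V assume "?Q V"
    then obtain v y z c where V: "V = cls I i v" "v \<in> cyc I i" "z \<in> V" and y: "y \<in> cls I i x"
      and c: "c \<in> cech_cocycles mpoly_ring fs (self_module mpoly_ring) i"
        "cech_corresponds mpoly_ring E d \<epsilon> fs i y c"
        "cech_corresponds mpoly_ring E d \<epsilon> fs i z (weyl_cech_act fs i P c)" by blast
    have yc: "y \<in> cyc I i" using mem_clsD(1)[OF I x y] .
    then have y': "y \<in> carrier (E i)" using cyc_subset[OF I] by blast
    have z: "z \<in> carrier (E i)" "cls I i z = V"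
      using mem_clsD(1,3)[OF I V(2)] V(1,3) cyc_subset[OF I] by blast+
    have Ly: "L i y \<in> carrier (E i)" by (rule chain_op_closed[OF chain y'])
    have "cech_corresponds mpoly_ring E d \<epsilon> fs i (L i y) (weyl_cech_act fs i P c)"
      using weyl_lift_cech_corresponds[OF L y' _ c(2)] c(1) by (auto simp: cech_cocycles_def)
    note unique = cech_corresponds_unique[OF z(1) Ly c(3) this]
    have "z \<ominus>\<^bsub>E i\<^esub> L i y \<in> bnd I i"
    proof (cases i)
      case (Suc q)
      then obtain u where "u \<in> carrier (E q)" "set fs \<subseteq> E.tors q u" "z \<ominus>\<^bsub>E i\<^esub> L i y = d q u"
        using unique by auto
      then show ?thesis
        unfolding Suc mem_bnd_Suc_iff[OF I] using I_least[OF E.ring_ideal_tors] by blast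
    qed (use unique Ly bnd_0[OF I] in auto)
    then have "V = cls I i (L i y)" using z Ly cls_eqI[OF I Ly z(1)] by simp
    then show "V = cls I i (L i x)" using chain_op_cls_cong[OF I chain x y] by simp
  qed
  finally show ?thesis .
qed

text \<open>Since any lift computes the action, each axiom is checked with a fitting one: the sum or
  the composite of two lifts, or multiplication by 1 for the identity.\<close>

lemma left_module_weyl_local_cohomology:
  assumes I: "ring_ideal I" and fs: "Idl\<^bsub>mpoly_ring\<^esub> (set fs) = I"
  shows "left_module weyl_algebra (weyl_local_cohomology E d \<epsilon> fs I i)"
  (is "left_module _ ?H")
proof -
  note simps = weyl_local_cohomology_simps[of fs I i]
  note smult = weyl_smult_cls[OF I fs]
  have c: "x \<in> carrier (E i)" if "x \<in> cyc I i" for x using that cyc_subset[OF I] by blast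
  have "left_module_axioms weyl_algebra ?H"
  proof (unfold left_module_axioms_def weyl_algebra_simps simps, intro conjI allI impI)
    fix P Q :: "('n, 'k) mpoly \<Rightarrow> ('n, 'k) mpoly" and U assume "P \<in> weyl_ops" "U \<in> cls I i ` cyc I i"
    then obtain x L where x: "U = cls I i x" "x \<in> cyc I i" and L: "weyl_lift P L"
      using weyl_lift_exists by blast
    have chain: "chain_op L" using L by (simp add: weyl_lift_def)
    note Lx = chain_op_cyc[OF I chain x(2)]
    show "P \<odot>\<^bsub>?H\<^esub> U \<in> cls I i ` cyc I i" using Lx by (simp add: x(1) smult[OF L x(2)])
    {
      fix V assume "V \<in> cls I i ` cyc I i"
      then obtain y where y: "V = cls I i y" "y \<in> cyc I i" by blast
      show "P \<odot>\<^bsub>?H\<^esub> (U <+>\<^bsub>E i\<^esub> V) = (P \<odot>\<^bsub>?H\<^esub> U) <+>\<^bsub>E i\<^esub> (P \<odot>\<^bsub>?H\<^esub> V)"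
        using x y c chain_op_cyc[OF I chain] chain_op_closed[OF chain] chain_op_add[OF chain]
        by (simp add: cls_add[OF I] smult[OF L] cyc_add[OF I])
    }
  next
    fix P Q :: "('n, 'k) mpoly \<Rightarrow> ('n, 'k) mpoly" and U
    assume PQ: "P \<in> weyl_ops" "Q \<in> weyl_ops" and "U \<in> cls I i ` cyc I i"
    then obtain x K L where x: "U = cls I i x" "x \<in> cyc I i" and K: "weyl_lift P K" and L: "weyl_lift Q L"
      using weyl_lift_exists by blast
    have chain: "chain_op K" "chain_op L" using K L by (simp_all add: weyl_lift_def)
    show "(\<lambda>p. P p + Q p) \<odot>\<^bsub>?H\<^esub> U = (P \<odot>\<^bsub>?H\<^esub> U) <+>\<^bsub>E i\<^esub> (Q \<odot>\<^bsub>?H\<^esub> U)"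
      using x c chain_op_closed[OF chain(1)] chain_op_closed[OF chain(2)]
      by (simp add: cls_add[OF I] smult[OF K] smult[OF L] smult[OF weyl_lift_add[OF PQ(1) K PQ(2) L]])
    show "(P \<circ> Q) \<odot>\<^bsub>?H\<^esub> U = P \<odot>\<^bsub>?H\<^esub> (Q \<odot>\<^bsub>?H\<^esub> U)"
      using x chain_op_cyc[OF I chain(2)]
      by (simp add: smult[OF K] smult[OF L] smult[OF weyl_lift_comp[OF PQ(1) K PQ(2) L]])
  next
    fix U assume "U \<in> cls I i ` cyc I i"
    then obtain x where x: "U = cls I i x" "x \<in> cyc I i" by blast
    have "weyl_lift id (\<lambda>q x. Const 1 \<odot>\<^bsub>E q\<^esub> x)"
      using weyl_lift_smult[OF weyl_loc_rep.const[of _ 1]] by (simp add: Const_1 id_def)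
    from smult[OF this x(2)] show "id \<odot>\<^bsub>?H\<^esub> U = U" using x c by (simp add: Const_1)
  qed
  then show ?thesis
    unfolding left_module_def
    using ring_weyl_algebra abelian_group_cls[OF I simps] by blast
qed

end

section \<open>The Mayer--Vietoris maps\<close>

lemma ring_ideal_set_add:
  fixes I J :: "'a::comm_ring_1 set"
  assumes I: "ring_ideal I" and J: "ring_ideal J"
  shows "ring_ideal (I <+>\<^bsub>rta\<^esub> J)" "I \<subseteq> I <+>\<^bsub>rta\<^esub> J"
    "J \<subseteq> I <+>\<^bsub>rta\<^esub> J"
    "ring_ideal A \<Longrightarrow> I \<subseteq> A \<Longrightarrow> J \<subseteq> A \<Longrightarrow> I <+>\<^bsub>rta\<^esub> J \<subseteq> A"
proof -
  interpret cring "rta :: 'a ring" by (rule cring_rta)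
  show "ring_ideal (I <+>\<^bsub>rta\<^esub> J)"
    using add_ideals[of I J] I J by (simp add: ideal_rta_iff)
  show "I \<subseteq> I <+>\<^bsub>rta\<^esub> J" "J \<subseteq> I <+>\<^bsub>rta\<^esub> J"
    using ring_idealD(1)[OF I] ring_idealD(1)[OF J] by (force simp: set_add_def')+
  show "ring_ideal A \<Longrightarrow> I \<subseteq> A \<Longrightarrow> J \<subseteq> A \<Longrightarrow> I <+>\<^bsub>rta\<^esub> J \<subseteq> A"
    by (auto simp: set_add_def' ring_idealD(2) subset_iff)
qed

section \<open>The three maps on representatives\<close>

context noetherian_resolution
begin

context
  fixes I J S N :: "'a set"
  assumes I: "ring_ideal I" and J: "ring_ideal J"
    and S_def: "S = I <+>\<^bsub>rta\<^esub> J" and N_def: "N = I \<inter> J"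
begin

lemma ring_ideal_S: "ring_ideal S" and S_upper: "I \<subseteq> S" "J \<subseteq> S"
  and S_least: "ring_ideal A \<Longrightarrow> I \<subseteq> A \<Longrightarrow> J \<subseteq> A \<Longrightarrow> S \<subseteq> A"
  unfolding S_def using ring_ideal_set_add[OF I J] by auto

lemma ring_ideal_N: "ring_ideal N" and N_lower: "N \<subseteq> I" "N \<subseteq> J"
  unfolding N_def using I J by (auto simp: ring_ideal_def)

lemma MV_rho_cls:
  assumes "x \<in> cyc S i"
  shows "MV_rho rta E d I J i (cls S i x) = (cls I i x, cls J i x)"
  unfolding MV_rho_def cls_def[symmetric]
  using UN_cls[OF ring_ideal_S I S_upper(1) assms] UN_cls[OF ring_ideal_S J S_upper(2) assms] by simp

lemma MV_pi_cls:
  assumes x: "x \<in> cyc I i" and y: "y \<in> cyc J i"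
  shows "MV_pi rta E d I J i (cls I i x, cls J i y) = cls N i (x \<ominus>\<^bsub>E i\<^esub> y)"
proof -
  have c: "x \<in> carrier (E i)" "y \<in> carrier (E i)" using x y cyc_subset I J by blast+
  have "cls N i (x' \<ominus>\<^bsub>E i\<^esub> y') = cls N i (x \<ominus>\<^bsub>E i\<^esub> y)" if "x' \<in> cls I i x" "y' \<in> cls J i y" for x' y'
  proof (rule cls_eqI[OF ring_ideal_N])
    have c': "x' \<in> carrier (E i)" "y' \<in> carrier (E i)"
      using mem_clsD(1)[OF I x that(1)] mem_clsD(1)[OF J y that(2)] cyc_subset I J by blast+
    have "x' \<ominus>\<^bsub>E i\<^esub> x \<in> bnd N i" "y' \<ominus>\<^bsub>E i\<^esub> y \<in> bnd N i"
      using mem_clsD(2)[OF I x that(1)] mem_clsD(2)[OF J y that(2)]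
        bnd_mono[OF I ring_ideal_N N_lower(1)] bnd_mono[OF J ring_ideal_N N_lower(2)] by blast+
    then have "(x' \<ominus>\<^bsub>E i\<^esub> x) \<oplus>\<^bsub>E i\<^esub> (\<ominus>\<^bsub>E i\<^esub> (y' \<ominus>\<^bsub>E i\<^esub> y)) \<in> bnd N i"
      by (intro bnd_add[OF ring_ideal_N] bnd_uminus[OF ring_ideal_N])
    also have "(x' \<ominus>\<^bsub>E i\<^esub> x) \<oplus>\<^bsub>E i\<^esub> (\<ominus>\<^bsub>E i\<^esub> (y' \<ominus>\<^bsub>E i\<^esub> y)) = (x' \<ominus>\<^bsub>E i\<^esub> y') \<ominus>\<^bsub>E i\<^esub> (x \<ominus>\<^bsub>E i\<^esub> y)"
      using c c' by (simp add: E.minus_eq E.minus_add E.a_ac)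
    finally show "(x' \<ominus>\<^bsub>E i\<^esub> y') \<ominus>\<^bsub>E i\<^esub> (x \<ominus>\<^bsub>E i\<^esub> y) \<in> bnd N i" .
    show "x \<ominus>\<^bsub>E i\<^esub> y \<in> carrier (E i)" "x' \<ominus>\<^bsub>E i\<^esub> y' \<in> carrier (E i)" using c c' by auto
  qed
  then have "(\<Union>x'\<in>cls I i x. \<Union>y'\<in>cls J i y. cls N i (x' \<ominus>\<^bsub>E i\<^esub> y')) =
      (\<Union>x'\<in>cls I i x. \<Union>y'\<in>cls J i y. cls N i (x \<ominus>\<^bsub>E i\<^esub> y))"
    by (intro SUP_cong refl)
  moreover have "x \<in> cls I i x" "y \<in> cls J i y" using c cls_self I J by blast+
  then have "cls I i x \<noteq> {}" "cls J i y \<noteq> {}" by blast+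
  ultimately show ?thesis by (simp add: MV_pi_def cls_def N_def)
qed

lemma split_difference:
  assumes "z \<in> carrier (E i)" "N \<subseteq> E.tors i z"
  obtains x y where "x \<in> carrier (E i)" "I \<subseteq> E.tors i x" "y \<in> carrier (E i)" "J \<subseteq> E.tors i y"
    "z = x \<ominus>\<^bsub>E i\<^esub> y"
proof -
  obtain x y where "x \<in> carrier (E i)" "y \<in> carrier (E i)" "z = x \<oplus>\<^bsub>E i\<^esub> y"
    "I \<subseteq> E.tors i x" "J \<subseteq> E.tors i y"
    using torsion_decomposition[OF assms(1) I J] assms(2) unfolding N_def by metis
  then show ?thesis by (intro that[of x "\<ominus>\<^bsub>E i\<^esub> y"]) (auto simp: E.tors_uminus E.minus_eq)
qed

text \<open>A primitive is split and \<open>d\<close> applied afterwards; in this order both parts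
  of the boundary are cocycles.\<close>

lemma bnd_split_difference:
  assumes "b \<in> bnd N i"
  obtains x y where "x \<in> carrier (E i)" "I \<subseteq> E.tors i x" "d i x = \<zero>\<^bsub>E (Suc i)\<^esub>"
    "y \<in> carrier (E i)" "J \<subseteq> E.tors i y" "d i y = \<zero>\<^bsub>E (Suc i)\<^esub>" "b = x \<ominus>\<^bsub>E i\<^esub> y"
proof (cases i)
  case 0
  then show ?thesis
    using assms that[of "\<zero>\<^bsub>E 0\<^esub>" "\<zero>\<^bsub>E 0\<^esub>"] by (simp add: bnd_0[OF ring_ideal_N])
next
  case (Suc q)
  then obtain u where u: "u \<in> carrier (E q)" "N \<subseteq> E.tors q u" "b = d q u"
    using assms by (auto simp: mem_bnd_Suc_iff[OF ring_ideal_N])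
  obtain x y where xy: "x \<in> carrier (E q)" "I \<subseteq> E.tors q x" "y \<in> carrier (E q)" "J \<subseteq> E.tors q y"
    "u = x \<ominus>\<^bsub>E q\<^esub> y" using split_difference[OF u(1,2)] .
  show ?thesis
    using xy u(3) d.tors[of x q] d.tors[of y q] by (intro that[of "d q x" "d q y"]) (auto simp: Suc d.diff)
qed

text \<open>The connecting map is a union over all admissible lifts of all representatives, so a
  single splitting computes it only once every choice is shown to give the same class. Since
  \<open>d z = 0\<close>, \<open>d x\<close> equals \<open>d y\<close> and is torsion for both
  ideals.\<close>

lemma MV_delta_cls:
  assumes z: "z \<in> cyc N i" "z = x \<ominus>\<^bsub>E i\<^esub> y"
    and x: "x \<in> carrier (E i)" "I \<subseteq> E.tors i x" and y: "y \<in> carrier (E i)" "J \<subseteq> E.tors i y"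
  shows "MV_delta rta E d I J i (cls N i z) = cls S (Suc i) (d i x)" (is ?delta)
    and "d i x \<in> cyc S (Suc i)" (is ?cyc)
proof -
  have "d i x \<ominus>\<^bsub>E (Suc i)\<^esub> d i y = \<zero>\<^bsub>E (Suc i)\<^esub>"
    using z(1) x y by (simp add: mem_cyc_iff[OF ring_ideal_N] z(2) d.diff)
  then have dxy: "d i x = d i y" using x y by (simp add: E.diff_eq_zero_iff)
  have S_tors: "S \<subseteq> E.tors q u" if "u \<in> carrier (E q)" "I \<subseteq> E.tors q u" "J \<subseteq> E.tors q u" for q u
    using that by (intro S_least E.ring_ideal_tors)
  have "I \<subseteq> E.tors (Suc i) (d i x)" "J \<subseteq> E.tors (Suc i) (d i x)"
    using x y d.tors[of x i] d.tors[of y i] dxy by auto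
  then have Sx: "S \<subseteq> E.tors (Suc i) (d i x)" using x by (intro S_tors) auto
  then show ?cyc using x by (simp add: mem_cyc_iff[OF ring_ideal_S])
  note Gamma = E.carrier_Gamma[OF acc]
  have Gamma_simps: "carrier (Gamma_complex rta E A q) = {x \<in> carrier (E q). A \<subseteq> E.tors q x}"
    if "ring_ideal A" for A q
    using Gamma[OF that] by (simp add: Gamma_complex_def)
  have zc: "z \<in> carrier (E i)" using x y z by simp
  have "cls S (Suc i) a = cls S (Suc i) (d i x)"
    if a: "a = d i x'" "a = d i y'" and x': "x' \<in> carrier (E i)" "I \<subseteq> E.tors i x'"
      and y': "y' \<in> carrier (E i)" "J \<subseteq> E.tors i y'" and mem: "x' \<ominus>\<^bsub>E i\<^esub> y' \<in> cls N i z" for a x' y'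
  proof -
    have "(x' \<ominus>\<^bsub>E i\<^esub> y') \<ominus>\<^bsub>E i\<^esub> z \<in> bnd N i" by (rule mem_clsD(2)[OF ring_ideal_N z(1) mem])
    then obtain u v where u: "u \<in> carrier (E i)" "I \<subseteq> E.tors i u" "d i u = \<zero>\<^bsub>E (Suc i)\<^esub>"
      and v: "v \<in> carrier (E i)" "J \<subseteq> E.tors i v" "d i v = \<zero>\<^bsub>E (Suc i)\<^esub>"
      and uv: "(x' \<ominus>\<^bsub>E i\<^esub> y') \<ominus>\<^bsub>E i\<^esub> z = u \<ominus>\<^bsub>E i\<^esub> v"
      by (rule bnd_split_difference)
    \<comment> \<open>The two expressions for \<open>e\<close> show torsion for \<open>I\<close> and
      for \<open>J\<close>, hence for their sum; as \<open>d u = 0\<close>, \<open>d e\<close> is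
      the difference of the two values.\<close>
    define e where "e = (x' \<ominus>\<^bsub>E i\<^esub> x) \<ominus>\<^bsub>E i\<^esub> u"
    have "e \<ominus>\<^bsub>E i\<^esub> ((y' \<ominus>\<^bsub>E i\<^esub> y) \<ominus>\<^bsub>E i\<^esub> v) = ((x' \<ominus>\<^bsub>E i\<^esub> y') \<ominus>\<^bsub>E i\<^esub> z) \<ominus>\<^bsub>E i\<^esub> (u \<ominus>\<^bsub>E i\<^esub> v)"
      using x y x' y' u v by (simp add: e_def z(2) E.minus_eq E.minus_add E.a_ac)
    also have "\<dots> = \<zero>\<^bsub>E i\<^esub>" unfolding uv using u v by simp
    finally have e: "e = (y' \<ominus>\<^bsub>E i\<^esub> y) \<ominus>\<^bsub>E i\<^esub> v"
      using x y x' y' u v by (simp add: E.diff_eq_zero_iff e_def)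
    have ec: "e \<in> carrier (E i)" using x x' u by (simp add: e_def)
    have "I \<subseteq> E.tors i e" unfolding e_def using x x' u by (auto intro!: E.tors_diff)
    moreover have "J \<subseteq> E.tors i e" unfolding e using y y' v by (auto intro!: E.tors_diff)
    ultimately have "S \<subseteq> E.tors i e" using ec by (intro S_tors)
    moreover have "d i x' \<ominus>\<^bsub>E (Suc i)\<^esub> d i x = d i e"
      using x x' u by (simp add: e_def d.diff)
    ultimately have "d i x' \<ominus>\<^bsub>E (Suc i)\<^esub> d i x \<in> bnd S (Suc i)"
      unfolding mem_bnd_Suc_iff[OF ring_ideal_S] using ec by blast
    then show ?thesis unfolding a(1) using x x' by (intro cls_eqI[OF ring_ideal_S]) auto
  qed
  note unique = this
  let ?X = "{cls S (Suc i) a | a b. a \<in> carrier (Gamma_complex rta E S (Suc i)) \<and>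
      b \<in> carrier (module_dsum (Gamma_complex rta E I i) (Gamma_complex rta E J i)) \<and>
      (case b of (x, y) \<Rightarrow> x \<ominus>\<^bsub>E i\<^esub> y) \<in> cls N i z \<and> map_prod (d i) (d i) b = (a, a)}"
  have "?X = {cls S (Suc i) (d i x)}"
  proof (intro equalityI subsetI)
    fix U assume "U \<in> ?X"
    then obtain a b where U: "U = cls S (Suc i) a"
      and b: "b \<in> carrier (module_dsum (Gamma_complex rta E I i) (Gamma_complex rta E J i))"
        "(case b of (x, y) \<Rightarrow> x \<ominus>\<^bsub>E i\<^esub> y) \<in> cls N i z" "map_prod (d i) (d i) b = (a, a)" by blast
    obtain x' y' where "b = (x', y')" by (cases b)
    then have "U = cls S (Suc i) (d i x)"
      using b unfolding U by (intro unique[of a x' y']) (auto simp: module_dsum_def Gamma_simps I J)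
    then show "U \<in> {cls S (Suc i) (d i x)}" by simp
  next
    fix U assume "U \<in> {cls S (Suc i) (d i x)}"
    then have U: "U = cls S (Suc i) (d i x)" by simp
    have "x \<ominus>\<^bsub>E i\<^esub> y \<in> cls N i z" using cls_self[OF ring_ideal_N zc] z(2) by simp
    then show "U \<in> ?X"
      unfolding U mem_Collect_eq using x y Sx dxy
      by (intro exI[of _ "d i x"] exI[of _ "(x, y)"])
        (simp add: module_dsum_def Gamma_simps I J ring_ideal_S)
  qed
  then show ?delta
    by (simp add: MV_delta_def connecting_hom_def cls_def S_def)
qed

end

end

section \<open>Linearity of the three maps\<close>

context weyl_resolution
begin

context
  fixes I J S N :: "('n, 'k) mpoly set" and fs_I fs_J fs_S fs_N :: "('n, 'k) mpoly list"
  assumes I: "ring_ideal I" and J: "ring_ideal J"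
    and S_def: "S = I <+>\<^bsub>mpoly_ring\<^esub> J" and N_def: "N = I \<inter> J"
    and gens: "Idl\<^bsub>mpoly_ring\<^esub> (set fs_I) = I" "Idl\<^bsub>mpoly_ring\<^esub> (set fs_J) = J"
      "Idl\<^bsub>mpoly_ring\<^esub> (set fs_S) = S" "Idl\<^bsub>mpoly_ring\<^esub> (set fs_N) = N"
begin

private lemmas S = ring_ideal_S[OF I J S_def N_def]
private lemmas N = ring_ideal_N[OF I J S_def N_def]
private lemmas smult = weyl_smult_cls[OF I gens(1)] weyl_smult_cls[OF J gens(2)]
  weyl_smult_cls[OF S gens(3)] weyl_smult_cls[OF N gens(4)]

lemma dsum_simps:
  "carrier (module_dsum A B) = carrier A \<times> carrier B"
  "(x, y) \<oplus>\<^bsub>module_dsum A B\<^esub> (x', y') = (x \<oplus>\<^bsub>A\<^esub> x', y \<oplus>\<^bsub>B\<^esub> y')"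
  "a \<odot>\<^bsub>module_dsum A B\<^esub> (x, y) = (a \<odot>\<^bsub>A\<^esub> x, a \<odot>\<^bsub>B\<^esub> y)"
  by (simp_all add: module_dsum_def)

lemma MV_rho_linear:
  "MV_rho mpoly_ring E d I J i \<in> linear_maps weyl_algebra (weyl_local_cohomology E d \<epsilon> fs_S S i)
    (module_dsum (weyl_local_cohomology E d \<epsilon> fs_I I i) (weyl_local_cohomology E d \<epsilon> fs_J J i))"
  unfolding linear_maps_def weyl_algebra_simps weyl_local_cohomology_simps dsum_simps mem_Collect_eq
proof (intro conjI ballI funcsetI)
  note rho = MV_rho_cls[OF I J S_def N_def]
  have sub: "cyc S i \<subseteq> cyc I i" "cyc S i \<subseteq> cyc J i"
    using cyc_mono[OF S I] cyc_mono[OF S J] S_upper[OF I J S_def N_def] by blast+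
  fix U assume "U \<in> cls S i ` cyc S i"
  then obtain x where x: "U = cls S i x" "x \<in> cyc S i" by blast
  show "MV_rho mpoly_ring E d I J i U \<in> cls I i ` cyc I i \<times> cls J i ` cyc J i"
    using x sub by (auto simp: rho)
  have c: "x \<in> carrier (E i)" if "x \<in> cyc S i" for x using that cyc_subset[OF S] by blast
  {
    fix V assume "V \<in> cls S i ` cyc S i"
    then obtain y where y: "V = cls S i y" "y \<in> cyc S i" by blast
    show "MV_rho mpoly_ring E d I J i (U <+>\<^bsub>E i\<^esub> V) = MV_rho mpoly_ring E d I J i U
        \<oplus>\<^bsub>module_dsum (weyl_local_cohomology E d \<epsilon> fs_I I i) (weyl_local_cohomology E d \<epsilon> fs_J J i)\<^esub>
        MV_rho mpoly_ring E d I J i V"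
      using x y c cyc_add[OF S]
      by (simp add: rho cls_add[OF S] cls_add[OF I] cls_add[OF J] dsum_simps weyl_local_cohomology_simps)
  }
  fix P :: "('n, 'k) mpoly \<Rightarrow> ('n, 'k) mpoly" assume "P \<in> weyl_ops"
  then obtain L where L: "weyl_lift P L" using weyl_lift_exists by blast
  then have "L i x \<in> cyc S i" using chain_op_cyc[OF S _ x(2)] by (simp add: weyl_lift_def)
  moreover have "x \<in> cyc I i" "x \<in> cyc J i" using x sub by auto
  ultimately show "MV_rho mpoly_ring E d I J i (P \<odot>\<^bsub>weyl_local_cohomology E d \<epsilon> fs_S S i\<^esub> U) =
      P \<odot>\<^bsub>module_dsum (weyl_local_cohomology E d \<epsilon> fs_I I i) (weyl_local_cohomology E d \<epsilon> fs_J J i)\<^esub>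
      MV_rho mpoly_ring E d I J i U"
    using x by (simp add: rho smult[OF L] dsum_simps)
qed

lemma MV_pi_linear:
  "MV_pi mpoly_ring E d I J i \<in> linear_maps weyl_algebra
    (module_dsum (weyl_local_cohomology E d \<epsilon> fs_I I i) (weyl_local_cohomology E d \<epsilon> fs_J J i))
    (weyl_local_cohomology E d \<epsilon> fs_N N i)"
  unfolding linear_maps_def weyl_algebra_simps weyl_local_cohomology_simps dsum_simps mem_Collect_eq
proof (intro conjI ballI funcsetI)
  note pi = MV_pi_cls[OF I J S_def N_def]
  let ?D = "module_dsum (weyl_local_cohomology E d \<epsilon> fs_I I i) (weyl_local_cohomology E d \<epsilon> fs_J J i)"
  have c: "x \<in> carrier (E i)" if "x \<in> cyc I i \<or> x \<in> cyc J i" for x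
    using that cyc_subset[OF I] cyc_subset[OF J] by blast
  have N_cyc: "x \<ominus>\<^bsub>E i\<^esub> y \<in> cyc N i" if "x \<in> cyc I i" "y \<in> cyc J i" for x y
    using that cyc_mono[OF I N N_lower(1)[OF I J S_def N_def]] cyc_mono[OF J N N_lower(2)[OF I J S_def N_def]]
    unfolding E.minus_eq by (intro cyc_add[OF N] cyc_uminus[OF N]) auto
  fix U assume "U \<in> cls I i ` cyc I i \<times> cls J i ` cyc J i"
  then obtain x y where x: "U = (cls I i x, cls J i y)" "x \<in> cyc I i" "y \<in> cyc J i" by blast
  show "MV_pi mpoly_ring E d I J i U \<in> cls N i ` cyc N i"
    using x N_cyc by (simp add: pi)
  {
    fix V assume "V \<in> cls I i ` cyc I i \<times> cls J i ` cyc J i"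
    then obtain x' y' where x': "V = (cls I i x', cls J i y')" "x' \<in> cyc I i" "y' \<in> cyc J i" by blast
    have "MV_pi mpoly_ring E d I J i (U \<oplus>\<^bsub>?D\<^esub> V) = cls N i ((x \<oplus>\<^bsub>E i\<^esub> x') \<ominus>\<^bsub>E i\<^esub> (y \<oplus>\<^bsub>E i\<^esub> y'))"
      using x x' c cyc_add[OF I] cyc_add[OF J]
      by (simp add: pi dsum_simps weyl_local_cohomology_simps cls_add[OF I] cls_add[OF J])
    also have "(x \<oplus>\<^bsub>E i\<^esub> x') \<ominus>\<^bsub>E i\<^esub> (y \<oplus>\<^bsub>E i\<^esub> y') = (x \<ominus>\<^bsub>E i\<^esub> y) \<oplus>\<^bsub>E i\<^esub> (x' \<ominus>\<^bsub>E i\<^esub> y')"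
      using x x' c by (intro E.add_diff_swap) auto
    finally show "MV_pi mpoly_ring E d I J i (U \<oplus>\<^bsub>?D\<^esub> V) =
        MV_pi mpoly_ring E d I J i U <+>\<^bsub>E i\<^esub> MV_pi mpoly_ring E d I J i V"
      using x x' c by (simp add: pi cls_add[OF N])
  }
  fix P :: "('n, 'k) mpoly \<Rightarrow> ('n, 'k) mpoly" assume "P \<in> weyl_ops"
  then obtain L where L: "weyl_lift P L" using weyl_lift_exists by blast
  then have chain: "chain_op L" by (simp add: weyl_lift_def)
  show "MV_pi mpoly_ring E d I J i (P \<odot>\<^bsub>?D\<^esub> U) =
      P \<odot>\<^bsub>weyl_local_cohomology E d \<epsilon> fs_N N i\<^esub> MV_pi mpoly_ring E d I J i U"
    using x c N_cyc chain_op_cyc[OF I chain] chain_op_cyc[OF J chain]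
    by (simp add: pi dsum_simps smult[OF L] chain_op_diff[OF chain])
qed

text \<open>A splitting \<open>z = x - y\<close> is carried by a lift to a splitting of
  \<open>L z\<close> of the same kind, so the claim reduces to
  \<open>d (L x) = L (d x)\<close>.\<close>

lemma MV_delta_linear:
  "MV_delta mpoly_ring E d I J i \<in> linear_maps weyl_algebra
    (weyl_local_cohomology E d \<epsilon> fs_N N i) (weyl_local_cohomology E d \<epsilon> fs_S S (Suc i))"
  unfolding linear_maps_def weyl_algebra_simps weyl_local_cohomology_simps mem_Collect_eq
proof (intro conjI ballI funcsetI)
  note delta = MV_delta_cls[OF I J S_def N_def]
  have split: "\<exists>z x y. U = cls N i z \<and> z \<in> cyc N i \<and> z = x \<ominus>\<^bsub>E i\<^esub> y \<and>
      x \<in> carrier (E i) \<and> I \<subseteq> E.tors i x \<and> y \<in> carrier (E i) \<and> J \<subseteq> E.tors i y"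
    if U: "U \<in> cls N i ` cyc N i" for U
  proof -
    obtain z where z: "U = cls N i z" "z \<in> cyc N i" using U by blast
    then have "z \<in> carrier (E i)" "N \<subseteq> E.tors i z" by (auto simp: mem_cyc_iff[OF N])
    from split_difference[OF I J S_def N_def this] show ?thesis using z by metis
  qed
  fix U assume "U \<in> cls N i ` cyc N i"
  from split[OF this] obtain z x y where U: "U = cls N i z" and z: "z \<in> cyc N i" "z = x \<ominus>\<^bsub>E i\<^esub> y"
    and x: "x \<in> carrier (E i)" "I \<subseteq> E.tors i x" and y: "y \<in> carrier (E i)" "J \<subseteq> E.tors i y" by blast
  note delta_U = delta[OF z x y]
  show "MV_delta mpoly_ring E d I J i U \<in> cls S (Suc i) ` cyc S (Suc i)"
    unfolding U delta_U(1) using delta_U(2) by blast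
  {
    fix V assume "V \<in> cls N i ` cyc N i"
    from split[OF this] obtain z' x' y' where V: "V = cls N i z'"
      and z': "z' \<in> cyc N i" "z' = x' \<ominus>\<^bsub>E i\<^esub> y'"
      and x': "x' \<in> carrier (E i)" "I \<subseteq> E.tors i x'" and y': "y' \<in> carrier (E i)" "J \<subseteq> E.tors i y'" by blast
    note delta_V = delta[OF z' x' y']
    have eq: "z \<oplus>\<^bsub>E i\<^esub> z' = (x \<oplus>\<^bsub>E i\<^esub> x') \<ominus>\<^bsub>E i\<^esub> (y \<oplus>\<^bsub>E i\<^esub> y')"
      unfolding z(2) z'(2) using x y x' y' by (intro E.add_diff_swap[symmetric]) auto
    have "MV_delta mpoly_ring E d I J i (cls N i (z \<oplus>\<^bsub>E i\<^esub> z')) = cls S (Suc i) (d i (x \<oplus>\<^bsub>E i\<^esub> x'))"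
      by (rule delta(1)[OF cyc_add[OF N z(1) z'(1)] eq])
        (use x y x' y' in \<open>auto intro!: E.tors_add\<close>)
    also have "\<dots> = cls S (Suc i) (d i x) <+>\<^bsub>E (Suc i)\<^esub> cls S (Suc i) (d i x')"
      using x x' by (simp add: d.add cls_add[OF S])
    moreover have "z \<in> carrier (E i)" "z' \<in> carrier (E i)" using z(1) z'(1) cyc_subset[OF N] by blast+
    ultimately show "MV_delta mpoly_ring E d I J i (U <+>\<^bsub>E i\<^esub> V) =
        MV_delta mpoly_ring E d I J i U <+>\<^bsub>E (Suc i)\<^esub> MV_delta mpoly_ring E d I J i V"
      unfolding U V delta_U(1) delta_V(1) by (simp add: cls_add[OF N])
  }
  fix P :: "('n, 'k) mpoly \<Rightarrow> ('n, 'k) mpoly" assume "P \<in> weyl_ops"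
  then obtain L where L: "weyl_lift P L" using weyl_lift_exists by blast
  then have chain: "chain_op L" by (simp add: weyl_lift_def)
  have Lz: "L i z = L i x \<ominus>\<^bsub>E i\<^esub> L i y" using x y by (simp add: z(2) chain_op_diff[OF chain])
  have "MV_delta mpoly_ring E d I J i (cls N i (L i z)) = cls S (Suc i) (d i (L i x))"
    by (rule delta(1)[OF chain_op_cyc[OF N chain z(1)] Lz])
      (use x y chain_op_tors[OF chain] chain_op_closed[OF chain] in blast)+
  then show "MV_delta mpoly_ring E d I J i (P \<odot>\<^bsub>weyl_local_cohomology E d \<epsilon> fs_N N i\<^esub> U) =
      P \<odot>\<^bsub>weyl_local_cohomology E d \<epsilon> fs_S S (Suc i)\<^esub> MV_delta mpoly_ring E d I J i U"
    unfolding U delta_U(1) smult(4)[OF L z(1)] smult(3)[OF L delta_U(2)]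
    using x by (simp add: chain_op_d[OF chain])
qed

end

end

theorem proposition3p3:
  fixes I J :: "('n::finite, 'k::field_char_0) mpoly set"
    and E :: "nat \<Rightarrow> (('n, 'k) mpoly, 'e) module" and d :: "nat \<Rightarrow> 'e \<Rightarrow> 'e"
    and \<epsilon> :: "('n, 'k) mpoly \<Rightarrow> 'e"
    and fs_I fs_J fs_sum fs_int :: "('n, 'k) mpoly list"
    and i :: nat
  assumes "ideal I mpoly_ring" and "ideal J mpoly_ring"
    and "injective_resolution mpoly_ring (self_module mpoly_ring) E d \<epsilon>"
    and "Idl\<^bsub>mpoly_ring\<^esub> (set fs_I) = I" and "Idl\<^bsub>mpoly_ring\<^esub> (set fs_J) = J"
    and "Idl\<^bsub>mpoly_ring\<^esub> (set fs_sum) = I <+>\<^bsub>mpoly_ring\<^esub> J"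
    and "Idl\<^bsub>mpoly_ring\<^esub> (set fs_int) = I \<inter> J"
  shows "let H_I = weyl_local_cohomology E d \<epsilon> fs_I I;
      H_J = weyl_local_cohomology E d \<epsilon> fs_J J;
      H_sum = weyl_local_cohomology E d \<epsilon> fs_sum (I <+>\<^bsub>mpoly_ring\<^esub> J);
      H_int = weyl_local_cohomology E d \<epsilon> fs_int (I \<inter> J)
    in left_module weyl_algebra (H_sum i) \<and>
      left_module weyl_algebra (module_dsum (H_I i) (H_J i)) \<and>
      left_module weyl_algebra (H_int i) \<and>
      MV_rho mpoly_ring E d I J i \<in> linear_maps weyl_algebra (H_sum i) (module_dsum (H_I i) (H_J i)) \<and>
      MV_pi mpoly_ring E d I J i \<in> linear_maps weyl_algebra (module_dsum (H_I i) (H_J i)) (H_int i) \<and>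
      MV_delta mpoly_ring E d I J i \<in> linear_maps weyl_algebra (H_int i) (H_sum (Suc i))"
proof -
  interpret weyl_resolution E d \<epsilon>
    unfolding weyl_resolution_def noetherian_resolution_def noetherian_resolution_axioms_def
    using assms(3) acc_ideals_mpoly by blast
  have I: "ring_ideal I" and J: "ring_ideal J" using assms(1,2) by (simp_all add: ideal_rta_iff)
  note gens = assms(4-7)
  note S = ring_ideal_S[OF I J refl refl] and N = ring_ideal_N[OF I J refl refl]
  show ?thesis
    unfolding Let_def
    using left_module_weyl_local_cohomology[OF S gens(3)]
      left_module_dsum[OF left_module_weyl_local_cohomology[OF I gens(1)]
        left_module_weyl_local_cohomology[OF J gens(2)]]
      left_module_weyl_local_cohomology[OF N gens(4)]
      MV_rho_linear[OF I J refl refl gens] MV_pi_linear[OF I J refl refl gens]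
      MV_delta_linear[OF I J refl refl gens] by blast
qed

end
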